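(* The spectral quasiorder is a cut distance identifying graphon order. That is, given two graphons $U,W$: (a) if $\delta_\square(U,W)=0$, then the spectra of $U$ and $W$ are the same (i.e. $\lambda_i^+(U)=\lambda_i^+(W)$ and $\lambda_i^-(U)=\lambda_i^-(W)$ for all $i$), and (b) if $U\prec W$, then $\lambda_i^+(U)\le\lambda_i^+(W)$ and $\lambda_i^-(U)\ge\lambda_i^-(W)$ for all $i=1,2,3,\ldots$, and at least one of these inequalities is strict.
   Context: $\Omega$ is a standard Borel space with an atomless probability measure $\nu$. A graphon is a symmetric measurable function $W:\Omega^2\to[0,1]$ (modulo null sets). For a measure preserving bijection $\varphi:\Omega\to\Omega$ put $W^\varphi(x,y)=W(\varphi(x),\varphi(y))$. The cut norm is $\|Y\|_\square=\sup_{S,T\subset\Omega}|\int_{S\times T}Y|$ and the cut distance is $\delta_\square(U,W)=\inf_\varphi\|U-W^\varphi\|_\square$ over measure preserving bijections $\varphi$ of $\Omega$. Graphons $\Gamma_n$ converge weak* to $W$ if $\int_{S\times T}\Gamma_n\to\int_{S\times T}W$ for all measurable $S,T\subset\Omega$. The envelope $\langle W\rangle$ is the set of all graphons $U$ for which there are measure preserving bijections $\pi_1,\pi_2,\ldots$ of $\Omega$ with $W^{\pi_n}\to U$ weak*. Write $U\preceq W$ if $\langle U\rangle\subset\langle W\rangle$, and $U\prec W$ if $U\preceq W$ but not $W\preceq U$. A graphon $W$ induces the self-adjoint Hilbert–Schmidt operator $T_W$ on the real Hilbert space $L^2(\Omega)$, $(T_Wf)(x)=\int_yW(x,y)f(y)$.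 Its positive eigenvalues, listed with multiplicity in non-increasing order, are $\lambda_1^+(W)\ge\lambda_2^+(W)\ge\dots\ge0$, and its negative eigenvalues, listed with multiplicity in non-decreasing order, are $\lambda_1^-(W)\le\lambda_2^-(W)\le\dots\le0$; each list is padded by zeros if finite. The spectral quasiorder puts $W$ below $U$ if $\lambda_i^+(W)\le\lambda_i^+(U)$ and $\lambda_i^-(W)\ge\lambda_i^-(U)$ for all $i$, and strictly below if moreover at least one of these inequalities is strict. A graphon order is a preorder on graphons for which graphons at cut distance $0$ are below each other; it is cut distance identifying if $U\prec W$ implies that $U$ is below $W$ and $W$ is not below $U$. *)

theory Defs
  imports "HOL-Probability.Probability" "HOL-Library.Extended_Nat"
begin

section \<open>Atomless standard Borel probability spaces\<close>

definition standard_borel_space :: "'a measure \<Rightarrow> bool" where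
  "standard_borel_space M \<longleftrightarrow>
     (\<exists>T. completely_metrizable_space T \<and> second_countable T \<and>
          space M = topspace T \<and> sets M = sigma_sets (topspace T) {U. openin T U})"

definition atomless :: "'a measure \<Rightarrow> bool" where
  "atomless M \<longleftrightarrow>
     \<not> (\<exists>A\<in>sets M. measure M A > 0 \<and>
          (\<forall>B\<in>sets M. B \<subseteq> A \<longrightarrow> measure M B = 0 \<or> measure M B = measure M A))"

text \<open>
  A measure preserving bijection is an automorphism of the probability space: the map and its
  inverse are measurable. (On a standard Borel space measurability of the inverse
  is automatic, by the Lusin-Souslin theorem.)
\<close>

definition mp_bijection :: "'a measure \<Rightarrow> ('a \<Rightarrow> 'a) \<Rightarrow> bool" where
  "mp_bijection M \<phi> \<longleftrightarrow>
     bij_betw \<phi> (space M) (space M) \<and>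
     \<phi> \<in> measurable M M \<and> the_inv_into (space M) \<phi> \<in> measurable M M \<and>
     (\<forall>A\<in>sets M. emeasure M (\<phi> -` A \<inter> space M) = emeasure M A)"


section \<open>Graphons, cut distance and envelopes\<close>

text \<open>
  Graphons are handled through representatives. Every notion below depends only on the class of
  a representative modulo null sets, and its values outside \<^term>\<open>space M \<times> space M\<close> are
  irrelevant.
\<close>

definition graphon :: "'a measure \<Rightarrow> ('a \<times> 'a \<Rightarrow> real) \<Rightarrow> bool" where
  "graphon M W \<longleftrightarrow>
     W \<in> borel_measurable (M \<Otimes>\<^sub>M M) \<and>
     (\<forall>x\<in>space M. \<forall>y\<in>space M. W (x, y) = W (y, x) \<and> 0 \<le> W (x, y) \<and> W (x, y) \<le> 1)"

definition version :: "('a \<times> 'a \<Rightarrow> real) \<Rightarrow> ('a \<Rightarrow> 'a) \<Rightarrow> 'a \<times> 'a \<Rightarrow> real" where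
  "version W \<phi> = (\<lambda>(x, y). W (\<phi> x, \<phi> y))"

definition cut_norm :: "'a measure \<Rightarrow> ('a \<times> 'a \<Rightarrow> real) \<Rightarrow> real" where
  "cut_norm M Y =
     (SUP (S, T)\<in>sets M \<times> sets M. \<bar>set_lebesgue_integral (M \<Otimes>\<^sub>M M) (S \<times> T) Y\<bar>)"

definition cut_dist :: "'a measure \<Rightarrow> ('a \<times> 'a \<Rightarrow> real) \<Rightarrow> ('a \<times> 'a \<Rightarrow> real) \<Rightarrow> real" where
  "cut_dist M U W =
     (INF \<phi>\<in>{\<phi>. mp_bijection M \<phi>}. cut_norm M (\<lambda>z. U z - version W \<phi> z))"

definition weak_star_conv ::
  "'a measure \<Rightarrow> (nat \<Rightarrow> 'a \<times> 'a \<Rightarrow> real) \<Rightarrow> ('a \<times> 'a \<Rightarrow> real) \<Rightarrow> bool" where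
  "weak_star_conv M \<Gamma> W \<longleftrightarrow>
     (\<forall>S\<in>sets M. \<forall>T\<in>sets M.
        (\<lambda>n. set_lebesgue_integral (M \<Otimes>\<^sub>M M) (S \<times> T) (\<Gamma> n))
          \<longlonglongrightarrow> set_lebesgue_integral (M \<Otimes>\<^sub>M M) (S \<times> T) W)"

definition envelope :: "'a measure \<Rightarrow> ('a \<times> 'a \<Rightarrow> real) \<Rightarrow> ('a \<times> 'a \<Rightarrow> real) set" where
  "envelope M W =
     {U. graphon M U \<and>
         (\<exists>\<pi>. (\<forall>n. mp_bijection M (\<pi> n)) \<and> weak_star_conv M (\<lambda>n. version W (\<pi> n)) U)}"

definition env_le :: "'a measure \<Rightarrow> ('a \<times> 'a \<Rightarrow> real) \<Rightarrow> ('a \<times> 'a \<Rightarrow> real) \<Rightarrow> bool" where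
  "env_le M U W \<longleftrightarrow> envelope M U \<subseteq> envelope M W"

definition env_less :: "'a measure \<Rightarrow> ('a \<times> 'a \<Rightarrow> real) \<Rightarrow> ('a \<times> 'a \<Rightarrow> real) \<Rightarrow> bool" where
  "env_less M U W \<longleftrightarrow> env_le M U W \<and> \<not> env_le M W U"


section \<open>The spectrum of a graphon\<close>

definition L2_fun :: "'a measure \<Rightarrow> ('a \<Rightarrow> real) \<Rightarrow> bool" where
  "L2_fun M f \<longleftrightarrow> f \<in> borel_measurable M \<and> integrable M (\<lambda>x. (f x)\<^sup>2)"

definition graphon_op :: "'a measure \<Rightarrow> ('a \<times> 'a \<Rightarrow> real) \<Rightarrow> ('a \<Rightarrow> real) \<Rightarrow> 'a \<Rightarrow> real" where
  "graphon_op M W f = (\<lambda>x. \<integral>y. W (x, y) * f y \<partial>M)"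

definition eigenfunction ::
  "'a measure \<Rightarrow> ('a \<times> 'a \<Rightarrow> real) \<Rightarrow> real \<Rightarrow> ('a \<Rightarrow> real) \<Rightarrow> bool" where
  "eigenfunction M W t f \<longleftrightarrow> L2_fun M f \<and> (AE x in M. graphon_op M W f x = t * f x)"

text \<open>Linear independence of \<open>f 0, \<dots>, f (n - 1)\<close> as elements of the space of functions modulo null sets.\<close>

definition independent_mod_null :: "'a measure \<Rightarrow> nat \<Rightarrow> (nat \<Rightarrow> 'a \<Rightarrow> real) \<Rightarrow> bool" where
  "independent_mod_null M n f \<longleftrightarrow>
     (\<forall>c :: nat \<Rightarrow> real. (AE x in M. (\<Sum>i<n. c i * f i x) = 0) \<longrightarrow> (\<forall>i<n. c i = 0))"

text \<open>
  The dimension of the eigenspace of \<^term>\<open>t\<close> in \<open>L\<^sup>2\<close>; it is \<open>0\<close> if \<^term>\<open>t\<close> is not an eigenvalue.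
\<close>

definition eig_mult :: "'a measure \<Rightarrow> ('a \<times> 'a \<Rightarrow> real) \<Rightarrow> real \<Rightarrow> enat" where
  "eig_mult M W t =
     Sup {enat n | n. \<exists>f. (\<forall>i<n. eigenfunction M W t (f i)) \<and> independent_mod_null M n f}"

text \<open>
  The following two predicates each determine the sequence \<^term>\<open>l\<close> uniquely:
  monotonicity, and the requirement that each nonzero value of the relevant sign
  occurs exactly as often as its multiplicity, force the remaining entries (if any) to be a tail of
  zeros. Such a sequence exists because \<^term>\<open>graphon_op M W\<close> is compact and self-adjoint.
\<close>

definition pos_eig_list :: "'a measure \<Rightarrow> ('a \<times> 'a \<Rightarrow> real) \<Rightarrow> (nat \<Rightarrow> real) \<Rightarrow> bool" where
  "pos_eig_list M W l \<longleftrightarrow>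
     decseq l \<and> (\<forall>i. 0 \<le> l i) \<and>
     (\<forall>t>0. finite {i. l i = t} \<and> enat (card {i. l i = t}) = eig_mult M W t)"

definition neg_eig_list :: "'a measure \<Rightarrow> ('a \<times> 'a \<Rightarrow> real) \<Rightarrow> (nat \<Rightarrow> real) \<Rightarrow> bool" where
  "neg_eig_list M W l \<longleftrightarrow>
     incseq l \<and> (\<forall>i. l i \<le> 0) \<and>
     (\<forall>t<0. finite {i. l i = t} \<and> enat (card {i. l i = t}) = eig_mult M W t)"

text \<open>Indices start at \<open>0\<close>: the \<open>i\<close>-th entry is \<open>\<lambda>\<close> with index \<open>i + 1\<close> in the usual numbering.\<close>

definition pos_eig :: "'a measure \<Rightarrow> ('a \<times> 'a \<Rightarrow> real) \<Rightarrow> nat \<Rightarrow> real" where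
  "pos_eig M W = (THE l. pos_eig_list M W l)"

definition neg_eig :: "'a measure \<Rightarrow> ('a \<times> 'a \<Rightarrow> real) \<Rightarrow> nat \<Rightarrow> real" where
  "neg_eig M W = (THE l. neg_eig_list M W l)"


section \<open>Graphon orders\<close>

definition spectral_le :: "'a measure \<Rightarrow> ('a \<times> 'a \<Rightarrow> real) \<Rightarrow> ('a \<times> 'a \<Rightarrow> real) \<Rightarrow> bool" where
  "spectral_le M W U \<longleftrightarrow>
     (\<forall>i. pos_eig M W i \<le> pos_eig M U i \<and> neg_eig M W i \<ge> neg_eig M U i)"

definition spectral_less :: "'a measure \<Rightarrow> ('a \<times> 'a \<Rightarrow> real) \<Rightarrow> ('a \<times> 'a \<Rightarrow> real) \<Rightarrow> bool" where
  "spectral_less M W U \<longleftrightarrow> spectral_le M W U \<and>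
     (\<exists>i. pos_eig M W i < pos_eig M U i \<or> neg_eig M W i > neg_eig M U i)"

definition graphon_order ::
  "'a measure \<Rightarrow> (('a \<times> 'a \<Rightarrow> real) \<Rightarrow> ('a \<times> 'a \<Rightarrow> real) \<Rightarrow> bool) \<Rightarrow> bool" where
  "graphon_order M le \<longleftrightarrow>
     reflp_on {W. graphon M W} le \<and> transp_on {W. graphon M W} le \<and>
     (\<forall>U W. graphon M U \<longrightarrow> graphon M W \<longrightarrow> cut_dist M U W = 0 \<longrightarrow> le U W \<and> le W U)"

definition cut_distance_identifying ::
  "'a measure \<Rightarrow> (('a \<times> 'a \<Rightarrow> real) \<Rightarrow> ('a \<times> 'a \<Rightarrow> real) \<Rightarrow> bool) \<Rightarrow> bool" where
  "cut_distance_identifying M le \<longleftrightarrow>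
     (\<forall>U W. graphon M U \<longrightarrow> graphon M W \<longrightarrow> env_less M U W \<longrightarrow> le U W \<and> \<not> le W U)"

end

(* Positive eigenvalues obey a min-max principle, and quadratic forms on a fixed finite-dimensional
   space pass to weak* limits; hence a weak* limit U of versions of W has its spectrum below that of W.
   If the two spectra agree, then U and W have the same Hilbert-Schmidt norm (the sum of the squared
   eigenvalues), so the weak convergence is strong. Undoing the bijections then exhibits versions of U
   converging to W in L^2, which puts the envelope of W inside that of U.

   No theory of L^2 as a Hilbert space is used: eigenfunctions of a bounded kernel for nonzero
   eigenvalues are bounded, so everything happens in the space of bounded measurable functions, and
   eigenvectors arise as limits of the powers of a positive contraction. *)

theory Submission
  imports Defs
begin

section \<open>Bounded functions and kernels\<close>


text \<open>The space of bounded functions is not complete, so an L^2-Cauchy sequence of iterates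
  need not have a limit in it. What helps is that a bounded kernel maps an L^2-Cauchy sequence to a
  pointwise convergent one: the eigenvector is the pointwise limit of T applied to the iterates, and
  nothing has to converge before T is applied.

  The second obstacle is that the formula for the Hilbert-Schmidt norm usually rests on completeness
  of the eigenfunctions. Here it comes from a statement about kernels. What is left of K after
  subtracting its first n positive and first n negative eigenpairs has a quadratic form controlled
  by the next eigenvalues, hence tending to 0. By polarisation these residual kernels tend to 0 when
  tested on rectangles, and then when tested against K itself; but that last product is |K|^2 minus
  the partial sum of squares.

  Negative eigenvalues are treated as positive ones of -K.\<close>

definition bdd_meas :: "'b measure \<Rightarrow> ('b \<Rightarrow> real) \<Rightarrow> bool" where
  "bdd_meas N f \<longleftrightarrow> f \<in> borel_measurable N \<and> (\<exists>C. \<forall>x\<in>space N. \<bar>f x\<bar> \<le> C)"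

text \<open>Over \<open>M \<Otimes>\<^sub>M M\<close> this is the Hilbert-Schmidt inner product of
  kernels, so one set of lemmas serves functions and kernels alike.\<close>

definition ip :: "'b measure \<Rightarrow> ('b \<Rightarrow> real) \<Rightarrow> ('b \<Rightarrow> real) \<Rightarrow> real" where
  "ip N f g = (\<integral>x. f x * g x \<partial>N)"

definition sym_kernel :: "'a measure \<Rightarrow> ('a \<times> 'a \<Rightarrow> real) \<Rightarrow> bool" where
  "sym_kernel M K \<longleftrightarrow> bdd_meas (M \<Otimes>\<^sub>M M) K \<and> (\<forall>x\<in>space M. \<forall>y\<in>space M. K (x, y) = K (y, x))"

lemma bdd_measI: "f \<in> borel_measurable N \<Longrightarrow> (\<And>x. x \<in> space N \<Longrightarrow> \<bar>f x\<bar> \<le> C) \<Longrightarrow> bdd_meas N f"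
  unfolding bdd_meas_def by blast

lemma bdd_meas_measurable: "bdd_meas N f \<Longrightarrow> f \<in> borel_measurable N"
  unfolding bdd_meas_def by blast

lemma bdd_meas_bound:
  assumes "bdd_meas N f"
  obtains C where "C > 0" "\<And>x. x \<in> space N \<Longrightarrow> \<bar>f x\<bar> \<le> C"
proof -
  obtain C where "\<forall>x\<in>space N. \<bar>f x\<bar> \<le> C" using assms unfolding bdd_meas_def by blast
  then show ?thesis by (intro that[of "max C 1"]) force+
qed

lemma bdd_meas_const: "bdd_meas N (\<lambda>x. c)"
  by (rule bdd_measI[of _ _ "\<bar>c\<bar>"]) auto

lemma bdd_meas_add:
  assumes "bdd_meas N f" "bdd_meas N g" shows "bdd_meas N (\<lambda>x. f x + g x)"
proof -
  obtain C D where "\<And>x. x \<in> space N \<Longrightarrow> \<bar>f x\<bar> \<le> C" "\<And>x. x \<in> space N \<Longrightarrow> \<bar>g x\<bar> \<le> D"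
    using bdd_meas_bound assms by metis
  then show ?thesis
    using assms[THEN bdd_meas_measurable] by (intro bdd_measI[of _ _ "C + D"]) (auto, force)
qed

lemma bdd_meas_mult:
  assumes "bdd_meas N f" "bdd_meas N g" shows "bdd_meas N (\<lambda>x. f x * g x)"
proof -
  obtain C D where "C > 0" "\<And>x. x \<in> space N \<Longrightarrow> \<bar>f x\<bar> \<le> C" "\<And>x. x \<in> space N \<Longrightarrow> \<bar>g x\<bar> \<le> D"
    using bdd_meas_bound assms by metis
  then show ?thesis
    using assms[THEN bdd_meas_measurable]
    by (intro bdd_measI[of _ _ "C * D"]) (auto simp: abs_mult intro!: mult_mono)
qed

lemma bdd_meas_uminus: "bdd_meas N f \<Longrightarrow> bdd_meas N (\<lambda>x. - f x)"
  unfolding bdd_meas_def by auto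

lemma bdd_meas_diff: "bdd_meas N f \<Longrightarrow> bdd_meas N g \<Longrightarrow> bdd_meas N (\<lambda>x. f x - g x)"
  using bdd_meas_add[OF _ bdd_meas_uminus, of N f g] by simp

lemma bdd_meas_divide: "bdd_meas N f \<Longrightarrow> bdd_meas N (\<lambda>x. f x / c)"
  using bdd_meas_mult[OF _ bdd_meas_const, of N f "inverse c"] by (simp add: divide_inverse)

lemma bdd_meas_power2: "bdd_meas N f \<Longrightarrow> bdd_meas N (\<lambda>x. (f x)\<^sup>2)"
  using bdd_meas_mult[of N f f] by (simp add: power2_eq_square)

lemma bdd_meas_sum: "(\<And>i. i \<in> I \<Longrightarrow> bdd_meas N (f i)) \<Longrightarrow> bdd_meas N (\<lambda>x. \<Sum>i\<in>I. f i x)"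
  by (induction I rule: infinite_finite_induct) (auto intro: bdd_meas_const bdd_meas_add)

lemma bdd_meas_indicator: "A \<in> sets N \<Longrightarrow> bdd_meas N (indicator A)"
  by (rule bdd_measI[of _ _ 1]) (auto simp: indicator_def)

lemma bdd_meas_compose:
  assumes "bdd_meas N f" "h \<in> measurable L N" shows "bdd_meas L (\<lambda>x. f (h x))"
proof -
  obtain C where "\<And>x. x \<in> space N \<Longrightarrow> \<bar>f x\<bar> \<le> C" using bdd_meas_bound assms by metis
  then show ?thesis
    using bdd_meas_measurable[OF assms(1)] assms(2) measurable_space[OF assms(2)]
    by (intro bdd_measI[of _ _ C]) (auto intro: measurable_compose)
qed

lemmas bdd_meas_intros = bdd_meas_const bdd_meas_add bdd_meas_mult bdd_meas_uminus bdd_meas_diff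
  bdd_meas_divide bdd_meas_power2 bdd_meas_sum bdd_meas_indicator

lemma (in finite_measure) bdd_meas_integrable: "bdd_meas M f \<Longrightarrow> integrable M f"
  by (metis AE_I2 bdd_meas_def integrable_const_bound real_norm_def)

lemma ip_commute: "ip N f g = ip N g f"
  unfolding ip_def by (simp add: mult.commute)

lemma ip_cong:
  "(\<And>x. x \<in> space N \<Longrightarrow> f x = f' x) \<Longrightarrow> (\<And>x. x \<in> space N \<Longrightarrow> g x = g' x) \<Longrightarrow> ip N f g = ip N f' g'"
  unfolding ip_def by (rule Bochner_Integration.integral_cong) auto

lemma ip_self_nonneg: "ip N f f \<ge> 0"
  unfolding ip_def by simp

lemma ip_scale_left: "ip N (\<lambda>x. c * f x) g = c * ip N f g"
  unfolding ip_def by (simp add: mult.assoc)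

lemma ip_scale_right: "ip N g (\<lambda>x. c * f x) = c * ip N g f"
  using ip_scale_left[of N c f g] by (simp add: ip_commute)

lemma ip_divide_left: "ip N (\<lambda>x. f x / c) g = ip N f g / c"
  using ip_scale_left[of N "inverse c" f g] by (simp add: divide_inverse mult.commute)

lemma ip_divide_right: "ip N g (\<lambda>x. f x / c) = ip N g f / c"
  using ip_divide_left[of N f c g] by (simp add: ip_commute)

lemma ip_uminus_left: "ip N (\<lambda>x. - f x) g = - ip N f g"
  using ip_scale_left[of N "-1" f g] by simp

lemma ip_zero_left: "ip N (\<lambda>x. 0) g = 0"
  unfolding ip_def by simp

context finite_measure
begin

lemma ip_add_left:
  assumes "bdd_meas M f" "bdd_meas M g" "bdd_meas M h"
  shows "ip M (\<lambda>x. f x + g x) h = ip M f h + ip M g h"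
  unfolding ip_def distrib_right
  by (intro Bochner_Integration.integral_add bdd_meas_integrable bdd_meas_intros assms)

lemma ip_diff_left:
  assumes "bdd_meas M f" "bdd_meas M g" "bdd_meas M h"
  shows "ip M (\<lambda>x. f x - g x) h = ip M f h - ip M g h"
  unfolding ip_def left_diff_distrib
  by (intro Bochner_Integration.integral_diff bdd_meas_integrable bdd_meas_intros assms)

lemma ip_sum_left:
  assumes "\<And>i. i \<in> I \<Longrightarrow> bdd_meas M (f i)" "bdd_meas M h"
  shows "ip M (\<lambda>x. \<Sum>i\<in>I. f i x) h = (\<Sum>i\<in>I. ip M (f i) h)"
  unfolding ip_def sum_distrib_right
  by (intro Bochner_Integration.integral_sum bdd_meas_integrable bdd_meas_intros assms)

lemma ip_add_right:
  assumes "bdd_meas M f" "bdd_meas M g" "bdd_meas M h"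
  shows "ip M h (\<lambda>x. f x + g x) = ip M h f + ip M h g"
  using ip_add_left[OF assms] by (simp add: ip_commute)

lemma ip_diff_right:
  assumes "bdd_meas M f" "bdd_meas M g" "bdd_meas M h"
  shows "ip M h (\<lambda>x. f x - g x) = ip M h f - ip M h g"
  using ip_diff_left[OF assms] by (simp add: ip_commute)

lemma ip_sum_right:
  assumes "\<And>i. i \<in> I \<Longrightarrow> bdd_meas M (f i)" "bdd_meas M h"
  shows "ip M h (\<lambda>x. \<Sum>i\<in>I. f i x) = (\<Sum>i\<in>I. ip M h (f i))"
  using ip_sum_left[OF assms] by (simp add: ip_commute)

end

lemma quadratic_nonneg_discriminant:
  fixes a b c :: real
  assumes "\<And>t. a + 2 * t * b + t\<^sup>2 * c \<ge> 0" "c \<ge> 0"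
  shows "b\<^sup>2 \<le> a * c"
proof (cases "c = 0")
  case True
  show ?thesis
  proof (cases "b = 0")
    case False
    \<comment> \<open>This \<open>t\<close> gives the linear expression the value -1: a linear
      function bounded below has slope 0.\<close>
    have "a + 2 * (- (a + 1) / (2 * b)) * b \<ge> 0"
      using assms(1)[of "- (a + 1) / (2 * b)"] True by simp
    then show ?thesis using False by (simp add: field_simps)
  qed (use True in simp)
next
  case False
  then have "c > 0" using assms(2) by simp
  \<comment> \<open>The minimiser of the quadratic polynomial in \<open>t\<close>.\<close>
  have "a + 2 * (- b / c) * b + (- b / c)\<^sup>2 * c \<ge> 0" by (rule assms(1))
  also have "a + 2 * (- b / c) * b + (- b / c)\<^sup>2 * c = (a * c - b\<^sup>2) / c"
    using \<open>c > 0\<close> by (simp add: field_simps power2_eq_square)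
  finally show ?thesis using \<open>c > 0\<close> by (simp add: zero_le_divide_iff)
qed

section \<open>Cauchy-Schwarz for semidefinite forms\<close>

context finite_measure
begin

lemma form_Cauchy_Schwarz:
  assumes bdd: "\<And>f. bdd_meas M f \<Longrightarrow> bdd_meas M (A f)"
    and lin: "\<And>f g t x. bdd_meas M f \<Longrightarrow> bdd_meas M g \<Longrightarrow> x \<in> space M \<Longrightarrow>
      A (\<lambda>x. f x + t * g x) x = A f x + t * A g x"
    and sa: "\<And>f g. bdd_meas M f \<Longrightarrow> bdd_meas M g \<Longrightarrow> ip M (A f) g = ip M f (A g)"
    and psd: "\<And>f. bdd_meas M f \<Longrightarrow> ip M (A f) f \<ge> 0"
    and f: "bdd_meas M f" and g: "bdd_meas M g"
  shows "(ip M (A f) g)\<^sup>2 \<le> ip M (A f) f * ip M (A g) g"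
proof (rule quadratic_nonneg_discriminant)
  show "ip M (A g) g \<ge> 0" by (rule psd[OF g])
next
  fix t
  have *: "bdd_meas M (\<lambda>x. f x + t * g x)" by (intro bdd_meas_intros f g)
  have "0 \<le> ip M (A (\<lambda>x. f x + t * g x)) (\<lambda>x. f x + t * g x)" by (rule psd[OF *])
  also have "\<dots> = ip M (\<lambda>x. A f x + t * A g x) (\<lambda>x. f x + t * g x)"
    using lin[OF f g] by (intro ip_cong) auto
  also have "\<dots> = ip M (A f) f + t * ip M (A f) g + t * ip M (A g) f + t * (t * ip M (A g) g)"
    using bdd[OF f] bdd[OF g] f g
    by (simp add: ip_add_left ip_add_right ip_scale_left ip_scale_right bdd_meas_intros algebra_simps)
  also have "\<dots> = ip M (A f) f + 2 * t * ip M (A f) g + t\<^sup>2 * ip M (A g) g"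
    using sa[OF f g] ip_commute[of M f "A g"] by (simp add: power2_eq_square)
  finally show "0 \<le> ip M (A f) f + 2 * t * ip M (A f) g + t\<^sup>2 * ip M (A g) g" .
qed

lemma ip_Cauchy_Schwarz:
  assumes "bdd_meas M f" "bdd_meas M g"
  shows "(ip M f g)\<^sup>2 \<le> ip M f f * ip M g g"
  by (rule form_Cauchy_Schwarz[of "\<lambda>f. f"]) (auto simp: assms ip_self_nonneg)

lemma ip_abs_le:
  assumes "bdd_meas M f" "bdd_meas M g"
  shows "\<bar>ip M f g\<bar> \<le> sqrt (ip M f f) * sqrt (ip M g g)"
  using real_sqrt_le_mono[OF ip_Cauchy_Schwarz[OF assms]] by (simp add: real_sqrt_mult)

lemma ip_self_add_triangle:
  assumes f: "bdd_meas M f" and g: "bdd_meas M g"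
  shows "sqrt (ip M (\<lambda>x. f x + g x) (\<lambda>x. f x + g x)) \<le> sqrt (ip M f f) + sqrt (ip M g g)"
proof (rule real_le_lsqrt)
  have "ip M (\<lambda>x. f x + g x) (\<lambda>x. f x + g x) = ip M f f + 2 * ip M f g + ip M g g"
    using f g by (simp add: ip_add_left ip_add_right bdd_meas_intros ip_commute[of M g f])
  also have "\<dots> \<le> (sqrt (ip M f f) + sqrt (ip M g g))\<^sup>2"
    using ip_abs_le[OF f g] by (simp add: power2_sum ip_self_nonneg)
  finally show "ip M (\<lambda>x. f x + g x) (\<lambda>x. f x + g x) \<le> (sqrt (ip M f f) + sqrt (ip M g g))\<^sup>2" .
qed (simp add: ip_self_nonneg)

lemma ip_self_eq_0_imp_AE:
  assumes "bdd_meas M f" "ip M f f = 0"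
  shows "AE x in M. f x = 0"
proof -
  have "integrable M (\<lambda>x. f x * f x)" by (intro bdd_meas_integrable bdd_meas_intros assms)
  then have "AE x in M. f x * f x = 0"
    using assms(2) integral_nonneg_eq_0_iff_AE[of M "\<lambda>x. f x * f x"] unfolding ip_def by simp
  then show ?thesis by simp
qed

end

section \<open>Integral operators of bounded kernels\<close>

lemma sym_kernel_bdd: "sym_kernel M K \<Longrightarrow> bdd_meas (M \<Otimes>\<^sub>M M) K"
  unfolding sym_kernel_def by simp

lemma bdd_meas_section: "bdd_meas (M \<Otimes>\<^sub>M M) K \<Longrightarrow> x \<in> space M \<Longrightarrow> bdd_meas M (\<lambda>y. K (x, y))"
  by (rule bdd_meas_compose) auto

lemma graphon_op_eq_ip: "graphon_op M K f x = ip M (\<lambda>y. K (x, y)) f"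
  unfolding graphon_op_def ip_def ..

context prob_space
begin

lemma bdd_meas_op:
  assumes "bdd_meas (M \<Otimes>\<^sub>M M) K" "bdd_meas M f"
  shows "bdd_meas M (graphon_op M K f)"
proof -
  obtain C D where C: "C > 0" "\<And>z. z \<in> space (M \<Otimes>\<^sub>M M) \<Longrightarrow> \<bar>K z\<bar> \<le> C"
    and D: "\<And>x. x \<in> space M \<Longrightarrow> \<bar>f x\<bar> \<le> D"
    using bdd_meas_bound assms by metis
  note [measurable] = assms[THEN bdd_meas_measurable]
  show ?thesis
  proof (rule bdd_measI[of _ _ "C * D"])
    show "graphon_op M K f \<in> borel_measurable M" unfolding graphon_op_def by measurable
    fix x assume x: "x \<in> space M"
    have b: "bdd_meas M (\<lambda>y. K (x, y) * f y)"
      by (intro bdd_meas_intros bdd_meas_section assms x)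
    have "\<bar>graphon_op M K f x\<bar> \<le> (\<integral>y. \<bar>K (x, y) * f y\<bar> \<partial>M)"
      unfolding graphon_op_def by (rule integral_abs_bound)
    also have "\<dots> \<le> (\<integral>y. C * D \<partial>M)"
      using x C D by (intro integral_mono integrable_abs bdd_meas_integrable bdd_meas_const b)
        (auto simp: abs_mult space_pair_measure intro!: mult_mono)
    finally show "\<bar>graphon_op M K f x\<bar> \<le> C * D" by (simp add: prob_space)
  qed
qed

text \<open>Cauchy-Schwarz on the section K(x, .) controls every value of the image by the L^2 norm
  of \<open>f\<close>, uniformly in \<open>x\<close>. This smoothing turns L^2-Cauchy sequences into
  convergent ones.\<close>

lemma op_abs_le:
  assumes K: "bdd_meas (M \<Otimes>\<^sub>M M) K" and C: "C \<ge> 0" "\<And>z. z \<in> space (M \<Otimes>\<^sub>M M) \<Longrightarrow> \<bar>K z\<bar> \<le> C"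
    and f: "bdd_meas M f" and x: "x \<in> space M"
  shows "\<bar>graphon_op M K f x\<bar> \<le> C * sqrt (ip M f f)"
proof -
  have b: "bdd_meas M (\<lambda>y. K (x, y))" by (intro bdd_meas_section K x)
  have "ip M (\<lambda>y. K (x, y)) (\<lambda>y. K (x, y)) \<le> (\<integral>y. C\<^sup>2 \<partial>M)"
    unfolding ip_def power2_eq_square[symmetric] using x C
    by (intro integral_mono bdd_meas_integrable bdd_meas_intros b)
       (auto simp: space_pair_measure intro!: iffD2[OF abs_le_square_iff[symmetric]])
  then have "sqrt (ip M (\<lambda>y. K (x, y)) (\<lambda>y. K (x, y))) \<le> C"
    using C by (intro real_le_lsqrt) (auto simp: prob_space)
  then show ?thesis
    unfolding graphon_op_eq_ip
    by (intro order_trans[OF ip_abs_le[OF b f]] mult_right_mono) (auto simp: ip_self_nonneg)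
qed

lemma ip_op_self_le:
  assumes K: "bdd_meas (M \<Otimes>\<^sub>M M) K" and C: "C \<ge> 0" "\<And>z. z \<in> space (M \<Otimes>\<^sub>M M) \<Longrightarrow> \<bar>K z\<bar> \<le> C"
    and f: "bdd_meas M f"
  shows "ip M (graphon_op M K f) (graphon_op M K f) \<le> C\<^sup>2 * ip M f f"
proof -
  have "ip M (graphon_op M K f) (graphon_op M K f) \<le> (\<integral>x. C\<^sup>2 * ip M f f \<partial>M)"
    unfolding ip_def[of M "graphon_op M K f"] power2_eq_square[symmetric]
  proof (intro integral_mono bdd_meas_integrable bdd_meas_intros bdd_meas_op K f)
    fix x assume "x \<in> space M"
    then have "\<bar>graphon_op M K f x\<bar>\<^sup>2 \<le> (C * sqrt (ip M f f))\<^sup>2"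
      by (intro power_mono op_abs_le[OF K C f]) auto
    then show "(graphon_op M K f x)\<^sup>2 \<le> C\<^sup>2 * ip M f f"
      by (simp add: power_mult_distrib ip_self_nonneg)
  qed
  then show ?thesis by (simp add: prob_space)
qed

lemma op_add_scale:
  assumes "bdd_meas (M \<Otimes>\<^sub>M M) K" "bdd_meas M f" "bdd_meas M g" "x \<in> space M"
  shows "graphon_op M K (\<lambda>x. f x + t * g x) x = graphon_op M K f x + t * graphon_op M K g x"
  unfolding graphon_op_eq_ip
  by (simp add: ip_add_right ip_scale_right bdd_meas_intros assms bdd_meas_section)

lemma op_diff:
  assumes "bdd_meas (M \<Otimes>\<^sub>M M) K" "bdd_meas M f" "bdd_meas M g" "x \<in> space M"
  shows "graphon_op M K (\<lambda>x. f x - g x) x = graphon_op M K f x - graphon_op M K g x"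
  using op_add_scale[OF assms, of "-1"] by simp

lemma op_sum:
  assumes "bdd_meas (M \<Otimes>\<^sub>M M) K" "\<And>i. i \<in> I \<Longrightarrow> bdd_meas M (f i)" "x \<in> space M"
  shows "graphon_op M K (\<lambda>x. \<Sum>i\<in>I. c i * f i x) x = (\<Sum>i\<in>I. c i * graphon_op M K (f i) x)"
  unfolding graphon_op_eq_ip
  by (simp add: ip_sum_right ip_scale_right bdd_meas_intros assms bdd_meas_section)

text \<open>The conclusion holds at every point, since the integral forgets null sets. One
  application of the operator thus turns an almost everywhere identity into an everywhere
  one.\<close>

lemma op_cong_AE:
  assumes "K \<in> borel_measurable (M \<Otimes>\<^sub>M M)" "f \<in> borel_measurable M" "g \<in> borel_measurable M"
    "AE x in M. f x = g x" "x \<in> space M"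
  shows "graphon_op M K f x = graphon_op M K g x"
proof -
  note [measurable] = assms(1,2,3)
  show ?thesis unfolding graphon_op_def
    by (rule integral_cong_AE) (use assms(4,5) in auto)
qed

lemma bdd_meas_fst_snd:
  assumes "bdd_meas M f" "bdd_meas M g"
  shows "bdd_meas (M \<Otimes>\<^sub>M M) (\<lambda>z. f (fst z) * g (snd z))"
  by (intro bdd_meas_intros bdd_meas_compose[OF assms(1)] bdd_meas_compose[OF assms(2)]) auto

text \<open>Fubini: the form of the operator pairs the kernel with a rank-one kernel. Through this,
  convergence of kernels becomes convergence of quadratic forms.\<close>

lemma ip_op_eq:
  assumes K: "bdd_meas (M \<Otimes>\<^sub>M M) K" and f: "bdd_meas M f" and g: "bdd_meas M g"
  shows "ip M (graphon_op M K f) g = ip (M \<Otimes>\<^sub>M M) K (\<lambda>z. g (fst z) * f (snd z))"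
proof -
  interpret P: pair_prob_space M M ..
  have b: "bdd_meas (M \<Otimes>\<^sub>M M) (\<lambda>z. K z * (g (fst z) * f (snd z)))"
    by (intro bdd_meas_mult K bdd_meas_fst_snd f g)
  have "ip (M \<Otimes>\<^sub>M M) K (\<lambda>z. g (fst z) * f (snd z)) =
      (\<integral>x. (\<integral>y. K (x, y) * (g x * f y) \<partial>M) \<partial>M)"
    unfolding ip_def using P.integral_fst'[OF P.P.bdd_meas_integrable[OF b]] by simp
  also have "\<dots> = (\<integral>x. graphon_op M K f x * g x \<partial>M)"
    unfolding graphon_op_def by (intro Bochner_Integration.integral_cong) (auto simp: ac_simps simp flip: integral_mult_right_zero)
  finally show ?thesis unfolding ip_def by simp
qed

lemma ip_op_commute:
  assumes K: "sym_kernel M K" and f: "bdd_meas M f" and g: "bdd_meas M g"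
  shows "ip M (graphon_op M K f) g = ip M f (graphon_op M K g)"
proof -
  interpret P: pair_prob_space M M ..
  note KB = sym_kernel_bdd[OF K]
  have [measurable]: "K \<in> borel_measurable (M \<Otimes>\<^sub>M M)" "f \<in> borel_measurable M" "g \<in> borel_measurable M"
    using K f g by (auto simp: bdd_meas_def sym_kernel_def)
  have "ip M (graphon_op M K f) g = (\<integral>z. K z * (g (fst z) * f (snd z)) \<partial>(M \<Otimes>\<^sub>M M))"
    by (subst ip_op_eq[OF KB f g]) (simp add: ip_def)
  also have "\<dots> = (\<integral>(x,y). K (y,x) * (g y * f x) \<partial>(M \<Otimes>\<^sub>M M))"
    by (subst P.integral_product_swap[symmetric]) (auto simp: split_beta)
  also have "\<dots> = (\<integral>z. K z * (f (fst z) * g (snd z)) \<partial>(M \<Otimes>\<^sub>M M))"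
    using K by (intro Bochner_Integration.integral_cong)
      (auto simp: split_beta space_pair_measure sym_kernel_def)
  also have "\<dots> = ip M (graphon_op M K g) f"
    by (subst ip_op_eq[OF KB g f]) (simp add: ip_def)
  finally show ?thesis by (simp add: ip_commute)
qed

end

section \<open>Powers of positive contractions\<close>


text \<open>The operator inequality 0 \<le> B \<le> 1 for a self-adjoint B on bounded functions.
  Contraction in norm is a consequence, \<open>pos_contraction_norm_le\<close>.\<close>

definition pos_contraction :: "'b measure \<Rightarrow> (('b \<Rightarrow> real) \<Rightarrow> 'b \<Rightarrow> real) \<Rightarrow> bool" where
  "pos_contraction N B \<longleftrightarrow>
     (\<forall>f. bdd_meas N f \<longrightarrow> bdd_meas N (B f) \<and> 0 \<le> ip N (B f) f \<and> ip N (B f) f \<le> ip N f f) \<and>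
     (\<forall>f g. bdd_meas N f \<longrightarrow> bdd_meas N g \<longrightarrow> ip N (B f) g = ip N f (B g)) \<and>
     (\<forall>f g t. bdd_meas N f \<longrightarrow> bdd_meas N g \<longrightarrow>
        (\<forall>x\<in>space N. B (\<lambda>x. f x + t * g x) x = B f x + t * B g x))"

context finite_measure
begin

text \<open>This is B^2 \<le> B. Cauchy-Schwarz for the form of B at \<open>f\<close> and
  \<open>B f\<close>, followed by B \<le> 1 at \<open>B f\<close>, bounds <Bf, Bf>^2 by <Bf, f> <Bf,
  Bf>, and one factor cancels.\<close>

lemma pos_contraction_norm_le:
  assumes B: "pos_contraction M B" and f: "bdd_meas M f"
  shows "ip M (B f) (B f) \<le> ip M (B f) f" "ip M (B f) (B f) \<le> ip M f f"
proof -
  have bdd: "\<And>f. bdd_meas M f \<Longrightarrow> bdd_meas M (B f)" using B unfolding pos_contraction_def by blast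
  have "(ip M (B f) (B f))\<^sup>2 \<le> ip M (B f) f * ip M (B (B f)) (B f)"
    using B f bdd[OF f] unfolding pos_contraction_def by (intro form_Cauchy_Schwarz) blast+
  also have "\<dots> \<le> ip M (B f) f * ip M (B f) (B f)"
    using B f bdd[OF f] unfolding pos_contraction_def by (intro mult_left_mono) blast+
  finally show *: "ip M (B f) (B f) \<le> ip M (B f) f"
    using ip_self_nonneg[of M "B f"] B f unfolding pos_contraction_def power2_eq_square
    by (metis mult_right_le_imp_le order_le_less)
  then show "ip M (B f) (B f) \<le> ip M f f" using B f unfolding pos_contraction_def by force
qed

lemma pos_contraction_power:
  assumes "pos_contraction M B" "bdd_meas M g"
  shows "bdd_meas M ((B ^^ n) g)" "ip M ((B ^^ n) g) ((B ^^ n) g) \<le> ip M g g"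
proof -
  show *: "bdd_meas M ((B ^^ n) g)" for n
    by (induction n) (use assms in \<open>auto simp: pos_contraction_def\<close>)
  show "ip M ((B ^^ n) g) ((B ^^ n) g) \<le> ip M g g"
    by (induction n) (use pos_contraction_norm_le(2)[OF assms(1) *] in \<open>auto intro: order_trans\<close>)
qed

lemma pos_contraction_power_shift:
  assumes B: "pos_contraction M B" and g: "bdd_meas M g" and h: "bdd_meas M h"
  shows "ip M ((B ^^ i) g) ((B ^^ j) h) = ip M ((B ^^ (i + j)) g) h"
proof (induction j arbitrary: i)
  case (Suc j)
  have "ip M ((B ^^ i) g) ((B ^^ Suc j) h) = ip M ((B ^^ Suc i) g) ((B ^^ j) h)"
    using B pos_contraction_power(1)[OF B g, of i] pos_contraction_power(1)[OF B h, of j]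
    unfolding pos_contraction_def by simp
  then show ?case using Suc[of "Suc i"] by simp
qed simp

text \<open>The moments \<open>\<langle>B\<^sup>k g, g\<rangle>\<close> decrease in \<open>k\<close>, hence converge, and they control the distances
  between the iterates; no compactness is involved.\<close>

lemma pos_contraction_power_Cauchy:
  assumes B: "pos_contraction M B" and g: "bdd_meas M g"
  shows "\<exists>L. (\<lambda>n. ip M ((B ^^ n) g) ((B ^^ n) g)) \<longlonglongrightarrow> L \<and>
    (\<forall>\<epsilon>>0. \<exists>N. \<forall>m\<ge>N. \<forall>n\<ge>N.
      ip M (\<lambda>x. (B ^^ m) g x - (B ^^ n) g x) (\<lambda>x. (B ^^ m) g x - (B ^^ n) g x) < \<epsilon>)"
proof -
  define c where "c k = ip M ((B ^^ k) g) g" for k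
  note P = pos_contraction_power[OF B g]
  have c_ip: "ip M ((B ^^ i) g) ((B ^^ j) g) = c (i + j)" for i j
    unfolding c_def by (rule pos_contraction_power_shift[OF B g g])
  \<comment> \<open>Even moments are squared norms of u = B^n g, odd ones are forms <Bu, u>. From
    even to odd the step is 0 \<le> B \<le> 1, from odd to even it is B^2 \<le> B.\<close>
  have c_Suc: "c (Suc k) \<le> c k \<and> c (Suc k) \<ge> 0" for k
  proof (cases "even k")
    case True
    then obtain n where k: "k = n + n" by (metis evenE mult_2)
    have "c (Suc k) = ip M (B ((B ^^ n) g)) ((B ^^ n) g)" using c_ip[of "Suc n" n] k by simp
    moreover have "c k = ip M ((B ^^ n) g) ((B ^^ n) g)" using c_ip[of n n] k by simp
    ultimately show ?thesis using B P(1)[of n] unfolding pos_contraction_def by metis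
  next
    case False
    then obtain n where k: "k = Suc (n + n)" by (metis oddE Suc_eq_plus1 mult_2)
    have "c (Suc k) = ip M (B ((B ^^ n) g)) (B ((B ^^ n) g))" using c_ip[of "Suc n" "Suc n"] k by simp
    moreover have "c k = ip M (B ((B ^^ n) g)) ((B ^^ n) g)" using c_ip[of "Suc n" n] k by simp
    ultimately show ?thesis using pos_contraction_norm_le(1)[OF B P(1)[of n]] ip_self_nonneg by metis
  qed
  have "decseq c" using c_Suc by (intro decseq_SucI) blast
  moreover have "c k \<ge> 0" for k using c_Suc by (meson order_trans)
  ultimately obtain L where L: "c \<longlonglongrightarrow> L" using decseq_convergent by blast
  show ?thesis
  proof (intro exI[of _ L] conjI allI impI)
    have "(\<lambda>n. c (n + n)) \<longlonglongrightarrow> L"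
      by (rule LIMSEQ_subseq_LIMSEQ[OF L, of "\<lambda>n. n + n", unfolded o_def]) (auto simp: strict_mono_def)
    then show "(\<lambda>n. ip M ((B ^^ n) g) ((B ^^ n) g)) \<longlonglongrightarrow> L" by (simp add: c_ip)
  next
    fix \<epsilon> :: real assume "\<epsilon> > 0"
    then obtain N where N: "\<And>k. k \<ge> N \<Longrightarrow> \<bar>c k - L\<bar> < \<epsilon> / 4"
      using LIMSEQ_D[OF L, of "\<epsilon> / 4"] by auto
    have "ip M (\<lambda>x. (B ^^ m) g x - (B ^^ n) g x) (\<lambda>x. (B ^^ m) g x - (B ^^ n) g x) < \<epsilon>"
      if "m \<ge> N" "n \<ge> N" for m n
    proof -
      \<comment> \<open>Expanding the square leaves only moments, whose limits cancel as L - 2 L +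
        L. Their errors, counted with coefficients 1, 2 and 1, explain the \<epsilon> / 4.\<close>
      have "ip M (\<lambda>x. (B ^^ m) g x - (B ^^ n) g x) (\<lambda>x. (B ^^ m) g x - (B ^^ n) g x)
          = c (m + m) - 2 * c (m + n) + c (n + n)"
        by (simp add: ip_diff_left ip_diff_right bdd_meas_diff P(1) c_ip add.commute[of n m])
      moreover have "\<bar>c (m + m) - L\<bar> < \<epsilon> / 4" "\<bar>c (m + n) - L\<bar> < \<epsilon> / 4" "\<bar>c (n + n) - L\<bar> < \<epsilon> / 4"
        using that N[of "m + m"] N[of "m + n"] N[of "n + n"] by simp_all
      ultimately show ?thesis by linarith
    qed
    then show "\<exists>N. \<forall>m\<ge>N. \<forall>n\<ge>N.
      ip M (\<lambda>x. (B ^^ m) g x - (B ^^ n) g x) (\<lambda>x. (B ^^ m) g x - (B ^^ n) g x) < \<epsilon>" by blast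
  qed
qed

text \<open>Wanted for (1 - B)^2 \<le> 1 - B, which bounds |h - Bh|^2 by <h, h> - <Bh, h>.\<close>

lemma pos_contraction_complement:
  assumes B: "pos_contraction M B"
  shows "pos_contraction M (\<lambda>f x. f x - B f x)"
proof -
  have bdd: "\<And>f. bdd_meas M f \<Longrightarrow> bdd_meas M (B f)" using B unfolding pos_contraction_def by blast
  show ?thesis
    using B unfolding pos_contraction_def
    by (auto simp: ip_diff_left ip_diff_right bdd bdd_meas_diff algebra_simps)
qed

text \<open>By (1 - B)^2 \<le> 1 - B, a function on which the form of B nearly attains that of the
  identity is nearly fixed by B. As B contracts norms, n applications move it at most n times as far
  as one.\<close>

lemma pos_contraction_power_near_fixed:
  assumes B: "pos_contraction M B" and h: "\<And>j. bdd_meas M (h j)"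
    and lim: "(\<lambda>j. ip M (h j) (h j) - ip M (B (h j)) (h j)) \<longlonglongrightarrow> 0"
  shows "(\<lambda>j::nat. sqrt (ip M (\<lambda>x. (B ^^ n) (h j) x - h j x) (\<lambda>x. (B ^^ n) (h j) x - h j x))) \<longlonglongrightarrow> 0"
proof -
  define d where "d n j = sqrt (ip M (\<lambda>x. (B ^^ n) (h j) x - h j x) (\<lambda>x. (B ^^ n) (h j) x - h j x))" for n j
  note bdd = pos_contraction_power(1)[OF B h]
  have bddB: "\<And>f. bdd_meas M f \<Longrightarrow> bdd_meas M (B f)" using B unfolding pos_contraction_def by blast
  have step: "d (Suc n) j \<le> d n j + d 1 j" for n j
  proof -
    let ?P = "(B ^^ n) (h j)"
    have b: "bdd_meas M (\<lambda>x. ?P x - h j x)" by (intro bdd_meas_intros bdd h)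
    have lin: "B (\<lambda>x. ?P x - h j x) x = B ?P x - B (h j) x" if "x \<in> space M" for x
    proof -
      have "B (\<lambda>x. ?P x + (-1) * h j x) x = B ?P x + (-1) * B (h j) x"
        using B bdd[of n j] h[of j] that unfolding pos_contraction_def by blast
      then show ?thesis by simp
    qed
    have "d (Suc n) j = sqrt (ip M (\<lambda>x. B (\<lambda>x. ?P x - h j x) x + (B (h j) x - h j x))
        (\<lambda>x. B (\<lambda>x. ?P x - h j x) x + (B (h j) x - h j x)))"
      unfolding d_def by (intro arg_cong[where f = sqrt] ip_cong) (auto simp: lin)
    also have "\<dots> \<le> sqrt (ip M (B (\<lambda>x. ?P x - h j x)) (B (\<lambda>x. ?P x - h j x))) + d 1 j"
      unfolding d_def using ip_self_add_triangle[OF bddB[OF b] bdd_meas_diff[OF bddB[OF h[of j]] h[of j]]] by simp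
    also have "\<dots> \<le> d n j + d 1 j"
      unfolding d_def using pos_contraction_norm_le(2)[OF B b] by simp
    finally show ?thesis .
  qed
  have "(\<lambda>j. d 1 j) \<longlonglongrightarrow> 0"
  proof (rule tendsto_sandwich[OF _ _ tendsto_const])
    show "\<forall>\<^sub>F j in sequentially. 0 \<le> d 1 j" by (simp add: d_def ip_self_nonneg)
    show "\<forall>\<^sub>F j in sequentially. d 1 j \<le> sqrt (ip M (h j) (h j) - ip M (B (h j)) (h j))"
    proof (intro always_eventually allI)
      fix j
      have "ip M (\<lambda>x. h j x - B (h j) x) (\<lambda>x. h j x - B (h j) x) \<le> ip M (\<lambda>x. h j x - B (h j) x) (h j)"
        by (rule pos_contraction_norm_le(1)[OF pos_contraction_complement[OF B] h])
      moreover have "ip M (\<lambda>x. B (h j) x - h j x) (\<lambda>x. B (h j) x - h j x) =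
          ip M (\<lambda>x. h j x - B (h j) x) (\<lambda>x. h j x - B (h j) x)"
        unfolding ip_def by (simp add: algebra_simps)
      ultimately show "d 1 j \<le> sqrt (ip M (h j) (h j) - ip M (B (h j)) (h j))"
        unfolding d_def by (simp add: ip_diff_left bddB h)
    qed
    show "(\<lambda>j. sqrt (ip M (h j) (h j) - ip M (B (h j)) (h j))) \<longlonglongrightarrow> 0"
      using tendsto_real_sqrt[OF lim] by simp
  qed
  then have "(\<lambda>j. d n j) \<longlonglongrightarrow> 0"
  proof (induction n)
    case 0
    show ?case by (simp add: d_def ip_def)
  next
    case (Suc n)
    have "(\<lambda>j. d n j + d 1 j) \<longlonglongrightarrow> 0" using tendsto_add[OF Suc.IH[OF Suc.prems] Suc.prems] by simp
    then show ?case
      by (rule tendsto_sandwich[OF _ _ tendsto_const, rotated 2])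
         (use step in \<open>auto simp: d_def ip_self_nonneg\<close>)
  qed
  then show ?thesis unfolding d_def .
qed

end

section \<open>Eigenvectors of symmetric kernels\<close>


context prob_space
begin

lemma abs_ip_op_le:
  assumes K: "bdd_meas (M \<Otimes>\<^sub>M M) K" and C: "C \<ge> 0" "\<And>z. z \<in> space (M \<Otimes>\<^sub>M M) \<Longrightarrow> \<bar>K z\<bar> \<le> C"
    and f: "bdd_meas M f" and g: "bdd_meas M g"
  shows "\<bar>ip M (graphon_op M K f) g\<bar> \<le> C * sqrt (ip M f f) * sqrt (ip M g g)"
proof -
  have "sqrt (ip M (graphon_op M K f) (graphon_op M K f)) \<le> C * sqrt (ip M f f)"
    using real_sqrt_le_mono[OF ip_op_self_le[OF K C f]] C(1) by (simp add: real_sqrt_mult)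
  then show ?thesis
    by (intro order_trans[OF ip_abs_le[OF bdd_meas_op[OF K f] g]] mult_right_mono)
       (auto simp: ip_self_nonneg)
qed

text \<open>\<open>B\<close> is the operator T of \<open>K\<close>, shifted and scaled so that its
  fixed vectors are the eigenvectors of T for \<open>s\<close>. The iterates satisfy Tu - su = (s +
  C) (Bu - u), where the right side tends to 0 in L^2. The pointwise limit of Tu is therefore an
  eigenvector, and it is nonzero because the norms of the iterates do not tend to 0.\<close>

lemma eigenvector_as_power_limit:
  assumes K: "sym_kernel M K" and C: "C > 0" "\<And>z. z \<in> space (M \<Otimes>\<^sub>M M) \<Longrightarrow> \<bar>K z\<bar> \<le> C"
    and s: "s > 0"
    and Bdef: "B = (\<lambda>f x. (graphon_op M K f x + C * f x) / (s + C))"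
    and B: "pos_contraction M B" and g: "bdd_meas M g"
    and nz: "\<not> (\<lambda>n. ip M ((B ^^ n) g) ((B ^^ n) g)) \<longlonglongrightarrow> 0"
  shows "\<exists>e. bdd_meas M e \<and> ip M e e = 1 \<and> (\<forall>x\<in>space M. graphon_op M K e x = s * e x)"
proof -
  note KB = sym_kernel_bdd[OF K]
  have C0: "C \<ge> 0" using C by simp
  let ?T = "graphon_op M K"
  define u where "u n = (B ^^ n) g" for n
  define v where "v n = ?T (u n)" for n
  obtain L where L: "(\<lambda>n. ip M (u n) (u n)) \<longlonglongrightarrow> L"
    and cauchy: "\<And>\<epsilon>. \<epsilon> > 0 \<Longrightarrow> \<exists>N. \<forall>m\<ge>N. \<forall>n\<ge>N.
      ip M (\<lambda>x. u m x - u n x) (\<lambda>x. u m x - u n x) < \<epsilon>"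
    using pos_contraction_power_Cauchy[OF B g] unfolding u_def by blast
  have u_bdd: "bdd_meas M (u n)" and u_le: "ip M (u n) (u n) \<le> ip M g g" for n
    using pos_contraction_power[OF B g] unfolding u_def by auto
  have v_bdd: "bdd_meas M (v n)" for n unfolding v_def by (intro bdd_meas_op KB u_bdd)
  \<comment> \<open>One bound for all \<open>n\<close>, since powers of \<open>B\<close> do not
    increase the norm; it dominates both integrals below.\<close>
  define D where "D = C * sqrt (ip M g g)"
  have v_le: "\<bar>v n x\<bar> \<le> D" if "x \<in> space M" for n x
    unfolding v_def D_def using C0 u_le
    by (intro order_trans[OF op_abs_le[OF KB C0 C(2) u_bdd that]] mult_left_mono) auto
  have "L \<noteq> 0" using L nz unfolding u_def by metis
  moreover have "L \<ge> 0" by (rule LIMSEQ_le_const[OF L]) (auto simp: ip_self_nonneg)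
  ultimately have Lpos: "L > 0" by simp

  have conv: "convergent (\<lambda>n. v n x)" if x: "x \<in> space M" for x
  proof (rule Cauchy_convergent, rule CauchyI)
    fix \<epsilon> :: real assume e: "\<epsilon> > 0"
    obtain N where N: "\<And>m n. m \<ge> N \<Longrightarrow> n \<ge> N \<Longrightarrow>
        ip M (\<lambda>x. u m x - u n x) (\<lambda>x. u m x - u n x) < (\<epsilon> / C)\<^sup>2"
      using cauchy[of "(\<epsilon> / C)\<^sup>2"] e C(1) by (metis divide_pos_pos zero_less_power)
    have "norm (v m x - v n x) < \<epsilon>" if "m \<ge> N" "n \<ge> N" for m n
    proof -
      have "\<bar>v m x - v n x\<bar> \<le> C * sqrt (ip M (\<lambda>x. u m x - u n x) (\<lambda>x. u m x - u n x))"
        using op_abs_le[OF KB C0 C(2) bdd_meas_diff[OF u_bdd u_bdd] x, of m n]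
        unfolding v_def by (simp add: op_diff[OF KB u_bdd u_bdd x])
      also have "\<dots> < C * (\<epsilon> / C)"
        using e C N[OF that] by (intro mult_strict_left_mono real_less_lsqrt) auto
      finally show ?thesis using C by simp
    qed
    then show "\<exists>N. \<forall>m\<ge>N. \<forall>n\<ge>N. norm (v m x - v n x) < \<epsilon>" by blast
  qed
  define k where "k x = lim (\<lambda>n. v n x)" for x
  have vk: "(\<lambda>n. v n x) \<longlonglongrightarrow> k x" if "x \<in> space M" for x
    using conv[OF that] unfolding k_def by (simp add: convergent_LIMSEQ_iff)
  have [measurable]: "v n \<in> borel_measurable M" for n using v_bdd unfolding bdd_meas_def by blast
  have k_meas [measurable]: "k \<in> borel_measurable M" by (rule borel_measurable_LIMSEQ_real[OF vk]) auto
  have k_le: "\<bar>k x\<bar> \<le> D" if "x \<in> space M" for x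
    by (rule LIMSEQ_le_const2[OF tendsto_rabs[OF vk[OF that]]]) (use v_le that in blast)
  have k_bdd: "bdd_meas M k" using k_meas k_le by (rule bdd_measI)

  define d where "d n = sqrt (ip M (\<lambda>x. u (Suc n) x - u n x) (\<lambda>x. u (Suc n) x - u n x))" for n
  have d0: "d \<longlonglongrightarrow> 0"
  proof (rule LIMSEQ_I)
    fix \<epsilon> :: real assume e: "\<epsilon> > 0"
    obtain N where N: "\<And>m n. m \<ge> N \<Longrightarrow> n \<ge> N \<Longrightarrow>
        ip M (\<lambda>x. u m x - u n x) (\<lambda>x. u m x - u n x) < \<epsilon>\<^sup>2"
      using cauchy[of "\<epsilon>\<^sup>2"] e by (metis zero_less_power)
    have "d n < \<epsilon>" if "n \<ge> N" for n
      unfolding d_def using e N[of "Suc n" n] that by (intro real_less_lsqrt) auto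
    then show "\<exists>N. \<forall>n\<ge>N. norm (d n - 0) < \<epsilon>" by (auto simp: d_def ip_self_nonneg)
  qed
  have vu: "v n x - s * u n x = (s + C) * (u (Suc n) x - u n x)" for n x
    using s C unfolding v_def u_def Bdef by (simp add: field_simps)

  have k_eig: "?T k x = s * k x" if x: "x \<in> space M" for x
  proof (rule LIMSEQ_unique)
    have [measurable]: "(\<lambda>y. K (x, y)) \<in> borel_measurable M"
      using bdd_meas_section[OF KB x] unfolding bdd_meas_def by blast
    show lim1: "(\<lambda>n. ?T (v n) x) \<longlonglongrightarrow> ?T k x"
      unfolding graphon_op_def
    proof (rule integral_dominated_convergence[where w = "\<lambda>_. C * D"])
      show "AE y in M. (\<lambda>n. K (x, y) * v n y) \<longlonglongrightarrow> K (x, y) * k y"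
        by (intro AE_I2 tendsto_intros vk)
      show "AE y in M. norm (K (x, y) * v n y) \<le> C * D" for n
        using C0 C(2) v_le x
        by (intro AE_I2) (auto simp: abs_mult space_pair_measure intro!: mult_mono)
    qed auto
    \<comment> \<open>Applying T once more turns the L^2 estimate for v - su into an estimate at the
      point \<open>x\<close>.\<close>
    have "(\<lambda>n. ?T (v n) x - s * v n x) \<longlonglongrightarrow> 0"
    proof (rule Lim_null_comparison)
      show "(\<lambda>n. C * ((s + C) * d n)) \<longlonglongrightarrow> 0" using d0 by (auto intro!: tendsto_eq_intros)
      have "\<bar>?T (v n) x - s * v n x\<bar> \<le> C * ((s + C) * d n)" for n
      proof -
        have "?T (v n) x - s * v n x = ?T (\<lambda>x. v n x - s * u n x) x"
          using op_add_scale[OF KB v_bdd u_bdd x, of n "-s" n] by (simp add: v_def)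
        also have "\<bar>\<dots>\<bar> \<le> C * sqrt (ip M (\<lambda>x. v n x - s * u n x) (\<lambda>x. v n x - s * u n x))"
          by (intro op_abs_le[OF KB C0 C(2) _ x] bdd_meas_intros v_bdd u_bdd)
        also have "sqrt (ip M (\<lambda>x. v n x - s * u n x) (\<lambda>x. v n x - s * u n x)) = (s + C) * d n"
          unfolding vu d_def using s C by (simp add: ip_scale_left ip_scale_right real_sqrt_mult)
        finally show ?thesis .
      qed
      then show "\<forall>\<^sub>F n in sequentially. norm (?T (v n) x - s * v n x) \<le> C * ((s + C) * d n)" by simp
    qed
    then have "(\<lambda>n. (?T (v n) x - s * v n x) + s * v n x) \<longlonglongrightarrow> 0 + s * k x"
      by (intro tendsto_intros vk x)
    then show "(\<lambda>n. ?T (v n) x) \<longlonglongrightarrow> s * k x" by simp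
  qed

  have vv: "(\<lambda>n. ip M (v n) (v n)) \<longlonglongrightarrow> ip M k k"
    unfolding ip_def
  proof (rule integral_dominated_convergence[where w = "\<lambda>_. D * D"])
    show "AE x in M. (\<lambda>n. v n x * v n x) \<longlonglongrightarrow> k x * k x"
      by (intro AE_I2 tendsto_intros vk)
    show "AE x in M. norm (v n x * v n x) \<le> D * D" for n
    proof (intro AE_I2)
      fix x assume x: "x \<in> space M"
      have "\<bar>v n x\<bar> * \<bar>v n x\<bar> \<le> D * D"
        using v_le[OF x, of n] by (intro mult_mono) auto
      then show "norm (v n x * v n x) \<le> D * D" by simp
    qed
  qed auto
  \<comment> \<open>The triangle inequality for su = v - (s + C) (Bu - u), in the limit; it keeps
    \<open>k\<close> away from 0.\<close>
  have "s * sqrt L \<le> sqrt (ip M k k) + (s + C) * 0"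
  proof (rule LIMSEQ_le)
    show "(\<lambda>n. s * sqrt (ip M (u n) (u n))) \<longlonglongrightarrow> s * sqrt L" by (intro tendsto_intros L)
    show "(\<lambda>n. sqrt (ip M (v n) (v n)) + (s + C) * d n) \<longlonglongrightarrow> sqrt (ip M k k) + (s + C) * 0"
      by (intro tendsto_intros vv d0)
    have "s * sqrt (ip M (u n) (u n)) \<le> sqrt (ip M (v n) (v n)) + (s + C) * d n" for n
    proof -
      let ?w = "\<lambda>x. - (s + C) * (u (Suc n) x - u n x)"
      have "s * u n x = v n x + ?w x" for x using vu[of n x] by (simp add: algebra_simps)
      then have "s * sqrt (ip M (u n) (u n)) = sqrt (ip M (\<lambda>x. v n x + ?w x) (\<lambda>x. v n x + ?w x))"
        using s ip_scale_left[of M s "u n" "\<lambda>x. s * u n x"] ip_scale_right[of M "u n" s "u n"]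
        by (simp add: real_sqrt_mult)
      also have "\<dots> \<le> sqrt (ip M (v n) (v n)) + sqrt (ip M ?w ?w)"
        by (intro ip_self_add_triangle bdd_meas_intros v_bdd u_bdd)
      also have "sqrt (ip M ?w ?w) = (s + C) * d n"
        unfolding d_def ip_scale_left ip_scale_right using s C by (simp add: real_sqrt_mult)
      finally show ?thesis .
    qed
    then show "\<exists>N. \<forall>n\<ge>N. s * sqrt (ip M (u n) (u n)) \<le> sqrt (ip M (v n) (v n)) + (s + C) * d n"
      by blast
  qed
  then have "sqrt (ip M k k) > 0" using s Lpos by (smt (verit) mult_pos_pos real_sqrt_gt_zero mult_zero_right)
  then have kpos: "ip M k k > 0" by simp
  show ?thesis
  proof (intro exI[of _ "\<lambda>x. k x / sqrt (ip M k k)"] conjI ballI)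
    show "bdd_meas M (\<lambda>x. k x / sqrt (ip M k k))" by (intro bdd_meas_intros k_bdd)
    show "ip M (\<lambda>x. k x / sqrt (ip M k k)) (\<lambda>x. k x / sqrt (ip M k k)) = 1"
      unfolding ip_divide_left ip_divide_right using kpos by simp
    fix x assume x: "x \<in> space M"
    have "?T (\<lambda>x. k x / sqrt (ip M k k)) x = ?T k x / sqrt (ip M k k)"
      unfolding graphon_op_def by simp
    then show "?T (\<lambda>x. k x / sqrt (ip M k k)) x = s * (k x / sqrt (ip M k k))"
      using k_eig[OF x] by simp
  qed
qed

text \<open>The nonvanishing of the limit is where the Hilbert-Schmidt property enters:
  \<open>(T B\<^sup>n h)(x) = \<langle>B\<^sup>n K(x, \<cdot>), h\<rangle>\<close>, so if all limits vanished, then \<open>T B\<^sup>n \<rightarrow> 0\<close> in norm,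
  against \<open>T B\<^sup>n h \<approx> T h\<close> for near-maximisers \<open>h\<close> of the quadratic form.\<close>

lemma power_limit_nonzero:
  assumes K: "sym_kernel M K" and C: "C > 0" "\<And>z. z \<in> space (M \<Otimes>\<^sub>M M) \<Longrightarrow> \<bar>K z\<bar> \<le> C"
    and s: "s > 0"
    and Bdef: "B = (\<lambda>f x. (graphon_op M K f x + C * f x) / (s + C))"
    and B: "pos_contraction M B"
    and h: "\<And>j. bdd_meas M (h j)" "\<And>j. ip M (h j) (h j) \<le> 1"
    and hlim: "(\<lambda>j. ip M (graphon_op M K (h j)) (h j)) \<longlonglongrightarrow> s"
  shows "\<exists>g. bdd_meas M g \<and> \<not> (\<lambda>n. ip M ((B ^^ n) g) ((B ^^ n) g)) \<longlonglongrightarrow> 0"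
proof (rule ccontr)
  assume "\<not> ?thesis"
  then have lim0: "(\<lambda>n. ip M ((B ^^ n) g) ((B ^^ n) g)) \<longlonglongrightarrow> 0" if "bdd_meas M g" for g
    using that by blast
  note KB = sym_kernel_bdd[OF K]
  have [measurable]: "K \<in> borel_measurable (M \<Otimes>\<^sub>M M)" using KB unfolding bdd_meas_def by blast
  have C0: "C \<ge> 0" using C by simp
  let ?T = "graphon_op M K"
  define P where "P n x = (B ^^ n) (\<lambda>y. K (x, y))" for n x
  have sec: "bdd_meas M (\<lambda>y. K (x, y))" if "x \<in> space M" for x by (rule bdd_meas_section[OF KB that])
  have P_bdd: "bdd_meas M (P n x)" if "x \<in> space M" for n x
    unfolding P_def by (rule pos_contraction_power(1)[OF B sec[OF that]])
  \<comment> \<open>\<open>P n x\<close> is defined separately for each \<open>x\<close>, so joint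
    measurability has to be built up: the recursion of \<open>B\<close> is repeated on a jointly
    measurable representative.\<close>
  have P_joint: "\<exists>G\<in>borel_measurable (M \<Otimes>\<^sub>M M). \<forall>x\<in>space M. \<forall>y\<in>space M. G (x, y) = P n x y" for n
  proof (induction n)
    case 0
    show ?case by (intro bexI[of _ K]) (auto simp: P_def)
  next
    case (Suc n)
    then obtain G where G [measurable]: "G \<in> borel_measurable (M \<Otimes>\<^sub>M M)"
      and GP: "\<And>x y. x \<in> space M \<Longrightarrow> y \<in> space M \<Longrightarrow> G (x, y) = P n x y" by blast
    let ?G = "\<lambda>(x, y). ((\<integral>z. K (y, z) * G (x, z) \<partial>M) + C * G (x, y)) / (s + C)"
    have "?G \<in> borel_measurable (M \<Otimes>\<^sub>M M)" by measurable
    moreover have "?G (x, y) = P (Suc n) x y" if "x \<in> space M" "y \<in> space M" for x y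
    proof -
      have "(\<integral>z. K (y, z) * G (x, z) \<partial>M) = ?T (P n x) y"
        unfolding graphon_op_def using that by (intro Bochner_Integration.integral_cong) (auto simp: GP)
      then show ?thesis using that GP by (simp add: P_def Bdef)
    qed
    ultimately show ?case by blast
  qed
  have P_meas: "(\<lambda>x. ip M (P n x) (P n x)) \<in> borel_measurable M" for n
  proof -
    obtain G where G [measurable]: "G \<in> borel_measurable (M \<Otimes>\<^sub>M M)"
      and GP: "\<And>x y. x \<in> space M \<Longrightarrow> y \<in> space M \<Longrightarrow> G (x, y) = P n x y" using P_joint by blast
    have "(\<lambda>x. \<integral>y. G (x, y) * G (x, y) \<partial>M) \<in> borel_measurable M" by measurable
    moreover have "(\<integral>y. G (x, y) * G (x, y) \<partial>M) = ip M (P n x) (P n x)" if "x \<in> space M" for x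
      unfolding ip_def using that by (intro Bochner_Integration.integral_cong) (auto simp: GP)
    ultimately show ?thesis by (simp cong: measurable_cong)
  qed
  have P_le: "ip M (P n x) (P n x) \<le> C\<^sup>2" if x: "x \<in> space M" for n x
  proof -
    have "ip M (P n x) (P n x) \<le> ip M (\<lambda>y. K (x, y)) (\<lambda>y. K (x, y))"
      unfolding P_def by (rule pos_contraction_power(2)[OF B sec[OF x]])
    also have "\<dots> \<le> (\<integral>y. C\<^sup>2 \<partial>M)"
      unfolding ip_def power2_eq_square[symmetric] using x C
      by (intro integral_mono bdd_meas_integrable bdd_meas_intros sec)
         (auto simp: space_pair_measure intro!: iffD2[OF abs_le_square_iff[symmetric]])
    finally show ?thesis by (simp add: prob_space)
  qed
  have P_int: "integrable M (\<lambda>x. ip M (P n x) (P n x))" for n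
    using P_le by (intro bdd_meas_integrable bdd_measI[of _ _ "C\<^sup>2"] P_meas) (auto simp: ip_self_nonneg)
  \<comment> \<open>The squared Hilbert-Schmidt norm of T B^n, whose kernel has the sections
    \<open>P n x\<close>.\<close>
  define \<phi> where "\<phi> n = (\<integral>x. ip M (P n x) (P n x) \<partial>M)" for n
  have "\<phi> \<longlonglongrightarrow> (\<integral>x. 0 \<partial>M)"
    unfolding \<phi>_def
  proof (rule integral_dominated_convergence[where w = "\<lambda>_. C\<^sup>2"])
    show "AE x in M. (\<lambda>n. ip M (P n x) (P n x)) \<longlonglongrightarrow> 0"
      unfolding P_def by (intro AE_I2 lim0 sec)
    show "AE x in M. norm (ip M (P n x) (P n x)) \<le> C\<^sup>2" for n
      using P_le by (intro AE_I2) (auto simp: ip_self_nonneg)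
  qed (auto simp: P_meas)
  then have phi: "\<phi> \<longlonglongrightarrow> 0" by simp

  have TPh: "\<bar>ip M (?T ((B ^^ n) (h j))) (h j)\<bar> \<le> sqrt (\<phi> n)" for n j
  proof -
    let ?u = "(B ^^ n) (h j)"
    have u: "bdd_meas M ?u" by (rule pos_contraction_power(1)[OF B h(1)])
    note Tu = bdd_meas_op[OF KB u]
    have "ip M (?T ?u) (?T ?u) \<le> \<phi> n"
      unfolding \<phi>_def ip_def[of M "?T ?u"]
    proof (intro integral_mono P_int bdd_meas_integrable bdd_meas_intros Tu)
      fix x assume x: "x \<in> space M"
      have "?T ?u x = ip M (P n x) (h j)"
        using pos_contraction_power_shift[OF B sec[OF x] h(1), of 0 n j]
        unfolding graphon_op_eq_ip P_def by simp
      then have "?T ?u x * ?T ?u x \<le> ip M (P n x) (P n x) * ip M (h j) (h j)"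
        using ip_Cauchy_Schwarz[OF P_bdd[OF x] h(1)] by (simp add: power2_eq_square)
      also have "\<dots> \<le> ip M (P n x) (P n x)"
        by (rule mult_right_le_one_le) (auto simp: ip_self_nonneg h)
      finally show "?T ?u x * ?T ?u x \<le> ip M (P n x) (P n x)" .
    qed
    then have "sqrt (ip M (?T ?u) (?T ?u)) * sqrt (ip M (h j) (h j)) \<le> sqrt (\<phi> n) * 1"
      using h(2)[of j] by (intro mult_mono) (auto simp: ip_self_nonneg intro: order_trans[OF ip_self_nonneg])
    then show ?thesis using ip_abs_le[OF Tu h(1), of j] by simp
  qed

  have near: "(\<lambda>j. sqrt (ip M (\<lambda>x. (B ^^ n) (h j) x - h j x) (\<lambda>x. (B ^^ n) (h j) x - h j x))) \<longlonglongrightarrow> 0" for n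
  proof (rule pos_contraction_power_near_fixed[OF B h(1)])
    have Bh: "ip M (B (h j)) (h j) = (ip M (?T (h j)) (h j) + C * ip M (h j) (h j)) / (s + C)" for j
      unfolding Bdef ip_divide_left
      by (simp add: ip_add_left ip_scale_left bdd_meas_intros bdd_meas_op KB h)
    show "(\<lambda>j. ip M (h j) (h j) - ip M (B (h j)) (h j)) \<longlonglongrightarrow> 0"
    proof (rule tendsto_sandwich[OF _ _ tendsto_const])
      show "\<forall>\<^sub>F j in sequentially. 0 \<le> ip M (h j) (h j) - ip M (B (h j)) (h j)"
        using B h(1) unfolding pos_contraction_def by auto
      show "\<forall>\<^sub>F j in sequentially. ip M (h j) (h j) - ip M (B (h j)) (h j)
          \<le> (s - ip M (?T (h j)) (h j)) / (s + C)"
      proof (intro always_eventually allI)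
        fix j
        \<comment> \<open>By the choice of \<open>B\<close>, its defect at \<open>h j\<close> is the
          defect of T divided by \<open>s + C\<close>; near-maximisers for T are thus nearly fixed
          by \<open>B\<close>.\<close>
        have "ip M (h j) (h j) - ip M (B (h j)) (h j)
            = (s * ip M (h j) (h j) - ip M (?T (h j)) (h j)) / (s + C)"
          unfolding Bh using s C by (simp add: field_simps)
        also have "\<dots> \<le> (s - ip M (?T (h j)) (h j)) / (s + C)"
          using s C h(2)[of j] by (intro divide_right_mono) auto
        finally show "ip M (h j) (h j) - ip M (B (h j)) (h j) \<le> (s - ip M (?T (h j)) (h j)) / (s + C)" .
      qed
      have "(\<lambda>j. (s - ip M (?T (h j)) (h j)) / (s + C)) \<longlonglongrightarrow> (s - s) / (s + C)"
        using s C by (intro tendsto_intros hlim) auto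
      then show "(\<lambda>j. (s - ip M (?T (h j)) (h j)) / (s + C)) \<longlonglongrightarrow> 0" by simp
    qed
  qed

  \<comment> \<open>Write <Th, h> as <T B^n h, h> - <T (B^n h - h), h>. The first term is bounded by
    the Hilbert-Schmidt norm of T B^n for every j, the second vanishes as j grows with n
    fixed.\<close>
  have s_le: "s \<le> sqrt (\<phi> n)" for n
  proof -
    define d where "d j = sqrt (ip M (\<lambda>x. (B ^^ n) (h j) x - h j x) (\<lambda>x. (B ^^ n) (h j) x - h j x))" for j
    have "s \<le> sqrt (\<phi> n) + C * 0"
    proof (rule LIMSEQ_le[OF hlim])
      show "(\<lambda>j. sqrt (\<phi> n) + C * d j) \<longlonglongrightarrow> sqrt (\<phi> n) + C * 0"
        unfolding d_def by (intro tendsto_intros near)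
      have "ip M (?T (h j)) (h j) \<le> sqrt (\<phi> n) + C * d j" for j
      proof -
        let ?u = "(B ^^ n) (h j)"
        have u: "bdd_meas M ?u" by (rule pos_contraction_power(1)[OF B h(1)])
        note b = bdd_meas_diff[OF u h(1)[of j]]
        have "ip M (?T (\<lambda>x. ?u x - h j x)) (h j) = ip M (\<lambda>x. ?T ?u x - ?T (h j) x) (h j)"
          by (intro ip_cong) (auto simp: op_diff[OF KB u h(1)])
        also have "\<dots> = ip M (?T ?u) (h j) - ip M (?T (h j)) (h j)"
          by (intro ip_diff_left bdd_meas_op KB u h)
        finally have eq: "ip M (?T (\<lambda>x. ?u x - h j x)) (h j) = ip M (?T ?u) (h j) - ip M (?T (h j)) (h j)" .
        have "\<bar>ip M (?T (\<lambda>x. ?u x - h j x)) (h j)\<bar> \<le> C * d j * sqrt (ip M (h j) (h j))"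
          unfolding d_def by (rule abs_ip_op_le[OF KB C0 C(2) b h(1)])
        also have "\<dots> \<le> C * d j"
          using h(2)[of j] C0 by (intro mult_right_le_one_le) (auto simp: d_def ip_self_nonneg)
        finally show ?thesis using eq TPh[of n j] by linarith
      qed
      then show "\<exists>N. \<forall>j\<ge>N. ip M (?T (h j)) (h j) \<le> sqrt (\<phi> n) + C * d j" by blast
    qed
    then show ?thesis by simp
  qed
  have "s \<le> sqrt 0"
    by (rule LIMSEQ_le_const[OF tendsto_real_sqrt[OF phi]]) (use s_le in blast)
  then show False using s by simp
qed

text \<open>With \<open>s\<close> the supremum of the form over the unit ball, the form lies between
  -C |f|^2 and s |f|^2, so (T + C) / (s + C) is a positive contraction. A maximising sequence shows
  that its powers do not all die out.\<close>

theorem top_eigenvector: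
  assumes K: "sym_kernel M K"
    and pos: "bdd_meas M f0" "ip M (graphon_op M K f0) f0 > 0"
  obtains s e where "s > 0" "bdd_meas M e" "ip M e e = 1"
    "\<And>x. x \<in> space M \<Longrightarrow> graphon_op M K e x = s * e x"
    "\<And>f. bdd_meas M f \<Longrightarrow> ip M (graphon_op M K f) f \<le> s * ip M f f"
proof -
  note KB = sym_kernel_bdd[OF K]
  obtain C where C: "C > 0" "\<And>z. z \<in> space (M \<Otimes>\<^sub>M M) \<Longrightarrow> \<bar>K z\<bar> \<le> C"
    using bdd_meas_bound[OF KB] by metis
  have C0: "C \<ge> 0" using C by simp
  let ?T = "graphon_op M K"
  have abs_le: "\<bar>ip M (?T f) f\<bar> \<le> C * ip M f f" if "bdd_meas M f" for f
    using abs_ip_op_le[OF KB C0 C(2) that that] by (simp add: ip_self_nonneg mult.assoc)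
  \<comment> \<open>The ball rather than the sphere: it contains 0, so the set is nonempty at
    once.\<close>
  define Q where "Q = {ip M (?T f) f |f. bdd_meas M f \<and> ip M f f \<le> 1}"
  define s where "s = Sup Q"
  have Q_bdd: "bdd_above Q"
  proof (rule bdd_aboveI[of _ C])
    fix q assume "q \<in> Q"
    then obtain f where f: "bdd_meas M f" "ip M f f \<le> 1" "q = ip M (?T f) f" unfolding Q_def by blast
    have "C * ip M f f \<le> C * 1" using f C0 by (intro mult_left_mono) auto
    then show "q \<le> C" using abs_le[OF f(1)] f(3) by linarith
  qed
  have q_le: "ip M (?T f) f \<le> s * ip M f f" if f: "bdd_meas M f" for f
  proof (cases "ip M f f = 0")
    case True
    then show ?thesis using abs_le[OF f] by simp
  next
    case False
    define c where "c = sqrt (ip M f f)"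
    have c: "c > 0" "c\<^sup>2 = ip M f f" using False ip_self_nonneg[of M f] by (auto simp: c_def)
    have Tdiv: "?T (\<lambda>x. f x / c) = (\<lambda>x. ?T f x / c)" unfolding graphon_op_def by simp
    have "ip M (\<lambda>x. f x / c) (\<lambda>x. f x / c) = 1"
      unfolding ip_divide_left ip_divide_right c(2)[symmetric] using c(1) by (simp add: power2_eq_square)
    then have "ip M (?T (\<lambda>x. f x / c)) (\<lambda>x. f x / c) \<in> Q"
      unfolding Q_def using bdd_meas_divide[OF f, of c] by force
    then have "ip M (?T (\<lambda>x. f x / c)) (\<lambda>x. f x / c) \<le> s"
      unfolding s_def by (intro cSup_upper Q_bdd)
    then have "ip M (?T f) f / c\<^sup>2 \<le> s"
      unfolding Tdiv ip_divide_left ip_divide_right by (simp add: power2_eq_square)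
    then have "ip M (?T f) f \<le> s * c\<^sup>2" using c(1) by (simp add: pos_divide_le_eq)
    then show ?thesis using c(2) by simp
  qed
  have s: "s > 0"
    using q_le[OF pos(1)] pos(2) ip_self_nonneg[of M f0] by (smt (verit) mult_nonpos_nonneg)
  define B where "B = (\<lambda>f x. (?T f x + C * f x) / (s + C))"
  have bddB: "bdd_meas M (B f)" if "bdd_meas M f" for f
    unfolding B_def by (intro bdd_meas_intros bdd_meas_op KB that)
  have ipB: "ip M (B f) g = (ip M (?T f) g + C * ip M f g) / (s + C)"
    if "bdd_meas M f" "bdd_meas M g" for f g
    unfolding B_def ip_divide_left using that
    by (simp add: ip_add_left ip_scale_left bdd_meas_intros bdd_meas_op KB)
  have B: "pos_contraction M B"
    unfolding pos_contraction_def
  proof (intro conjI allI impI ballI)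
    fix f assume f: "bdd_meas M f"
    show "bdd_meas M (B f)" by (rule bddB[OF f])
    show "0 \<le> ip M (B f) f" "ip M (B f) f \<le> ip M f f"
      unfolding ipB[OF f f] using abs_le[OF f] q_le[OF f] s C by (auto simp: field_simps)
    fix g assume g: "bdd_meas M g"
    show "ip M (B f) g = ip M f (B g)"
      unfolding ip_commute[of M f "B g"] ipB[OF f g] ipB[OF g f]
      using ip_op_commute[OF K f g] by (simp add: ip_commute)
    fix t x assume "x \<in> space M"
    then show "B (\<lambda>x. f x + t * g x) x = B f x + t * B g x"
      unfolding B_def by (simp add: op_add_scale[OF KB f g] add_divide_distrib distrib_left ac_simps)
  qed
  have "\<exists>h. bdd_meas M h \<and> ip M h h \<le> 1 \<and> s - inverse (real (Suc j)) < ip M (?T h) h" for j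
  proof -
    have "ip M (?T (\<lambda>x. 0)) (\<lambda>x. 0) \<in> Q"
      unfolding Q_def by (intro CollectI exI[of _ "\<lambda>x. 0"]) (auto simp: bdd_meas_const ip_zero_left)
    then have "\<exists>q\<in>Q. s - inverse (real (Suc j)) < q"
      unfolding s_def by (intro less_cSupD) auto
    then show ?thesis unfolding Q_def by blast
  qed
  then obtain h where h: "\<And>j. bdd_meas M (h j)" "\<And>j. ip M (h j) (h j) \<le> 1"
    and hs: "\<And>j. s - inverse (real (Suc j)) < ip M (?T (h j)) (h j)" by metis
  have "(\<lambda>j. ip M (?T (h j)) (h j)) \<longlonglongrightarrow> s"
  proof (rule tendsto_sandwich[OF _ _ _ tendsto_const])
    show "(\<lambda>j. s - inverse (real (Suc j))) \<longlonglongrightarrow> s"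
      using tendsto_diff[OF tendsto_const LIMSEQ_inverse_real_of_nat, of s] by simp
    have "ip M (?T (h j)) (h j) \<le> s" for j
      using q_le[OF h(1), of j] h(2)[of j] s by (smt (verit) mult_left_le)
    then show "\<forall>\<^sub>F j in sequentially. ip M (?T (h j)) (h j) \<le> s" by simp
  qed (use hs in \<open>auto intro!: always_eventually less_imp_le\<close>)
  from power_limit_nonzero[OF K C s B_def B h this] obtain g
    where "bdd_meas M g" "\<not> (\<lambda>n. ip M ((B ^^ n) g) ((B ^^ n) g)) \<longlonglongrightarrow> 0" by blast
  from eigenvector_as_power_limit[OF K C s B_def B this] show thesis
    using that s q_le by blast
qed

end

section \<open>The spectral decomposition\<close>


text \<open>The index type is left free: a single index for one deflation step, an initial segment
  for Bessel's inequality, and pairs of a sign and a number when both signs are removed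
  together.\<close>

definition residual_kernel ::
  "('a \<times> 'a \<Rightarrow> real) \<Rightarrow> 'i set \<Rightarrow> ('i \<Rightarrow> real) \<Rightarrow> ('i \<Rightarrow> 'a \<Rightarrow> real) \<Rightarrow> 'a \<times> 'a \<Rightarrow> real" where
  "residual_kernel K I \<mu> v = (\<lambda>z. K z - (\<Sum>i\<in>I. \<mu> i * (v i (fst z) * v i (snd z))))"

text \<open>An eigenpair exhausting the quadratic form from above; \<open>s = 0\<close>, \<open>e = 0\<close> marks that the form is
  already nonpositive.\<close>

definition top_pair :: "'a measure \<Rightarrow> ('a \<times> 'a \<Rightarrow> real) \<Rightarrow> real \<Rightarrow> ('a \<Rightarrow> real) \<Rightarrow> bool" where
  "top_pair M K s e \<longleftrightarrow>
     0 \<le> s \<and> bdd_meas M e \<and> ip M e e = (if s > 0 then 1 else 0) \<and> (s = 0 \<longrightarrow> e = (\<lambda>_. 0)) \<and>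
     (\<forall>x\<in>space M. graphon_op M K e x = s * e x) \<and>
     (\<forall>f. bdd_meas M f \<longrightarrow> ip M (graphon_op M K f) f \<le> s * ip M f f)"

text \<open>The last clause is the upper half of the min-max principle: on functions orthogonal to
  the first \<open>n\<close> eigenfunctions the form is at most \<open>l n\<close>. With the sum on
  the right it can be stated for every \<open>f\<close>. Zero entries of \<open>l\<close> carry null
  functions, so that the sequences are always infinite.\<close>

definition spectral_system ::
  "'a measure \<Rightarrow> ('a \<times> 'a \<Rightarrow> real) \<Rightarrow> (nat \<Rightarrow> real) \<Rightarrow> (nat \<Rightarrow> 'a \<Rightarrow> real) \<Rightarrow> bool" where
  "spectral_system M K l e \<longleftrightarrow>
     decseq l \<and> (\<forall>n. 0 \<le> l n) \<and> (\<forall>n. bdd_meas M (e n)) \<and>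
     (\<forall>n. \<forall>x\<in>space M. graphon_op M K (e n) x = l n * e n x) \<and>
     (\<forall>i j. ip M (e i) (e j) = (if i = j \<and> l i > 0 then 1 else 0)) \<and>
     (\<forall>n f. bdd_meas M f \<longrightarrow>
        ip M (graphon_op M K f) f \<le> l n * ip M f f + (\<Sum>i<n. l i * (ip M (e i) f)\<^sup>2))"

context prob_space
begin

lemma top_pair_exists:
  assumes K: "sym_kernel M K"
  shows "\<exists>s e. top_pair M K s e"
proof (cases "\<exists>f. bdd_meas M f \<and> ip M (graphon_op M K f) f > 0")
  case True
  then obtain f where "bdd_meas M f" "ip M (graphon_op M K f) f > 0" by blast
  from top_eigenvector[OF K this] obtain s e where "s > 0" "bdd_meas M e" "ip M e e = 1"
    "\<And>x. x \<in> space M \<Longrightarrow> graphon_op M K e x = s * e x"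
    "\<And>f. bdd_meas M f \<Longrightarrow> ip M (graphon_op M K f) f \<le> s * ip M f f" by blast
  then have "top_pair M K s e" unfolding top_pair_def by auto
  then show ?thesis by blast
next
  case False
  then have "top_pair M K 0 (\<lambda>_. 0)"
    unfolding top_pair_def by (auto simp: bdd_meas_const ip_zero_left graphon_op_def not_less)
  then show ?thesis by blast
qed

lemma bdd_meas_residual_kernel:
  assumes "bdd_meas (M \<Otimes>\<^sub>M M) K" "\<And>i. i \<in> I \<Longrightarrow> bdd_meas M (v i)"
  shows "bdd_meas (M \<Otimes>\<^sub>M M) (residual_kernel K I \<mu> v)"
  unfolding residual_kernel_def by (intro bdd_meas_diff bdd_meas_sum bdd_meas_mult[OF bdd_meas_const] bdd_meas_fst_snd assms)

lemma sym_kernel_residual_kernel: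
  assumes "sym_kernel M K" "\<And>i. i \<in> I \<Longrightarrow> bdd_meas M (v i)"
  shows "sym_kernel M (residual_kernel K I \<mu> v)"
  using assms bdd_meas_residual_kernel[of K I v \<mu>]
  unfolding sym_kernel_def by (auto simp: residual_kernel_def mult.commute)

lemma op_residual_kernel:
  assumes K: "bdd_meas (M \<Otimes>\<^sub>M M) K" and v: "\<And>i. i \<in> I \<Longrightarrow> bdd_meas M (v i)"
    and f: "bdd_meas M f" and x: "x \<in> space M"
  shows "graphon_op M (residual_kernel K I \<mu> v) f x =
    graphon_op M K f x - (\<Sum>i\<in>I. \<mu> i * ip M (v i) f * v i x)"
proof -
  have "graphon_op M (residual_kernel K I \<mu> v) f x =
      ip M (\<lambda>y. K (x, y) - (\<Sum>i\<in>I. (\<mu> i * v i x) * v i y)) f"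
    unfolding graphon_op_eq_ip residual_kernel_def by (simp add: mult.assoc)
  also have "\<dots> = ip M (\<lambda>y. K (x, y)) f - (\<Sum>i\<in>I. (\<mu> i * v i x) * ip M (v i) f)"
    by (simp add: ip_diff_left ip_sum_left ip_scale_left bdd_meas_intros bdd_meas_section[OF K x] v f)
  finally show ?thesis unfolding graphon_op_eq_ip by (simp add: ac_simps)
qed

lemma ip_op_residual_kernel:
  assumes K: "bdd_meas (M \<Otimes>\<^sub>M M) K" and v: "\<And>i. i \<in> I \<Longrightarrow> bdd_meas M (v i)"
    and f: "bdd_meas M f" and g: "bdd_meas M g"
  shows "ip M (graphon_op M (residual_kernel K I \<mu> v) f) g =
    ip M (graphon_op M K f) g - (\<Sum>i\<in>I. \<mu> i * ip M (v i) f * ip M (v i) g)"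
proof -
  have "ip M (graphon_op M (residual_kernel K I \<mu> v) f) g =
      ip M (\<lambda>x. graphon_op M K f x - (\<Sum>i\<in>I. (\<mu> i * ip M (v i) f) * v i x)) g"
    by (intro ip_cong) (auto simp: op_residual_kernel[OF K v f])
  also have "\<dots> = ip M (graphon_op M K f) g - (\<Sum>i\<in>I. \<mu> i * ip M (v i) f * ip M (v i) g)"
    by (simp add: ip_diff_left ip_sum_left ip_scale_left bdd_meas_intros bdd_meas_op K v f g)
  finally show ?thesis .
qed

text \<open>Deflation: the rank-one part of the top eigenpair is subtracted, and the procedure is
  repeated. The new operator annihilates all earlier eigenfunctions, so the next one is orthogonal
  to them and is an eigenfunction of the original operator too.\<close>

theorem spectral_system_exists:
  assumes K: "sym_kernel M K"
  shows "\<exists>l e. spectral_system M K l e"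
proof -
  \<comment> \<open>A top pair is chosen for every symmetric kernel in advance, so that the
    recursion runs over kernels alone.\<close>
  obtain S E where SE: "\<And>k. sym_kernel M k \<Longrightarrow> top_pair M k (S k) (E k)"
    using top_pair_exists by metis
  define Ks where "Ks = rec_nat K (\<lambda>_ k. residual_kernel k {()} (\<lambda>_. S k) (\<lambda>_. E k))"
  define l where "l n = S (Ks n)" for n
  define e where "e n = E (Ks n)" for n
  have Ks0: "Ks 0 = K" and Ks_Suc: "Ks (Suc n) = residual_kernel (Ks n) {()} (\<lambda>_. l n) (\<lambda>_. e n)" for n
    unfolding Ks_def l_def e_def by auto
  have Ks_sym: "sym_kernel M (Ks n)" for n
  proof (induction n)
    case 0
    show ?case unfolding Ks0 by (rule K)
  next
    case (Suc n)
    then show ?case unfolding Ks_Suc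
      using SE[OF Suc] by (intro sym_kernel_residual_kernel) (auto simp: top_pair_def e_def)
  qed
  note KsB = sym_kernel_bdd[OF Ks_sym] and KB = sym_kernel_bdd[OF K]
  have top: "top_pair M (Ks n) (l n) (e n)" for n
    using SE[OF Ks_sym] unfolding l_def e_def .
  have l_nonneg: "0 \<le> l n" and e_bdd: "bdd_meas M (e n)"
    and e_norm: "ip M (e n) (e n) = (if l n > 0 then 1 else 0)"
    and e_zero: "l n = 0 \<Longrightarrow> e n = (\<lambda>_. 0)"
    and e_top: "\<And>x. x \<in> space M \<Longrightarrow> graphon_op M (Ks n) (e n) x = l n * e n x"
    and l_top: "\<And>f. bdd_meas M f \<Longrightarrow> ip M (graphon_op M (Ks n) f) f \<le> l n * ip M f f" for n
    using top[of n] unfolding top_pair_def by auto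
  have op_Suc: "graphon_op M (Ks (Suc n)) f x = graphon_op M (Ks n) f x - l n * ip M (e n) f * e n x"
    if "bdd_meas M f" "x \<in> space M" for n f x
    unfolding Ks_Suc using op_residual_kernel[where I = "{()}" and \<mu> = "\<lambda>_. l n" and v = "\<lambda>_. e n", OF KsB e_bdd that] by simp
  have op_Ks: "graphon_op M (Ks n) f x = graphon_op M K f x - (\<Sum>i<n. l i * ip M (e i) f * e i x)"
    if "bdd_meas M f" "x \<in> space M" for n f x
    by (induction n) (auto simp: Ks0 op_Suc that)
  have quad_Suc: "ip M (graphon_op M (Ks (Suc n)) f) f = ip M (graphon_op M (Ks n) f) f - l n * (ip M (e n) f)\<^sup>2"
    if "bdd_meas M f" for n f
    unfolding Ks_Suc using ip_op_residual_kernel[where I = "{()}" and \<mu> = "\<lambda>_. l n" and v = "\<lambda>_. e n", OF KsB e_bdd that that]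
    by (simp add: power2_eq_square)
  have quad_Ks: "ip M (graphon_op M (Ks n) f) f = ip M (graphon_op M K f) f - (\<Sum>i<n. l i * (ip M (e i) f)\<^sup>2)"
    if "bdd_meas M f" for n f
    by (induction n) (auto simp: Ks0 quad_Suc that)
  \<comment> \<open>Eigenfunctions of a symmetric operator for the distinct eigenvalues
    \<open>l n\<close> and 0 are orthogonal; if \<open>l n = 0\<close>, then \<open>e n\<close>
    itself is 0.\<close>
  have orth_step: "ip M (e n) (e j) = 0"
    if ker: "\<forall>x\<in>space M. graphon_op M (Ks n) (e j) x = 0" for n j
  proof (cases "l n = 0")
    case True
    then show ?thesis by (simp add: e_zero ip_zero_left)
  next
    case False
    have "l n * ip M (e n) (e j) = ip M (graphon_op M (Ks n) (e n)) (e j)"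
      unfolding ip_scale_left[symmetric] by (intro ip_cong) (auto simp: e_top)
    also have "\<dots> = ip M (e n) (graphon_op M (Ks n) (e j))"
      by (rule ip_op_commute[OF Ks_sym e_bdd e_bdd])
    also have "\<dots> = ip M (e n) (\<lambda>_. 0)" using ker by (intro ip_cong) auto
    finally show ?thesis using False by (simp add: ip_def)
  qed
  have ker: "\<forall>j<n. \<forall>x\<in>space M. graphon_op M (Ks n) (e j) x = 0" for n
  proof (induction n)
    case (Suc n)
    show ?case
    proof (intro allI impI ballI)
      fix j x assume j: "j < Suc n" and x: "x \<in> space M"
      show "graphon_op M (Ks (Suc n)) (e j) x = 0"
      proof (cases "j = n")
        case True
        then show ?thesis by (cases "l n = 0") (auto simp: op_Suc e_bdd x e_top e_norm less_le l_nonneg)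
      next
        case False
        then show ?thesis using Suc j x orth_step[of n j] by (auto simp: op_Suc e_bdd)
      qed
    qed
  qed simp
  have orth: "ip M (e i) (e j) = (if i = j \<and> l i > 0 then 1 else 0)" for i j
    using orth_step[of i j] orth_step[of j i] ker[of i] ker[of j] ip_commute[of M "e i" "e j"] e_norm[of i]
    by (cases i j rule: linorder_cases) auto
  have eig: "graphon_op M K (e n) x = l n * e n x" if "x \<in> space M" for n x
    using op_Ks[OF e_bdd that, of n n] e_top[OF that, of n] by (simp add: orth)
  \<comment> \<open>Deflation can only lower the form: \<open>l (Suc n)\<close> is the value of the
    new form at the unit vector \<open>e (Suc n)\<close>, and the old form is at most
    \<open>l n\<close> there.\<close>
  have "l (Suc n) \<le> l n" for n
  proof (cases "l (Suc n) = 0")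
    case False
    then have pos: "l (Suc n) > 0" using l_nonneg[of "Suc n"] by simp
    let ?e = "e (Suc n)"
    have "l (Suc n) = ip M (graphon_op M (Ks (Suc n)) ?e) ?e"
    proof -
      have "ip M (graphon_op M (Ks (Suc n)) ?e) ?e = l (Suc n) * ip M ?e ?e"
        unfolding ip_scale_left[symmetric] by (intro ip_cong) (auto simp: e_top)
      then show ?thesis using pos by (simp add: orth)
    qed
    also have "\<dots> \<le> ip M (graphon_op M (Ks n) ?e) ?e"
      unfolding quad_Suc[OF e_bdd] using l_nonneg[of n] by simp
    also have "\<dots> \<le> l n" using l_top[OF e_bdd, of n "Suc n"] pos by (simp add: orth)
    finally show ?thesis .
  qed (simp add: l_nonneg)
  then have "decseq l" by (rule decseq_SucI)
  moreover have "ip M (graphon_op M K f) f \<le> l n * ip M f f + (\<Sum>i<n. l i * (ip M (e i) f)\<^sup>2)"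
    if "bdd_meas M f" for n f
    using l_top[OF that, of n] quad_Ks[OF that, of n] by simp
  ultimately have "spectral_system M K l e"
    unfolding spectral_system_def using l_nonneg e_bdd eig orth by blast
  then show ?thesis by blast
qed

text \<open>Pythagoras: the residual is orthogonal to every rank-one kernel that was subtracted, so
  its products with \<open>K\<close> and with itself agree. The second gives Bessel's inequality,
  the first will identify a weak limit. The condition \<open>\<mu> i \<noteq> 0\<close> in the
  orthogonality admits the null padding vectors.\<close>

lemma residual_kernel_norm:
  assumes K: "bdd_meas (M \<Otimes>\<^sub>M M) K" and I: "finite I" and v: "\<And>i. i \<in> I \<Longrightarrow> bdd_meas M (v i)"
    and eig: "\<And>i x. i \<in> I \<Longrightarrow> x \<in> space M \<Longrightarrow> graphon_op M K (v i) x = \<mu> i * v i x"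
    and orth: "\<And>i j. i \<in> I \<Longrightarrow> j \<in> I \<Longrightarrow> ip M (v i) (v j) = (if i = j \<and> \<mu> i \<noteq> 0 then 1 else 0)"
  shows "ip (M \<Otimes>\<^sub>M M) (residual_kernel K I \<mu> v) K = ip (M \<Otimes>\<^sub>M M) K K - (\<Sum>i\<in>I. (\<mu> i)\<^sup>2)"
    and "ip (M \<Otimes>\<^sub>M M) (residual_kernel K I \<mu> v) (residual_kernel K I \<mu> v) =
      ip (M \<Otimes>\<^sub>M M) K K - (\<Sum>i\<in>I. (\<mu> i)\<^sup>2)"
proof -
  interpret P: pair_prob_space M M ..
  let ?N = "M \<Otimes>\<^sub>M M" and ?R = "residual_kernel K I \<mu> v"
  let ?v = "\<lambda>i z. v i (fst z) * v i (snd z)"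
  note R = bdd_meas_residual_kernel[where I = I and \<mu> = \<mu> and v = v, OF K v]
  have bv: "bdd_meas ?N (?v i)" if "i \<in> I" for i by (intro bdd_meas_fst_snd v that)
  have Tv: "ip M (graphon_op M K (v i)) (v i) = \<mu> i" if "i \<in> I" for i
  proof -
    have "ip M (graphon_op M K (v i)) (v i) = \<mu> i * ip M (v i) (v i)"
      unfolding ip_scale_left[symmetric] using that by (intro ip_cong) (auto simp: eig)
    then show ?thesis by (simp add: orth that)
  qed
  have Kv: "ip ?N (?v i) K = \<mu> i" if "i \<in> I" for i
    using ip_op_eq[OF K v[OF that] v[OF that]] Tv[OF that] ip_commute[of ?N K] by simp
  have "ip ?N ?R K = ip ?N K K - (\<Sum>i\<in>I. \<mu> i * ip ?N (?v i) K)"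
    unfolding residual_kernel_def
    by (simp add: P.P.ip_diff_left P.P.ip_sum_left ip_scale_left bdd_meas_sum bdd_meas_mult[OF bdd_meas_const] bv K)
  also have "\<dots> = ip ?N K K - (\<Sum>i\<in>I. (\<mu> i)\<^sup>2)" by (simp add: Kv power2_eq_square)
  finally show RK: "ip ?N ?R K = ip ?N K K - (\<Sum>i\<in>I. (\<mu> i)\<^sup>2)" .
  have Rv: "ip ?N (?v k) ?R = 0" if k: "k \<in> I" for k
  proof -
    have "ip ?N (?v k) ?R = ip M (graphon_op M ?R (v k)) (v k)"
      using ip_op_eq[OF R v[OF k] v[OF k]] ip_commute[of ?N ?R] by simp
    also have "\<dots> = ip M (graphon_op M K (v k)) (v k) - (\<Sum>i\<in>I. \<mu> i * ip M (v i) (v k) * ip M (v i) (v k))"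
      by (rule ip_op_residual_kernel[OF K v v[OF k] v[OF k]])
    also have "(\<Sum>i\<in>I. \<mu> i * ip M (v i) (v k) * ip M (v i) (v k)) = (\<Sum>i\<in>I. if i = k then \<mu> k else 0)"
      using k by (intro sum.cong) (auto simp: orth)
    also have "ip M (graphon_op M K (v k)) (v k) = \<mu> k" by (rule Tv[OF k])
    finally show ?thesis using k I by simp
  qed
  have "ip ?N ?R ?R = ip ?N K ?R - (\<Sum>i\<in>I. \<mu> i * ip ?N (?v i) ?R)"
  proof -
    have "ip ?N ?R ?R = ip ?N (\<lambda>z. K z - (\<Sum>i\<in>I. \<mu> i * ?v i z)) ?R"
      by (intro ip_cong) (auto simp: residual_kernel_def)
    also have "\<dots> = ip ?N K ?R - (\<Sum>i\<in>I. \<mu> i * ip ?N (?v i) ?R)"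
      by (simp add: P.P.ip_diff_left P.P.ip_sum_left ip_scale_left bdd_meas_sum bdd_meas_mult[OF bdd_meas_const] bv K R)
    finally show ?thesis .
  qed
  also have "\<dots> = ip ?N K K - (\<Sum>i\<in>I. (\<mu> i)\<^sup>2)"
    using RK ip_commute[of ?N ?R K] by (simp add: Rv)
  finally show "ip ?N ?R ?R = ip ?N K K - (\<Sum>i\<in>I. (\<mu> i)\<^sup>2)" .
qed

text \<open>Bessel's inequality for the kernel makes the eigenvalues square summable.\<close>

lemma spectral_system_tendsto_0:
  assumes K: "sym_kernel M K" and sys: "spectral_system M K l e"
  shows "l \<longlonglongrightarrow> 0"
proof -
  have "(\<Sum>i<n. (l i)\<^sup>2) \<le> ip (M \<Otimes>\<^sub>M M) K K" for n
    using residual_kernel_norm(2)[of K "{..<n}" e l] sym_kernel_bdd[OF K] sys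
      ip_self_nonneg[of "M \<Otimes>\<^sub>M M" "residual_kernel K {..<n} l e"]
    unfolding spectral_system_def by (auto simp: less_le)
  then have "summable (\<lambda>i. (l i)\<^sup>2)" by (intro summableI_nonneg_bounded) auto
  then have "(\<lambda>i. sqrt ((l i)\<^sup>2)) \<longlonglongrightarrow> sqrt 0"
    by (intro tendsto_real_sqrt summable_LIMSEQ_zero)
  then show ?thesis using sys unfolding spectral_system_def by simp
qed

end

section \<open>Uniqueness of the eigenvalue lists\<close>


text \<open>Gaussian elimination; the index set is arbitrary because each pivot removes one unknown.
  It serves to compare dimensions of eigenspaces and to find the test vector of the min-max
  argument.\<close>

lemma homogeneous_system_nontrivial:
  fixes a :: "nat \<Rightarrow> 'j \<Rightarrow> real"
  assumes "finite J" "m < card J"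
  shows "\<exists>c. (\<exists>j\<in>J. c j \<noteq> 0) \<and> (\<forall>i<m. (\<Sum>j\<in>J. a i j * c j) = 0)"
  using assms
proof (induction m arbitrary: J a)
  case 0
  then show ?case by (intro exI[of _ "\<lambda>_. 1"]) (auto simp: card_gt_0_iff)
next
  case (Suc m)
  show ?case
  proof (cases "\<forall>j\<in>J. a m j = 0")
    case True
    obtain c where "\<exists>j\<in>J. c j \<noteq> 0" "\<forall>i<m. (\<Sum>j\<in>J. a i j * c j) = 0"
      using Suc.IH[of J a] Suc.prems by auto
    then show ?thesis using True by (intro exI[of _ c]) (auto simp: less_Suc_eq)
  next
    case False
    then obtain p where p: "p \<in> J" "a m p \<noteq> 0" by blast
    define J' where "J' = J - {p}"
    have J': "finite J'" "m < card J'" using Suc.prems p unfolding J'_def by auto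
    obtain c where c: "\<exists>j\<in>J'. c j \<noteq> 0"
      and sol: "\<And>i. i < m \<Longrightarrow> (\<Sum>j\<in>J'. (a i j - a i p * a m j / a m p) * c j) = 0"
      using Suc.IH[OF J', of "\<lambda>i j. a i j - a i p * a m j / a m p"] by blast
    \<comment> \<open>The value that equation \<open>m\<close> forces on the pivot unknown.\<close>
    define q where "q = - (\<Sum>j\<in>J'. a m j * c j) / a m p"
    define d where "d = c(p := q)"
    have sum_d: "(\<Sum>j\<in>J. a i j * d j) = a i p * q + (\<Sum>j\<in>J'. a i j * c j)" for i
    proof -
      have "(\<Sum>j\<in>J. a i j * d j) = a i p * d p + (\<Sum>j\<in>J'. a i j * d j)"
        unfolding J'_def by (rule sum.remove) (use Suc.prems p in auto)
      also have "(\<Sum>j\<in>J'. a i j * d j) = (\<Sum>j\<in>J'. a i j * c j)"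
        by (intro sum.cong) (auto simp: d_def J'_def)
      finally show ?thesis by (simp add: d_def)
    qed
    have "(\<Sum>j\<in>J. a i j * d j) = 0" if "i < Suc m" for i
    proof (cases "i = m")
      case True
      then show ?thesis unfolding sum_d q_def using p by simp
    next
      case False
      have "a i p * q = - (\<Sum>j\<in>J'. a i p * a m j / a m p * c j)"
        unfolding q_def by (simp add: sum_distrib_left sum_divide_distrib mult.assoc)
      then show ?thesis
        unfolding sum_d using sol[of i] that False by (simp add: left_diff_distrib sum_subtractf)
    qed
    moreover have "\<exists>j\<in>J. d j \<noteq> 0" using c unfolding d_def J'_def by auto
    ultimately show ?thesis by blast
  qed
qed

text \<open>At the first index where two lists differ, say \<open>k i < k' i\<close>, the value
  \<open>k' i\<close> occurs in \<open>k\<close> only before \<open>i\<close>, since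
  \<open>k\<close> decreases, and there the lists agree. But \<open>k'\<close> takes it at
  \<open>i\<close> as well, so the multiplicities differ.\<close>

lemma pos_eig_list_unique:
  assumes "pos_eig_list M K l" "pos_eig_list M K l'"
  shows "l = l'"
proof -
  have card_eq: "card {i. l i = t} = card {i. l' i = t}" "finite {i. l i = t}" "finite {i. l' i = t}"
    if "t > 0" for t
    using assms that unfolding pos_eig_list_def by (metis enat.inject)+
  have le: "\<not> k i < k' i"
    if dec: "decseq k" and nonneg: "\<And>i. 0 \<le> k i" and eq: "\<And>j. j < i \<Longrightarrow> k j = k' j"
      and card: "\<And>t. t > 0 \<Longrightarrow> card {i. k i = t} = card {i. k' i = t}"
      and fin: "\<And>t. t > 0 \<Longrightarrow> finite {i. k' i = t}" for k k' :: "nat \<Rightarrow> real" and i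
  proof
    assume less: "k i < k' i"
    have "{j. k j = k' i} \<subset> {j. k' j = k' i}"
    proof
      have "j < i" if "k j = k' i" for j
        using decseqD[OF dec, of i j] less that by (cases "j < i") auto
      then show "{j. k j = k' i} \<subseteq> {j. k' j = k' i}" using eq by force
      have "i \<in> {j. k' j = k' i}" "i \<notin> {j. k j = k' i}" using less by auto
      then show "{j. k j = k' i} \<noteq> {j. k' j = k' i}" by blast
    qed
    then have "card {j. k j = k' i} < card {j. k' j = k' i}"
      using fin[of "k' i"] less nonneg[of i] by (intro psubset_card_mono) auto
    then show False using card[of "k' i"] less nonneg[of i] by simp
  qed
  have "l i = l' i" for i
  proof (induction i rule: less_induct)
    case (less i)
    show ?case
      using le[of l i l'] le[of l' i l] less card_eq assms unfolding pos_eig_list_def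
      by (smt (verit))
  qed
  then show ?thesis by blast
qed

section \<open>Multiplicities of positive eigenvalues\<close>

context prob_space
begin

text \<open>Links square integrable eigenfunctions to the bounded calculus: the representative is Tf
  / t. On a probability space \<open>f\<close> is integrable, so Tf is bounded by C times its L^1
  norm, and as T does not see null sets the eigenequation holds at every point.\<close>

lemma eigenfunction_bounded_version:
  assumes K: "bdd_meas (M \<Otimes>\<^sub>M M) K" and t: "t \<noteq> 0" and f: "eigenfunction M K t f"
  shows "\<exists>g. bdd_meas M g \<and> (AE x in M. f x = g x) \<and> (\<forall>x\<in>space M. graphon_op M K g x = t * g x)"
proof -
  have [measurable]: "f \<in> borel_measurable M" "K \<in> borel_measurable (M \<Otimes>\<^sub>M M)"
    and sq: "integrable M (\<lambda>x. (f x)\<^sup>2)" and eig: "AE x in M. graphon_op M K f x = t * f x"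
    using f K unfolding eigenfunction_def L2_fun_def bdd_meas_def by auto
  have intf: "integrable M f"
  proof (rule Bochner_Integration.integrable_bound[of M "\<lambda>x. 1 + (f x)\<^sup>2"])
    show "AE x in M. norm (f x) \<le> norm (1 + (f x)\<^sup>2)"
    proof (rule AE_I2)
      fix x
      have "0 \<le> (\<bar>f x\<bar> - 1)\<^sup>2" by simp
      then have "2 * \<bar>f x\<bar> \<le> 1 + (f x)\<^sup>2" by (simp add: power2_diff)
      then show "norm (f x) \<le> norm (1 + (f x)\<^sup>2)" by simp
    qed
  qed (use sq in auto)
  obtain C where C: "C > 0" "\<And>z. z \<in> space (M \<Otimes>\<^sub>M M) \<Longrightarrow> \<bar>K z\<bar> \<le> C"
    using bdd_meas_bound[OF K] by metis
  let ?g = "\<lambda>x. graphon_op M K f x / t"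
  have "bdd_meas M (graphon_op M K f)"
  proof (rule bdd_measI)
    show "graphon_op M K f \<in> borel_measurable M" unfolding graphon_op_def by measurable
    fix x assume x: "x \<in> space M"
    have le: "\<bar>K (x, y) * f y\<bar> \<le> C * \<bar>f y\<bar>" if "y \<in> space M" for y
      using C x that by (auto simp: abs_mult space_pair_measure intro!: mult_right_mono)
    have [measurable]: "(\<lambda>y. K (x, y)) \<in> borel_measurable M" using x by measurable
    have int: "integrable M (\<lambda>y. K (x, y) * f y)"
      by (rule Bochner_Integration.integrable_bound[of M "\<lambda>y. C * \<bar>f y\<bar>"])
         (use intf le C in \<open>auto intro!: AE_I2\<close>)
    have "\<bar>graphon_op M K f x\<bar> \<le> (\<integral>y. \<bar>K (x, y) * f y\<bar> \<partial>M)"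
      unfolding graphon_op_def by (rule integral_abs_bound)
    also have "\<dots> \<le> (\<integral>y. C * \<bar>f y\<bar> \<partial>M)"
      using int intf le by (intro integral_mono) auto
    finally show "\<bar>graphon_op M K f x\<bar> \<le> (\<integral>y. C * \<bar>f y\<bar> \<partial>M)" .
  qed
  then have g: "bdd_meas M ?g" by (rule bdd_meas_divide)
  have fg: "AE x in M. f x = ?g x" using eig t by (auto elim!: eventually_mono)
  have "graphon_op M K ?g x = t * ?g x" if "x \<in> space M" for x
  proof -
    have "graphon_op M K f x = graphon_op M K ?g x"
      by (rule op_cong_AE) (use g fg that in \<open>auto simp: bdd_meas_def\<close>)
    then show ?thesis using t by simp
  qed
  then show ?thesis using g fg by blast
qed

text \<open>By symmetry \<open>F\<close> is orthogonal to the remaining \<open>e i\<close> as well.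
  The sum in the min-max bound then vanishes, leaving t |F|^2 \<le> l_n |F|^2 with l_n tending to
  0.\<close>

lemma eigenfunction_null_if_orthogonal:
  assumes K: "sym_kernel M K" and sys: "spectral_system M K l e" and t: "t > 0"
    and F: "bdd_meas M F" and eig: "\<And>x. x \<in> space M \<Longrightarrow> graphon_op M K F x = t * F x"
    and orth: "\<And>i. l i = t \<Longrightarrow> ip M (e i) F = 0"
  shows "AE x in M. F x = 0"
proof -
  have e_bdd: "\<And>i. bdd_meas M (e i)" and e_eig: "\<And>i x. x \<in> space M \<Longrightarrow> graphon_op M K (e i) x = l i * e i x"
    and quad: "\<And>n. ip M (graphon_op M K F) F \<le> l n * ip M F F + (\<Sum>i<n. l i * (ip M (e i) F)\<^sup>2)"
    using sys F unfolding spectral_system_def by auto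
  have TF: "ip M (graphon_op M K F) g = t * ip M F g" for g
    unfolding ip_scale_left[symmetric] by (intro ip_cong) (auto simp: eig)
  have orth_all: "ip M (e i) F = 0" for i
  proof (cases "l i = t")
    case False
    have "l i * ip M (e i) F = ip M (graphon_op M K (e i)) F"
      unfolding ip_scale_left[symmetric] by (intro ip_cong) (auto simp: e_eig)
    also have "\<dots> = t * ip M (e i) F"
      using ip_op_commute[OF K F e_bdd[of i]] ip_op_commute[OF K e_bdd[of i] F] TF[of "e i"]
      by (simp add: ip_commute)
    finally show ?thesis using False by simp
  qed (rule orth)
  have "t * ip M F F \<le> 0 * ip M F F"
  proof (rule LIMSEQ_le_const)
    show "(\<lambda>n. l n * ip M F F) \<longlonglongrightarrow> 0 * ip M F F"
      by (intro tendsto_intros spectral_system_tendsto_0[OF K sys])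
    show "\<exists>N. \<forall>n\<ge>N. t * ip M F F \<le> l n * ip M F F" using quad by (auto simp: TF orth_all)
  qed
  then have "ip M F F = 0" using t ip_self_nonneg[of M F] by (simp add: mult_le_0_iff)
  then show ?thesis by (rule ip_self_eq_0_imp_AE[OF F])
qed

text \<open>Deflation misses no multiplicity. The \<open>e i\<close> with \<open>l i = t\<close> are
  orthonormal, hence independent. Among more eigenfunctions than these, a system with fewer
  equations than unknowns yields a nontrivial combination orthogonal to all of them, and that
  combination is null.\<close>

lemma eig_mult_spectral_system:
  assumes K: "sym_kernel M K" and sys: "spectral_system M K l e" and t: "t > 0"
  shows "finite {i. l i = t}" "eig_mult M K t = enat (card {i. l i = t})"
proof -
  have e_bdd: "\<And>i. bdd_meas M (e i)" and e_eig: "\<And>i x. x \<in> space M \<Longrightarrow> graphon_op M K (e i) x = l i * e i x"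
    and e_orth: "\<And>i j. ip M (e i) (e j) = (if i = j \<and> l i > 0 then 1 else 0)"
    using sys unfolding spectral_system_def by auto
  obtain N where N: "\<And>n. n \<ge> N \<Longrightarrow> \<bar>l n\<bar> < t"
    using LIMSEQ_D[OF spectral_system_tendsto_0[OF K sys] t] by auto
  have "{i. l i = t} \<subseteq> {..<N}"
  proof
    fix i assume "i \<in> {i. l i = t}"
    then show "i \<in> {..<N}" using N[of i] t by (cases "i < N") auto
  qed
  then show fin: "finite {i. l i = t}" by (rule finite_subset) simp
  let ?m = "card {i. l i = t}"
  obtain h where h: "bij_betw h {..<?m} {i. l i = t}"
    using ex_bij_betw_nat_finite[OF fin] atLeast0LessThan by metis
  have lh: "l (h i) = t" if "i < ?m" for i using bij_betwE[OF h] that by auto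
  have "\<forall>i<?m. eigenfunction M K t (e (h i))"
    using e_bdd e_eig lh bdd_meas_integrable[OF bdd_meas_power2[OF e_bdd]]
    unfolding eigenfunction_def L2_fun_def bdd_meas_def by auto
  moreover have "independent_mod_null M ?m (\<lambda>i. e (h i))"
    unfolding independent_mod_null_def
  proof (intro allI impI)
    fix c :: "nat \<Rightarrow> real" and k
    assume zero: "AE x in M. (\<Sum>i<?m. c i * e (h i) x) = 0" and k: "k < ?m"
    have "ip M (\<lambda>x. \<Sum>i<?m. c i * e (h i) x) (e (h k)) = 0"
      unfolding ip_def using zero by (intro integral_eq_zero_AE) (auto elim!: eventually_mono)
    moreover have "ip M (\<lambda>x. \<Sum>i<?m. c i * e (h i) x) (e (h k)) = (\<Sum>i<?m. c i * ip M (e (h i)) (e (h k)))"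
      by (simp add: ip_sum_left ip_scale_left bdd_meas_intros e_bdd)
    moreover have "(\<Sum>i<?m. c i * ip M (e (h i)) (e (h k))) = (\<Sum>i<?m. if i = k then c k else 0)"
      using k lh t h by (intro sum.cong) (auto simp: e_orth bij_betw_def inj_on_def)
    ultimately show "c k = 0" using k by simp
  qed
  ultimately have "\<exists>f. (\<forall>i<?m. eigenfunction M K t (f i)) \<and> independent_mod_null M ?m f"
    by (intro exI[of _ "\<lambda>i. e (h i)"] conjI)
  then have lower: "enat ?m \<le> eig_mult M K t"
    unfolding eig_mult_def by (intro Sup_upper CollectI exI[of _ ?m] conjI refl)
  have "n \<le> ?m" if f: "\<forall>i<n. eigenfunction M K t (f i)" and ind: "independent_mod_null M n f" for n f
  proof (rule ccontr)
    assume "\<not> n \<le> ?m"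
    have "\<forall>i. \<exists>g. i < n \<longrightarrow> bdd_meas M g \<and> (AE x in M. f i x = g x) \<and> (\<forall>x\<in>space M. graphon_op M K g x = t * g x)"
      using eigenfunction_bounded_version[OF sym_kernel_bdd[OF K]] f t by (metis less_irrefl)
    then obtain g where g: "\<And>i. i < n \<Longrightarrow> bdd_meas M (g i)" "\<And>i. i < n \<Longrightarrow> AE x in M. f i x = g i x"
      "\<And>i x. i < n \<Longrightarrow> x \<in> space M \<Longrightarrow> graphon_op M K (g i) x = t * g i x" by metis
    obtain c where c: "\<exists>j<n. c j \<noteq> 0" and sol: "\<And>i. i < ?m \<Longrightarrow> (\<Sum>j<n. ip M (e (h i)) (g j) * c j) = 0"
      using homogeneous_system_nontrivial[of "{..<n}" ?m "\<lambda>i j. ip M (e (h i)) (g j)"] \<open>\<not> n \<le> ?m\<close> by auto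
    let ?F = "\<lambda>x. \<Sum>j<n. c j * g j x"
    have "AE x in M. ?F x = 0"
    proof (rule eigenfunction_null_if_orthogonal[OF K sys t])
      show "bdd_meas M ?F" by (intro bdd_meas_intros g) simp
      show "graphon_op M K ?F x = t * ?F x" if "x \<in> space M" for x
        using op_sum[OF sym_kernel_bdd[OF K], of "{..<n}" g x c] g that
        by (simp add: sum_distrib_left mult.left_commute)
      show "ip M (e i) ?F = 0" if "l i = t" for i
      proof -
        have "i \<in> h ` {..<?m}" using bij_betw_imp_surj_on[OF h] \<open>l i = t\<close> by simp
        then obtain i' where "i' < ?m" "h i' = i" by blast
        have "ip M (e i) ?F = (\<Sum>j<n. ip M (e i) (\<lambda>x. c j * g j x))"
          by (intro ip_sum_right bdd_meas_intros g e_bdd) simp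
        then show ?thesis using sol[OF \<open>i' < ?m\<close>] \<open>h i' = i\<close> by (simp add: ip_scale_right mult.commute)
      qed
    qed
    moreover have "AE x in M. \<forall>j<n. f j x = g j x"
      using g(2) by (subst AE_all_countable) auto
    ultimately have "AE x in M. (\<Sum>j<n. c j * f j x) = 0" by eventually_elim simp
    then show False using ind c unfolding independent_mod_null_def by blast
  qed
  then have "eig_mult M K t \<le> enat ?m" unfolding eig_mult_def by (intro Sup_least) auto
  then show "eig_mult M K t = enat ?m" using lower by simp
qed

lemma pos_eig_spectral_system:
  assumes K: "sym_kernel M K" and sys: "spectral_system M K l e"
  shows "pos_eig M K = l"
proof -
  have "pos_eig_list M K l"
    using sys eig_mult_spectral_system[OF K sys] unfolding pos_eig_list_def spectral_system_def by auto
  then show ?thesis unfolding pos_eig_def by (intro the_equality) (auto intro: pos_eig_list_unique)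
qed

end

section \<open>Negative eigenvalues by change of sign\<close>

lemma neg_eig_list_iff: "neg_eig_list M K l \<longleftrightarrow> pos_eig_list M (\<lambda>z. - K z) (\<lambda>i. - l i)"
proof -
  have op: "graphon_op M (\<lambda>z. - K z) f x = - graphon_op M K f x" for f x
    unfolding graphon_op_def by simp
  have eig: "eigenfunction M (\<lambda>z. - K z) (- t) f \<longleftrightarrow> eigenfunction M K t f" for t f
    unfolding eigenfunction_def op by simp
  have "eig_mult M (\<lambda>z. - K z) (- t) = eig_mult M K t" for t
    unfolding eig_mult_def eig ..
  then have mult: "eig_mult M (\<lambda>z. - K z) t = eig_mult M K (- t)" for t
    by (metis minus_minus)
  have "(\<forall>t<0. finite {i. l i = t} \<and> enat (card {i. l i = t}) = eig_mult M K t) \<longleftrightarrow>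
      (\<forall>t>0. finite {i. l i = - t} \<and> enat (card {i. l i = - t}) = eig_mult M K (- t))"
    by (metis minus_minus neg_0_less_iff_less neg_less_0_iff_less)
  moreover have "- l i = t \<longleftrightarrow> l i = - t" for i t by auto
  ultimately show ?thesis
    unfolding neg_eig_list_def pos_eig_list_def mult by (simp add: monotone_def)
qed

text \<open>Both sides are definite descriptions; existence of one list, with uniqueness, pins down
  both.\<close>

lemma neg_eig_eq_pos_eig:
  assumes ex: "\<exists>l. pos_eig_list M (\<lambda>z. - K z) l"
  shows "neg_eig M K = (\<lambda>i. - pos_eig M (\<lambda>z. - K z) i)"
proof -
  obtain l where l: "pos_eig_list M (\<lambda>z. - K z) l" using ex by blast
  have pos: "pos_eig M (\<lambda>z. - K z) = l"
    unfolding pos_eig_def using l by (intro the_equality) (auto intro: pos_eig_list_unique)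
  show ?thesis
    unfolding neg_eig_def pos
  proof (rule the_equality)
    show "neg_eig_list M K (\<lambda>i. - l i)" using l unfolding neg_eig_list_iff by simp
    fix k assume "neg_eig_list M K k"
    then have "(\<lambda>i. - k i) = l" unfolding neg_eig_list_iff by (rule pos_eig_list_unique[OF _ l])
    then show "k = (\<lambda>i. - l i)" by auto
  qed
qed

section \<open>Convergence tested on rectangles\<close>


context finite_measure
begin

text \<open>The uniform norm bound makes the admissible test functions an L^2-closed set: an error
  in \<open>G\<close> costs at most its norm times \<open>sqrt R\<close>, whatever \<open>n\<close>
  is.\<close>

lemma ip_tendsto_0_closure:
  assumes F: "\<And>n. bdd_meas M (F n)" and R: "\<And>n. ip M (F n) (F n) \<le> R"
    and G: "bdd_meas M G" and G': "\<And>k::nat. bdd_meas M (G' k)"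
    and lim: "\<And>k. (\<lambda>n::nat. ip M (F n) (G' k)) \<longlonglongrightarrow> 0"
    and approx: "(\<lambda>k. ip M (\<lambda>x. G x - G' k x) (\<lambda>x. G x - G' k x)) \<longlonglongrightarrow> 0"
  shows "(\<lambda>n. ip M (F n) G) \<longlonglongrightarrow> 0"
proof (rule LIMSEQ_I)
  fix \<epsilon> :: real assume \<epsilon>: "\<epsilon> > 0"
  define a where "a k = sqrt R * sqrt (ip M (\<lambda>x. G x - G' k x) (\<lambda>x. G x - G' k x))" for k
  have "a \<longlonglongrightarrow> sqrt R * sqrt 0" unfolding a_def by (intro tendsto_intros approx)
  then have "a \<longlonglongrightarrow> 0" by simp
  then obtain k where k: "\<bar>a k\<bar> < \<epsilon> / 2" using LIMSEQ_D[of a 0 "\<epsilon> / 2"] \<epsilon> by auto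
  obtain N where N: "\<And>n. n \<ge> N \<Longrightarrow> \<bar>ip M (F n) (G' k)\<bar> < \<epsilon> / 2"
    using LIMSEQ_D[OF lim[of k], of "\<epsilon> / 2"] \<epsilon> by auto
  have "norm (ip M (F n) G - 0) < \<epsilon>" if "n \<ge> N" for n
  proof -
    have "\<bar>ip M (F n) (\<lambda>x. G x - G' k x)\<bar> \<le> a k"
      unfolding a_def
      by (intro order_trans[OF ip_abs_le] mult_right_mono F bdd_meas_diff G G') (auto simp: ip_self_nonneg R)
    moreover have "ip M (F n) (\<lambda>x. G x - G' k x) = ip M (F n) G - ip M (F n) (G' k)"
      by (intro ip_diff_right F G G')
    ultimately show ?thesis using N[OF that] k by simp
  qed
  then show "\<exists>N. \<forall>n\<ge>N. norm (ip M (F n) G - 0) < \<epsilon>" by blast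
qed

lemma ip_dist_tendsto_0_dominated:
  assumes G: "bdd_meas M G" and G': "\<And>k::nat. bdd_meas M (G' k)"
    and le: "\<And>k x. x \<in> space M \<Longrightarrow> \<bar>G x - G' k x\<bar> \<le> D"
    and lim: "\<And>x. x \<in> space M \<Longrightarrow> (\<lambda>k. G' k x) \<longlonglongrightarrow> G x"
  shows "(\<lambda>k. ip M (\<lambda>x. G x - G' k x) (\<lambda>x. G x - G' k x)) \<longlonglongrightarrow> 0"
proof -
  have [measurable]: "G \<in> borel_measurable M" "G' k \<in> borel_measurable M" for k
    using G G' by (auto simp: bdd_meas_def)
  have "(\<lambda>k. ip M (\<lambda>x. G x - G' k x) (\<lambda>x. G x - G' k x)) \<longlonglongrightarrow> (\<integral>x. (G x - G x) * (G x - G x) \<partial>M)"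
    unfolding ip_def
  proof (rule integral_dominated_convergence[where w = "\<lambda>_. D * D"])
    show "AE x in M. (\<lambda>k. (G x - G' k x) * (G x - G' k x)) \<longlonglongrightarrow> (G x - G x) * (G x - G x)"
      by (intro AE_I2 tendsto_intros lim)
    show "AE x in M. norm ((G x - G' k x) * (G x - G' k x)) \<le> D * D" for k
    proof (rule AE_I2)
      fix x assume x: "x \<in> space M"
      have "\<bar>G x - G' k x\<bar> * \<bar>G x - G' k x\<bar> \<le> D * D"
        using le[OF x, of k] by (intro mult_mono) auto
      then show "norm ((G x - G' k x) * (G x - G' k x)) \<le> D * D" by simp
    qed
  qed auto
  then show ?thesis by simp
qed

lemma ip_tendsto_0_from_sets:
  assumes F: "\<And>n. bdd_meas M (F n)" and R: "\<And>n. ip M (F n) (F n) \<le> R"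
    and sets: "\<And>A. A \<in> sets M \<Longrightarrow> (\<lambda>n::nat. ip M (F n) (indicator A)) \<longlonglongrightarrow> 0"
    and G: "bdd_meas M G"
  shows "(\<lambda>n. ip M (F n) G) \<longlonglongrightarrow> 0"
proof -
  \<comment> \<open>The induction runs through arbitrary nonnegative measurable functions, so
    boundedness is a premise inside the claim. It passes to summands and approximants because these
    are nonnegative.\<close>
  have nonneg: "bdd_meas M G \<longrightarrow> (\<lambda>n. ip M (F n) G) \<longlonglongrightarrow> 0"
    if "G \<in> borel_measurable M" "\<And>x. 0 \<le> G x" for G
    using that
  proof (induction G rule: borel_measurable_induct_real)
    case (set A)
    then show ?case using sets by simp
  next
    case (mult u c)
    show ?case
    proof
      assume b: "bdd_meas M (\<lambda>x. c * u x)"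
      show "(\<lambda>n. ip M (F n) (\<lambda>x. c * u x)) \<longlonglongrightarrow> 0"
      proof (cases "c = 0")
        case False
        then have "bdd_meas M u" using bdd_meas_divide[OF b, of c] by simp
        then show ?thesis using mult tendsto_mult_right_zero by (auto simp: ip_scale_right)
      qed (simp add: ip_def)
    qed
  next
    case (add u v)
    show ?case
    proof
      assume b: "bdd_meas M (\<lambda>x. v x + u x)"
      obtain C where C: "\<And>x. x \<in> space M \<Longrightarrow> \<bar>v x + u x\<bar> \<le> C" using bdd_meas_bound[OF b] by metis
      have bu: "bdd_meas M u" and bv: "bdd_meas M v"
        using C add by (auto intro!: bdd_measI[of _ _ C] simp: abs_le_iff) (smt (verit))+
      then show "(\<lambda>n. ip M (F n) (\<lambda>x. v x + u x)) \<longlonglongrightarrow> 0"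
        using add tendsto_add_zero by (simp add: ip_add_right F)
    qed
  next
    case (seq U)
    show ?case
    proof
      assume b: "bdd_meas M G"
      obtain C where C: "\<And>x. x \<in> space M \<Longrightarrow> \<bar>G x\<bar> \<le> C" using bdd_meas_bound[OF b] by metis
      have le: "0 \<le> U k x" "U k x \<le> G x" "G x \<le> C" if "x \<in> space M" for k x
      proof -
        have "incseq U" using seq by blast
        then have "incseq (\<lambda>k. U k x)" by (auto simp: incseq_def le_fun_def)
        then show "U k x \<le> G x" by (rule incseq_le) (use seq that in blast)
        show "0 \<le> U k x" using seq by blast
        show "G x \<le> C" using C[OF that] by simp
      qed
      then have bU: "bdd_meas M (U k)" for k
        using seq(1) order_trans[OF le(2,3)] by (intro bdd_measI[of _ _ C]) auto
      show "(\<lambda>n. ip M (F n) G) \<longlonglongrightarrow> 0"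
      proof (rule ip_tendsto_0_closure[OF F R b bU])
        show "(\<lambda>n. ip M (F n) (U k)) \<longlonglongrightarrow> 0" for k using seq bU by blast
        show "(\<lambda>k. ip M (\<lambda>x. G x - U k x) (\<lambda>x. G x - U k x)) \<longlonglongrightarrow> 0"
        proof (rule ip_dist_tendsto_0_dominated[OF b bU])
          show "\<bar>G x - U k x\<bar> \<le> C" if "x \<in> space M" for x k using le(1,2)[OF that, of k] le(3)[OF that] by simp
        qed (use seq in blast)
      qed
    qed
  qed
  obtain C where C: "C > 0" "\<And>x. x \<in> space M \<Longrightarrow> \<bar>G x\<bar> \<le> C" using bdd_meas_bound[OF G] by metis
  \<comment> \<open>The shift makes \<open>G\<close> nonnegative on \<open>space M\<close>; the
    maximum changes nothing there but secures nonnegativity outside, where \<open>G\<close> has no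
    bound.\<close>
  let ?G = "\<lambda>x. max 0 (G x + C)"
  have [measurable]: "G \<in> borel_measurable M" using G by (simp add: bdd_meas_def)
  have bG: "bdd_meas M ?G"
  proof (rule bdd_measI)
    show "\<bar>?G x\<bar> \<le> 2 * C" if "x \<in> space M" for x using C(2)[OF that] C(1) by auto
  qed measurable
  have "(\<lambda>n. ip M (F n) ?G - C * ip M (F n) (indicator (space M))) \<longlonglongrightarrow> 0 - C * 0"
    using nonneg[of ?G] bG by (intro tendsto_intros sets) (auto simp: bdd_meas_def)
  moreover have "ip M (F n) ?G - C * ip M (F n) (indicator (space M)) = ip M (F n) G" for n
  proof -
    have "ip M (F n) ?G - C * ip M (F n) (indicator (space M)) = ip M (F n) (\<lambda>x. ?G x - C * indicator (space M) x)"
      by (simp add: ip_diff_right ip_scale_right F bG bdd_meas_mult bdd_meas_const bdd_meas_indicator)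
    also have "\<dots> = ip M (F n) G"
      using C(2) by (intro ip_cong) (auto simp: abs_le_iff max_def, smt (verit))
    finally show ?thesis .
  qed
  ultimately show ?thesis by simp
qed

end

context prob_space
begin

text \<open>Rectangles are stable under intersection, so Dynkin's theorem reaches all measurable
  sets. Countable disjoint unions use the norm bound: the indicators of finite partial unions
  converge in L^2.\<close>

lemma ip_tendsto_0_from_rectangles:
  assumes F: "\<And>n. bdd_meas (M \<Otimes>\<^sub>M M) (F n)" and R: "\<And>n. ip (M \<Otimes>\<^sub>M M) (F n) (F n) \<le> R"
    and rect: "\<And>A B. A \<in> sets M \<Longrightarrow> B \<in> sets M \<Longrightarrow>
      (\<lambda>n::nat. ip (M \<Otimes>\<^sub>M M) (F n) (indicator (A \<times> B))) \<longlonglongrightarrow> 0"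
    and G: "bdd_meas (M \<Otimes>\<^sub>M M) G"
  shows "(\<lambda>n. ip (M \<Otimes>\<^sub>M M) (F n) G) \<longlonglongrightarrow> 0"
proof -
  interpret P: pair_prob_space M M ..
  let ?N = "M \<Otimes>\<^sub>M M" and ?E = "{a \<times> b |a b. a \<in> sets M \<and> b \<in> sets M}"
  have "(\<lambda>n. ip ?N (F n) (indicator Z)) \<longlonglongrightarrow> 0" if "Z \<in> sets ?N" for Z
  proof -
    have Z: "Z \<in> sigma_sets (space M \<times> space M) ?E" using that by (simp add: sets_pair_measure)
    have E: "Int_stable ?E" "?E \<subseteq> Pow (space M \<times> space M)"
      by (rule Int_stable_pair_measure_generator, rule pair_measure_closed)
    have setsN: "sigma_sets (space M \<times> space M) ?E = sets ?N" by (simp add: sets_pair_measure)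
    have sp: "space M \<times> space M \<in> sets ?N" by auto
    show ?thesis
      using E Z
    proof (induction rule: sigma_sets_induct_disjoint)
      case (basic A)
      then show ?case using rect by blast
    next
      case empty
      show ?case by (simp add: ip_def)
    next
      case (compl A)
      then have A: "A \<in> sets ?N" by (simp add: setsN)
      have "(\<lambda>n. ip ?N (F n) (indicator (space M \<times> space M)) - ip ?N (F n) (indicator A)) \<longlonglongrightarrow> 0 - 0"
        by (intro tendsto_intros rect compl) auto
      moreover have "ip ?N (F n) (indicator (space M \<times> space M)) - ip ?N (F n) (indicator A) =
          ip ?N (F n) (indicator (space M \<times> space M - A))" for n
      proof -
        have "ip ?N (F n) (indicator (space M \<times> space M)) - ip ?N (F n) (indicator A) =
            ip ?N (F n) (\<lambda>z. indicator (space M \<times> space M) z - indicator A z)"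
          by (rule P.P.ip_diff_right[symmetric]) (intro F bdd_meas_indicator A sp)+
        also have "\<dots> = ip ?N (F n) (indicator (space M \<times> space M - A))"
          using sets.sets_into_space[OF A]
          by (intro ip_cong) (auto simp: indicator_def space_pair_measure)
        finally show ?thesis .
      qed
      ultimately show ?case by simp
    next
      case (union A)
      then have A: "A i \<in> sets ?N" for i by (auto simp: setsN)
      have b: "bdd_meas ?N (indicator (\<Union>i<k. A i))" for k :: nat
        by (intro bdd_meas_indicator sets.countable_UN'' A) auto
      have b': "bdd_meas ?N (indicator (\<Union>i. A i))"
        by (intro bdd_meas_indicator sets.countable_UN'' A) auto
      show ?case
      proof (rule P.P.ip_tendsto_0_closure[OF F R b' b])
        fix k :: nat
        have "ip ?N (F n) (indicator (\<Union>i<k. A i)) = (\<Sum>i<k. ip ?N (F n) (indicator (A i)))" for n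
        proof -
          have "ip ?N (F n) (indicator (\<Union>i<k. A i)) = ip ?N (F n) (\<lambda>z. \<Sum>i<k. indicator (A i) z)"
            using union(1) by (intro ip_cong indicator_UN_disjoint) (auto simp: disjoint_family_on_def)
          also have "\<dots> = (\<Sum>i<k. ip ?N (F n) (indicator (A i)))"
            by (intro P.P.ip_sum_right F bdd_meas_indicator A)
          finally show ?thesis .
        qed
        moreover have "(\<lambda>n. \<Sum>i<k. ip ?N (F n) (indicator (A i))) \<longlonglongrightarrow> (\<Sum>i<k. 0)"
          by (intro tendsto_intros union(3))
        ultimately show "(\<lambda>n. ip ?N (F n) (indicator (\<Union>i<k. A i))) \<longlonglongrightarrow> 0" by simp
      next
        show "(\<lambda>k. ip ?N (\<lambda>z. indicator (\<Union>i. A i) z - indicator (\<Union>i<k. A i) z)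
            (\<lambda>z. indicator (\<Union>i. A i) z - indicator (\<Union>i<k. A i) z)) \<longlonglongrightarrow> 0"
        proof (rule P.P.ip_dist_tendsto_0_dominated[OF b' b])
          show "\<bar>indicator (\<Union>i. A i) z - indicator (\<Union>i<k. A i) z\<bar> \<le> (1::real)" for z k
            by (auto simp: indicator_def)
          show "(\<lambda>k. indicator (\<Union>i<k. A i) z) \<longlonglongrightarrow> (indicator (\<Union>i. A i) z :: real)" for z
            by (rule LIMSEQ_indicator_UN)
        qed
      qed
    qed
  qed
  then show ?thesis by (intro P.P.ip_tendsto_0_from_sets[OF F R _ G])
qed

end

section \<open>Measure preserving bijections and weak limits\<close>


lemma mp_bijection_measurable: "mp_bijection M \<phi> \<Longrightarrow> \<phi> \<in> measurable M M"
  unfolding mp_bijection_def by simp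

lemma mp_bijection_distr: "mp_bijection M \<phi> \<Longrightarrow> distr M M \<phi> = M"
  unfolding mp_bijection_def by (intro measure_eqI) (auto simp: emeasure_distr)

lemma mp_bijectionI:
  assumes \<phi>: "\<phi> \<in> measurable M M" and \<sigma>: "\<sigma> \<in> measurable M M"
    and inv: "\<And>x. x \<in> space M \<Longrightarrow> \<sigma> (\<phi> x) = x" "\<And>x. x \<in> space M \<Longrightarrow> \<phi> (\<sigma> x) = x"
    and pres: "\<And>A. A \<in> sets M \<Longrightarrow> emeasure M (\<phi> -` A \<inter> space M) = emeasure M A"
  shows "mp_bijection M \<phi>"
proof -
  note sp = measurable_space[OF \<phi>] measurable_space[OF \<sigma>]
  have bij: "bij_betw \<phi> (space M) (space M)"
    by (rule bij_betwI[of _ _ _ \<sigma>]) (use inv sp in auto)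
  have "the_inv_into (space M) \<phi> x = \<sigma> x" if "x \<in> space M" for x
    using that inv sp bij by (intro the_inv_into_f_eq) (auto simp: bij_betw_def)
  then have "the_inv_into (space M) \<phi> \<in> measurable M M"
    using \<sigma> by (simp cong: measurable_cong)
  then show ?thesis unfolding mp_bijection_def using bij \<phi> pres by blast
qed

lemma mp_bijection_id: "mp_bijection M (\<lambda>x. x)"
  by (rule mp_bijectionI[of _ _ "\<lambda>x. x"]) (auto intro!: arg_cong[where f = "emeasure M"] dest: sets.sets_into_space)

lemma mp_bijection_inverse:
  assumes \<phi>: "mp_bijection M \<phi>"
  shows "\<exists>\<sigma>. mp_bijection M \<sigma> \<and> (\<forall>x\<in>space M. \<sigma> (\<phi> x) = x \<and> \<phi> (\<sigma> x) = x)"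
proof -
  let ?s = "the_inv_into (space M) \<phi>"
  have bij: "bij_betw \<phi> (space M) (space M)" and m: "\<phi> \<in> measurable M M" "?s \<in> measurable M M"
    and pres: "\<And>A. A \<in> sets M \<Longrightarrow> emeasure M (\<phi> -` A \<inter> space M) = emeasure M A"
    using \<phi> unfolding mp_bijection_def by auto
  have inv: "?s (\<phi> x) = x" "\<phi> (?s x) = x" if "x \<in> space M" for x
    using that bij by (auto simp: bij_betw_def the_inv_into_f_f f_the_inv_into_f)
  have "emeasure M (?s -` A \<inter> space M) = emeasure M A" if A: "A \<in> sets M" for A
  proof -
    have "emeasure M (?s -` A \<inter> space M) = emeasure M (\<phi> -` (?s -` A \<inter> space M) \<inter> space M)"
      by (rule pres[symmetric]) (rule measurable_sets[OF m(2) A])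
    also have "\<phi> -` (?s -` A \<inter> space M) \<inter> space M = A"
      using inv measurable_space[OF m(1)] sets.sets_into_space[OF A] by auto
    finally show ?thesis .
  qed
  then have "mp_bijection M ?s" using m inv by (intro mp_bijectionI[of _ _ \<phi>]) auto
  then show ?thesis using inv by blast
qed

lemma mp_bijection_comp:
  assumes \<phi>: "mp_bijection M \<phi>" and \<psi>: "mp_bijection M \<psi>"
  shows "mp_bijection M (\<lambda>x. \<phi> (\<psi> x))"
proof -
  obtain \<sigma> where \<sigma>: "mp_bijection M \<sigma>" "\<And>x. x \<in> space M \<Longrightarrow> \<sigma> (\<phi> x) = x" "\<And>x. x \<in> space M \<Longrightarrow> \<phi> (\<sigma> x) = x"
    using mp_bijection_inverse[OF \<phi>] by blast
  obtain \<tau> where \<tau>: "mp_bijection M \<tau>" "\<And>x. x \<in> space M \<Longrightarrow> \<tau> (\<psi> x) = x" "\<And>x. x \<in> space M \<Longrightarrow> \<psi> (\<tau> x) = x"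
    using mp_bijection_inverse[OF \<psi>] by blast
  note meas = \<phi>[THEN mp_bijection_measurable] \<psi>[THEN mp_bijection_measurable]
    \<sigma>(1)[THEN mp_bijection_measurable] \<tau>(1)[THEN mp_bijection_measurable]
  note sp = meas[THEN measurable_space]
  have pres: "emeasure M (\<phi> -` A \<inter> space M) = emeasure M A" "emeasure M (\<psi> -` A \<inter> space M) = emeasure M A"
    if "A \<in> sets M" for A using \<phi> \<psi> that unfolding mp_bijection_def by auto
  show ?thesis
  proof (rule mp_bijectionI[of _ _ "\<lambda>x. \<tau> (\<sigma> x)"])
    show "(\<lambda>x. \<phi> (\<psi> x)) \<in> measurable M M" "(\<lambda>x. \<tau> (\<sigma> x)) \<in> measurable M M"
      using meas by (auto intro: measurable_compose)
    show "\<tau> (\<sigma> (\<phi> (\<psi> x))) = x" "\<phi> (\<psi> (\<tau> (\<sigma> x))) = x" if "x \<in> space M" for x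
      using that sp \<sigma> \<tau> by auto
    fix A assume A: "A \<in> sets M"
    have "(\<lambda>x. \<phi> (\<psi> x)) -` A \<inter> space M = \<psi> -` (\<phi> -` A \<inter> space M) \<inter> space M" using sp by auto
    then show "emeasure M ((\<lambda>x. \<phi> (\<psi> x)) -` A \<inter> space M) = emeasure M A"
      by (simp only: pres(1)[OF A] pres(2)[OF measurable_sets[OF meas(1) A]])
  qed
qed

lemma ip_mp_bijection:
  assumes \<phi>: "mp_bijection M \<phi>" and [measurable]: "f \<in> borel_measurable M" "g \<in> borel_measurable M"
  shows "ip M (\<lambda>x. f (\<phi> x)) (\<lambda>x. g (\<phi> x)) = ip M f g"
proof -
  have "(\<integral>x. f x * g x \<partial>distr M M \<phi>) = (\<integral>x. f (\<phi> x) * g (\<phi> x) \<partial>M)"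
    by (rule integral_distr) (use mp_bijection_measurable[OF \<phi>] in measurable)
  then show ?thesis unfolding ip_def mp_bijection_distr[OF \<phi>] by simp
qed

section \<open>Versions of kernels and their spectra\<close>

context prob_space
begin

lemma measurable_pair_mp_bijection:
  assumes \<phi>: "mp_bijection M \<phi>"
  shows "(\<lambda>(x, y). (\<phi> x, \<phi> y)) \<in> measurable (M \<Otimes>\<^sub>M M) (M \<Otimes>\<^sub>M M)"
  using mp_bijection_measurable[OF \<phi>] by measurable

lemma version_eq: "version F \<phi> = (\<lambda>z. F (case z of (x, y) \<Rightarrow> (\<phi> x, \<phi> y)))"
  unfolding version_def by auto

lemma ip_version:
  assumes \<phi>: "mp_bijection M \<phi>"
    and [measurable]: "F \<in> borel_measurable (M \<Otimes>\<^sub>M M)" "G \<in> borel_measurable (M \<Otimes>\<^sub>M M)"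
  shows "ip (M \<Otimes>\<^sub>M M) (version F \<phi>) (version G \<phi>) = ip (M \<Otimes>\<^sub>M M) F G"
proof -
  have "distr (M \<Otimes>\<^sub>M M) (M \<Otimes>\<^sub>M M) (\<lambda>(x, y). (\<phi> x, \<phi> y)) = distr M M \<phi> \<Otimes>\<^sub>M distr M M \<phi>"
    using mp_bijection_measurable[OF \<phi>]
    by (intro pair_measure_distr[symmetric]) (simp_all add: mp_bijection_distr[OF \<phi>] sigma_finite_measure_axioms)
  then have d: "distr (M \<Otimes>\<^sub>M M) (M \<Otimes>\<^sub>M M) (\<lambda>(x, y). (\<phi> x, \<phi> y)) = M \<Otimes>\<^sub>M M"
    by (simp add: mp_bijection_distr[OF \<phi>])
  have "(\<integral>z. F z * G z \<partial>distr (M \<Otimes>\<^sub>M M) (M \<Otimes>\<^sub>M M) (\<lambda>(x, y). (\<phi> x, \<phi> y))) =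
      (\<integral>z. version F \<phi> z * version G \<phi> z \<partial>(M \<Otimes>\<^sub>M M))"
    unfolding version_eq by (rule integral_distr[OF measurable_pair_mp_bijection[OF \<phi>]]) measurable
  then show ?thesis unfolding ip_def d by simp
qed

lemma bdd_meas_version:
  "bdd_meas (M \<Otimes>\<^sub>M M) F \<Longrightarrow> mp_bijection M \<phi> \<Longrightarrow> bdd_meas (M \<Otimes>\<^sub>M M) (version F \<phi>)"
  unfolding version_eq by (rule bdd_meas_compose[OF _ measurable_pair_mp_bijection])

text \<open>The eigenfunctions of the version are the \<open>e i\<close> composed with \<phi>.
  Instead of a spectral system for the version, the bound for \<open>K\<close> is used at f \<circ>
  \<sigma>, where \<sigma> inverts \<phi>.\<close>

lemma spectral_system_version_bound:
  assumes K: "sym_kernel M K" and sys: "spectral_system M K l e" and \<phi>: "mp_bijection M \<phi>"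
    and f: "bdd_meas M f"
  shows "ip M (graphon_op M (version K \<phi>) f) f \<le>
    l n * ip M f f + (\<Sum>i<n. l i * (ip M (\<lambda>x. e i (\<phi> x)) f)\<^sup>2)"
proof -
  note KB = sym_kernel_bdd[OF K]
  have e_bdd: "\<And>i. bdd_meas M (e i)" using sys unfolding spectral_system_def by auto
  obtain \<sigma> where \<sigma>: "mp_bijection M \<sigma>" "\<And>x. x \<in> space M \<Longrightarrow> \<sigma> (\<phi> x) = x"
    "\<And>x. x \<in> space M \<Longrightarrow> \<phi> (\<sigma> x) = x" using mp_bijection_inverse[OF \<phi>] by blast
  define g where "g = (\<lambda>x. f (\<sigma> x))"
  have g: "bdd_meas M g"
    unfolding g_def by (rule bdd_meas_compose[OF f mp_bijection_measurable[OF \<sigma>(1)]])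
  have gf: "g (\<phi> x) = f x" if "x \<in> space M" for x unfolding g_def using \<sigma>(2)[OF that] by simp
  have [measurable]: "g \<in> borel_measurable M" "\<And>i. e i \<in> borel_measurable M" "K \<in> borel_measurable (M \<Otimes>\<^sub>M M)"
    using g e_bdd KB by (auto simp: bdd_meas_def)
  have "ip M (graphon_op M (version K \<phi>) f) f =
      ip (M \<Otimes>\<^sub>M M) (version K \<phi>) (\<lambda>z. f (fst z) * f (snd z))"
    by (rule ip_op_eq[OF bdd_meas_version[OF KB \<phi>] f f])
  also have "\<dots> = ip (M \<Otimes>\<^sub>M M) (version K \<phi>) (version (\<lambda>z. g (fst z) * g (snd z)) \<phi>)"
    by (intro ip_cong) (auto simp: version_def space_pair_measure gf)
  also have "\<dots> = ip (M \<Otimes>\<^sub>M M) K (\<lambda>z. g (fst z) * g (snd z))"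
    by (rule ip_version[OF \<phi>]) measurable
  also have "\<dots> = ip M (graphon_op M K g) g" by (rule ip_op_eq[OF KB g g, symmetric])
  also have "\<dots> \<le> l n * ip M g g + (\<Sum>i<n. l i * (ip M (e i) g)\<^sup>2)"
    using sys g unfolding spectral_system_def by blast
  also have "ip M g g = ip M f f"
    using ip_mp_bijection[OF \<phi>, of g g] ip_cong[of M "\<lambda>x. g (\<phi> x)" f "\<lambda>x. g (\<phi> x)" f] gf by simp
  also have "(\<Sum>i<n. l i * (ip M (e i) g)\<^sup>2) = (\<Sum>i<n. l i * (ip M (\<lambda>x. e i (\<phi> x)) f)\<^sup>2)"
  proof (intro sum.cong refl)
    fix i
    have "ip M (e i) g = ip M (\<lambda>x. e i (\<phi> x)) f"
      using ip_mp_bijection[OF \<phi>, of "e i" g] ip_cong[of M "\<lambda>x. e i (\<phi> x)" "\<lambda>x. e i (\<phi> x)" "\<lambda>x. g (\<phi> x)" f] gf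
      by simp
    then show "l i * (ip M (e i) g)\<^sup>2 = l i * (ip M (\<lambda>x. e i (\<phi> x)) f)\<^sup>2" by simp
  qed
  finally show ?thesis .
qed

text \<open>The Courant-Fischer argument: some unit vector in the span of \<open>e 0, \<dots>, e i\<close> is orthogonal to
  the first \<open>i\<close> eigenfunctions of the \<open>n\<close>-th version of \<open>K\<close>.\<close>

lemma pos_eig_le_of_weak_limit:
  assumes K: "sym_kernel M K" and L: "sym_kernel M L" and \<pi>: "\<And>n. mp_bijection M (\<pi> n)"
    and lim: "\<And>G. bdd_meas (M \<Otimes>\<^sub>M M) G \<Longrightarrow>
      (\<lambda>n::nat. ip (M \<Otimes>\<^sub>M M) (\<lambda>z. version K (\<pi> n) z - L z) G) \<longlonglongrightarrow> 0"
  shows "pos_eig M L i \<le> pos_eig M K i"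
proof -
  interpret P: pair_prob_space M M ..
  note KB = sym_kernel_bdd[OF K] and LB = sym_kernel_bdd[OF L]
  obtain l e where sysL: "spectral_system M L l e" using spectral_system_exists[OF L] by blast
  obtain m d where sysK: "spectral_system M K m d" using spectral_system_exists[OF K] by blast
  have l: "decseq l" "\<And>n. 0 \<le> l n" and e_bdd: "\<And>n. bdd_meas M (e n)"
    and e_eig: "\<And>n x. x \<in> space M \<Longrightarrow> graphon_op M L (e n) x = l n * e n x"
    and e_orth: "\<And>i j. ip M (e i) (e j) = (if i = j \<and> l i > 0 then 1 else 0)"
    using sysL unfolding spectral_system_def by auto
  have m: "\<And>n. 0 \<le> m n" and d_bdd: "\<And>n. bdd_meas M (d n)"
    using sysK unfolding spectral_system_def by auto
  have "l i \<le> m i"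
  proof (cases "l i = 0")
    case True
    then show ?thesis using m by simp
  next
    case False
    then have li: "l i > 0" using l(2)[of i] by simp
    have lj: "l i \<le> l j" if "j \<le> i" for j using l(1) that by (rule decseqD)
    define D where "D n = (\<lambda>z. version K (\<pi> n) z - L z)" for n
    \<comment> \<open>The test vector below depends on \<open>n\<close>, so the error is measured on
      the whole span of e_0, ..., e_i at once; (i + 1)^2 fixed test kernels suffice.\<close>
    define \<delta> where "\<delta> n = (\<Sum>j\<le>i. \<Sum>k\<le>i. \<bar>ip (M \<Otimes>\<^sub>M M) (D n) (\<lambda>z. e k (fst z) * e j (snd z))\<bar>)" for n
    have vB: "bdd_meas (M \<Otimes>\<^sub>M M) (version K (\<pi> n))" for n by (rule bdd_meas_version[OF KB \<pi>])
    have DB: "bdd_meas (M \<Otimes>\<^sub>M M) (D n)" for n unfolding D_def by (intro bdd_meas_diff vB LB)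
    have "\<delta> \<longlonglongrightarrow> (\<Sum>j\<le>i. \<Sum>k\<le>i. \<bar>0\<bar>)"
      unfolding \<delta>_def D_def by (intro tendsto_intros lim bdd_meas_fst_snd e_bdd)
    then have \<delta>: "\<delta> \<longlonglongrightarrow> 0" by simp
    have "l i \<le> m i + \<delta> n" for n
    proof -
      \<comment> \<open>There are \<open>i\<close> equations for the \<open>i + 1\<close>
        coefficients, as \<open>{..i}\<close> includes 0.\<close>
      obtain c0 where c0: "\<exists>j\<in>{..i}. c0 j \<noteq> 0"
        and sol0: "\<And>k. k < i \<Longrightarrow> (\<Sum>j\<le>i. ip M (\<lambda>x. d k (\<pi> n x)) (e j) * c0 j) = 0"
        using homogeneous_system_nontrivial[of "{..i}" i "\<lambda>k j. ip M (\<lambda>x. d k (\<pi> n x)) (e j)"] by auto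
      define s where "s = (\<Sum>j\<le>i. (c0 j)\<^sup>2)"
      obtain j0 where "j0 \<le> i" "c0 j0 \<noteq> 0" using c0 by auto
      then have "s > 0" unfolding s_def by (intro sum_pos2[of "{..i}" j0]) auto
      define c where "c j = c0 j / sqrt s" for j
      have c_sq: "(\<Sum>j\<le>i. (c j)\<^sup>2) = 1"
        using \<open>s > 0\<close> unfolding c_def power_divide sum_divide_distrib[symmetric] by (simp add: s_def)
      have sol: "(\<Sum>j\<le>i. c j * ip M (\<lambda>x. d k (\<pi> n x)) (e j)) = 0" if "k < i" for k
        using sol0[OF that] unfolding c_def times_divide_eq_left sum_divide_distrib[symmetric]
        by (simp add: mult.commute)
      have c_le: "\<bar>c j\<bar> \<le> 1" if "j \<le> i" for j
      proof -
        have "(c j)\<^sup>2 \<le> (\<Sum>j\<le>i. (c j)\<^sup>2)" using that by (intro member_le_sum) auto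
        then show ?thesis using c_sq by (simp add: abs_square_le_1)
      qed
      define f where "f = (\<lambda>x. \<Sum>j\<le>i. c j * e j x)"
      have cb: "bdd_meas M (\<lambda>x. c j * e j x)" for j by (intro bdd_meas_intros e_bdd)
      have f: "bdd_meas M f" unfolding f_def by (intro bdd_meas_intros e_bdd)
      have ip_f: "ip M h f = (\<Sum>j\<le>i. c j * ip M h (e j))" if "bdd_meas M h" for h
      proof -
        have "ip M h f = (\<Sum>j\<le>i. ip M h (\<lambda>x. c j * e j x))"
          unfolding f_def by (intro ip_sum_right cb that)
        then show ?thesis by (simp add: ip_scale_right)
      qed
      have ip_op_f: "ip M (graphon_op M H f) f = (\<Sum>j\<le>i. \<Sum>k\<le>i. c j * c k * ip M (graphon_op M H (e j)) (e k))"
        if H: "bdd_meas (M \<Otimes>\<^sub>M M) H" for H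
      proof -
        have "ip M (graphon_op M H f) f = (\<Sum>k\<le>i. c k * ip M (graphon_op M H f) (e k))"
          by (rule ip_f) (intro bdd_meas_op H f)
        also have "\<dots> = (\<Sum>k\<le>i. c k * (\<Sum>j\<le>i. c j * ip M (graphon_op M H (e j)) (e k)))"
        proof (intro sum.cong refl arg_cong2[where f = "(*)"])
          fix k
          have "ip M (graphon_op M H f) (e k) = ip M (\<lambda>x. \<Sum>j\<le>i. c j * graphon_op M H (e j) x) (e k)"
            unfolding f_def by (intro ip_cong op_sum H e_bdd) auto
          also have "\<dots> = (\<Sum>j\<le>i. ip M (\<lambda>x. c j * graphon_op M H (e j) x) (e k))"
            by (intro ip_sum_left e_bdd bdd_meas_mult[OF bdd_meas_const] bdd_meas_op H)
          finally show "ip M (graphon_op M H f) (e k) = (\<Sum>j\<le>i. c j * ip M (graphon_op M H (e j)) (e k))"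
            by (simp add: ip_scale_left)
        qed
        also have "\<dots> = (\<Sum>k\<le>i. \<Sum>j\<le>i. c j * c k * ip M (graphon_op M H (e j)) (e k))"
          by (simp add: sum_distrib_left ac_simps)
        also have "\<dots> = (\<Sum>j\<le>i. \<Sum>k\<le>i. c j * c k * ip M (graphon_op M H (e j)) (e k))"
          by (rule sum.swap)
        finally show ?thesis .
      qed
      have e_i: "ip M (e j) (e k) = (if j = k then 1 else 0)" if "j \<le> i" for j k
        using lj[OF that] li by (auto simp: e_orth)
      have "ip M f f = (\<Sum>k\<le>i. c k * ip M f (e k))" by (rule ip_f[OF f])
      also have "\<dots> = (\<Sum>k\<le>i. (c k)\<^sup>2)"
      proof (intro sum.cong refl)
        fix k assume "k \<in> {..i}"
        then have "ip M (e k) f = (\<Sum>j\<le>i. if j = k then c k else 0)"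
          unfolding ip_f[OF e_bdd] by (intro sum.cong) (auto simp: e_i)
        then show "c k * ip M f (e k) = (c k)\<^sup>2"
          using \<open>k \<in> {..i}\<close> by (simp add: ip_commute[of M f] power2_eq_square)
      qed
      finally have f1: "ip M f f = 1" using c_sq by simp
      \<comment> \<open>At unit vectors of this span the form of \<open>L\<close> is at least
        \<open>l i\<close>. It differs from the form of the version by at most
        \<open>\<delta> n\<close>, and the latter is at most \<open>m i\<close> at
        \<open>f\<close>.\<close>
      have "l i = (\<Sum>j\<le>i. l i * (c j)\<^sup>2)" using c_sq by (simp add: sum_distrib_left[symmetric])
      also have "\<dots> \<le> (\<Sum>j\<le>i. l j * (c j)\<^sup>2)" using lj by (intro sum_mono mult_right_mono) auto
      also have "\<dots> = (\<Sum>j\<le>i. \<Sum>k\<le>i. c j * c k * ip M (graphon_op M L (e j)) (e k))"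
      proof (intro sum.cong refl)
        fix j assume j: "j \<in> {..i}"
        have "ip M (graphon_op M L (e j)) (e k) = l j * ip M (e j) (e k)" for k
          unfolding ip_scale_left[symmetric] by (intro ip_cong) (auto simp: e_eig)
        then have "(\<Sum>k\<le>i. c j * c k * ip M (graphon_op M L (e j)) (e k)) =
            (\<Sum>k\<le>i. if j = k then l j * (c j)\<^sup>2 else 0)"
          using j by (intro sum.cong) (auto simp: e_i power2_eq_square)
        then show "l j * (c j)\<^sup>2 = (\<Sum>k\<le>i. c j * c k * ip M (graphon_op M L (e j)) (e k))"
          using j by simp
      qed
      also have "\<dots> = ip M (graphon_op M L f) f" by (rule ip_op_f[OF LB, symmetric])
      also have "\<dots> = ip M (graphon_op M (version K (\<pi> n)) f) f - ip M (graphon_op M (D n) f) f"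
        using P.P.ip_diff_left[OF vB LB bdd_meas_fst_snd[OF f f], of n]
        unfolding ip_op_eq[OF LB f f] ip_op_eq[OF vB f f] ip_op_eq[OF DB f f] by (simp add: D_def)
      finally have "l i \<le> ip M (graphon_op M (version K (\<pi> n)) f) f - ip M (graphon_op M (D n) f) f" .
      moreover have "ip M (graphon_op M (version K (\<pi> n)) f) f \<le> m i"
      proof -
        have "ip M (\<lambda>x. d k (\<pi> n x)) f = 0" if "k < i" for k
          using sol[OF that] ip_f[OF bdd_meas_compose[OF d_bdd mp_bijection_measurable[OF \<pi>]]] by simp
        then show ?thesis using spectral_system_version_bound[OF K sysK \<pi> f, of n i] f1 by simp
      qed
      moreover have "- ip M (graphon_op M (D n) f) f \<le> \<delta> n"
      proof -
        have "\<bar>ip M (graphon_op M (D n) f) f\<bar> \<le>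
            (\<Sum>j\<le>i. \<Sum>k\<le>i. \<bar>c j * c k * ip M (graphon_op M (D n) (e j)) (e k)\<bar>)"
          unfolding ip_op_f[OF DB] by (intro order_trans[OF sum_abs] sum_mono sum_abs)
        also have "\<dots> \<le> \<delta> n"
          unfolding \<delta>_def
        proof (intro sum_mono)
          fix j k assume "j \<in> {..i}" "k \<in> {..i}"
          then have "\<bar>c j\<bar> * \<bar>c k\<bar> \<le> 1 * 1" by (intro mult_mono c_le) auto
          then have "\<bar>c j\<bar> * \<bar>c k\<bar> * \<bar>ip M (graphon_op M (D n) (e j)) (e k)\<bar> \<le>
              1 * \<bar>ip M (graphon_op M (D n) (e j)) (e k)\<bar>" by (intro mult_right_mono) auto
          then show "\<bar>c j * c k * ip M (graphon_op M (D n) (e j)) (e k)\<bar> \<le>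
              \<bar>ip (M \<Otimes>\<^sub>M M) (D n) (\<lambda>z. e k (fst z) * e j (snd z))\<bar>"
            unfolding ip_op_eq[OF DB e_bdd e_bdd, symmetric] by (simp add: abs_mult)
        qed
        finally show ?thesis by simp
      qed
      ultimately show ?thesis by simp
    qed
    moreover have "(\<lambda>n. m i + \<delta> n) \<longlonglongrightarrow> m i + 0" by (intro tendsto_intros \<delta>)
    ultimately have "l i \<le> m i + 0" by (intro LIMSEQ_le_const) auto
    then show ?thesis by simp
  qed
  then show ?thesis using pos_eig_spectral_system[OF L sysL] pos_eig_spectral_system[OF K sysK] by simp
qed

end

section \<open>The Hilbert-Schmidt norm\<close>


context prob_space
begin

text \<open>\<open>g\<close> is the component of \<open>f\<close> orthogonal to the
  \<open>v i\<close>. Indices with \<open>\<mu> i = 0\<close> carry null vectors, whose coefficients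
  vanish by Cauchy-Schwarz.\<close>

lemma eigensystem_Bessel:
  assumes I: "finite I" and v: "\<And>i. i \<in> I \<Longrightarrow> bdd_meas M (v i)"
    and orth: "\<And>i j. i \<in> I \<Longrightarrow> j \<in> I \<Longrightarrow> ip M (v i) (v j) = (if i = j \<and> \<mu> i \<noteq> 0 then 1 else 0)"
    and f: "bdd_meas M f" and g_def: "g = (\<lambda>x. f x - (\<Sum>i\<in>I. ip M (v i) f * v i x))"
  shows "bdd_meas M g" "\<And>k. k \<in> I \<Longrightarrow> ip M (v k) g = 0" "ip M g g \<le> ip M f f"
proof -
  have cv: "bdd_meas M (\<lambda>x. ip M (v i) f * v i x)" if "i \<in> I" for i by (intro bdd_meas_mult bdd_meas_const v that)
  have sv: "bdd_meas M (\<lambda>x. \<Sum>i\<in>I. ip M (v i) f * v i x)" by (intro bdd_meas_sum cv)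
  show g: "bdd_meas M g" unfolding g_def by (intro bdd_meas_diff f sv)
  have ip_g: "ip M h g = ip M h f - (\<Sum>i\<in>I. ip M (v i) f * ip M h (v i))" if h: "bdd_meas M h" for h
  proof -
    have "ip M h g = ip M h f - ip M h (\<lambda>x. \<Sum>i\<in>I. ip M (v i) f * v i x)"
      unfolding g_def by (intro ip_diff_right f sv h)
    also have "ip M h (\<lambda>x. \<Sum>i\<in>I. ip M (v i) f * v i x) = (\<Sum>i\<in>I. ip M h (\<lambda>x. ip M (v i) f * v i x))"
      by (intro ip_sum_right cv h)
    finally show ?thesis by (simp add: ip_scale_right)
  qed
  show vg: "ip M (v k) g = 0" if k: "k \<in> I" for k
  proof -
    have "(\<Sum>i\<in>I. ip M (v i) f * ip M (v k) (v i)) = (\<Sum>i\<in>I. if i = k then ip M (v k) f * ip M (v k) (v k) else 0)"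
      using k by (intro sum.cong) (auto simp: orth)
    also have "\<dots> = ip M (v k) f * ip M (v k) (v k)" using k I by simp
    also have "\<dots> = ip M (v k) f"
    proof (cases "\<mu> k = 0")
      case True
      then have "(ip M (v k) f)\<^sup>2 \<le> 0" using ip_Cauchy_Schwarz[OF v[OF k] f] k by (simp add: orth)
      then show ?thesis by simp
    qed (simp add: orth k)
    finally show ?thesis by (simp add: ip_g[OF v[OF k]])
  qed
  have "ip M g g = ip M g f"
    using ip_g[OF g] vg by (simp add: ip_commute[of M g "v _"])
  also have "\<dots> = ip M f f - (\<Sum>i\<in>I. (ip M (v i) f)\<^sup>2)"
    using ip_g[OF f] by (simp add: ip_commute[of M g f] ip_commute[of M f "v _"] power2_eq_square)
  also have "\<dots> \<le> ip M f f" by (simp add: sum_nonneg)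
  finally show "ip M g g \<le> ip M f f" .
qed

text \<open>The residual annihilates every \<open>v i\<close>, so its form at \<open>f\<close> is
  the form of \<open>K\<close> at the component of \<open>f\<close> orthogonal to them, where only
  the first term of the min-max bound survives. \<open>I\<close> may hold more than the first
  \<open>n\<close> vectors \<open>e i\<close>, in particular those of the other sign.\<close>

lemma residual_kernel_form_le:
  assumes K: "sym_kernel M K" and sys: "spectral_system M K l e"
    and I: "finite I" and v: "\<And>i. i \<in> I \<Longrightarrow> bdd_meas M (v i)"
    and eig: "\<And>i x. i \<in> I \<Longrightarrow> x \<in> space M \<Longrightarrow> graphon_op M K (v i) x = \<mu> i * v i x"
    and orth: "\<And>i j. i \<in> I \<Longrightarrow> j \<in> I \<Longrightarrow> ip M (v i) (v j) = (if i = j \<and> \<mu> i \<noteq> 0 then 1 else 0)"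
    and sub: "\<And>i. i < n \<Longrightarrow> e i \<in> v ` I" and f: "bdd_meas M f"
  shows "ip M (graphon_op M (residual_kernel K I \<mu> v) f) f \<le> l n * ip M f f"
proof -
  note KB = sym_kernel_bdd[OF K]
  let ?R = "residual_kernel K I \<mu> v"
  have R: "sym_kernel M ?R" by (intro sym_kernel_residual_kernel K v)
  note RB = sym_kernel_bdd[OF R]
  define g where "g = (\<lambda>x. f x - (\<Sum>i\<in>I. ip M (v i) f * v i x))"
  note g = eigensystem_Bessel[OF I v orth f g_def]
  have sv: "bdd_meas M (\<lambda>x. \<Sum>i\<in>I. ip M (v i) f * v i x)"
    by (intro bdd_meas_sum bdd_meas_mult bdd_meas_const v)
  have Rv: "graphon_op M ?R (v k) x = 0" if k: "k \<in> I" and x: "x \<in> space M" for k x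
  proof -
    have "(\<Sum>i\<in>I. \<mu> i * ip M (v i) (v k) * v i x) = (\<Sum>i\<in>I. if i = k then \<mu> k * v k x else 0)"
      using k by (intro sum.cong) (auto simp: orth)
    also have "\<dots> = \<mu> k * v k x" using k I by simp
    finally show ?thesis using op_residual_kernel[where I = I and \<mu> = \<mu> and v = v, OF KB v v[OF k] x] eig[OF k x] by simp
  qed
  have Rg: "graphon_op M ?R g x = graphon_op M ?R f x" if x: "x \<in> space M" for x
    using op_diff[OF RB f sv x] op_sum[where I = I and c = "\<lambda>i. ip M (v i) f" and f = v, OF RB v x] Rv[OF _ x]
    unfolding g_def by simp
  have "ip M (graphon_op M ?R f) f = ip M (graphon_op M ?R g) f"
    by (intro ip_cong) (auto simp: Rg)
  also have "\<dots> = ip M g (graphon_op M ?R f)" by (rule ip_op_commute[OF R g(1) f])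
  also have "\<dots> = ip M g (graphon_op M ?R g)" by (intro ip_cong) (auto simp: Rg)
  also have "\<dots> = ip M (graphon_op M ?R g) g" by (rule ip_commute)
  also have "\<dots> = ip M (graphon_op M K g) g"
    using ip_op_residual_kernel[where I = I and \<mu> = \<mu> and v = v, OF KB v g(1) g(1)] g(2) by simp
  also have "\<dots> \<le> l n * ip M g g + (\<Sum>i<n. l i * (ip M (e i) g)\<^sup>2)"
    using sys g(1) unfolding spectral_system_def by blast
  also have "(\<Sum>i<n. l i * (ip M (e i) g)\<^sup>2) = 0"
  proof (intro sum.neutral ballI)
    fix i assume "i \<in> {..<n}"
    then obtain k where "k \<in> I" "e i = v k" using sub[of i] by auto
    then show "l i * (ip M (e i) g)\<^sup>2 = 0" using g(2) by simp
  qed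
  also have "l n * ip M g g + 0 \<le> l n * ip M f f"
    using sys g(3) unfolding spectral_system_def by (auto intro: mult_left_mono)
  finally show ?thesis .
qed

lemma graphon_op_uminus: "graphon_op M (\<lambda>z. - K z) f x = - graphon_op M K f x"
  unfolding graphon_op_def by simp

theorem Hilbert_Schmidt_norm:
  assumes K: "sym_kernel M K" and pos: "spectral_system M K l e"
    and neg: "spectral_system M (\<lambda>z. - K z) m d"
  shows "(\<lambda>n. \<Sum>i<n. (l i)\<^sup>2 + (m i)\<^sup>2) \<longlonglongrightarrow> ip (M \<Otimes>\<^sub>M M) K K"
proof -
  interpret P: pair_prob_space M M ..
  note KB = sym_kernel_bdd[OF K]
  have K': "sym_kernel M (\<lambda>z. - K z)" using K unfolding sym_kernel_def by (auto intro: bdd_meas_uminus)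
  let ?N = "M \<Otimes>\<^sub>M M"
  have l: "\<And>n. 0 \<le> l n" and e_bdd: "\<And>n. bdd_meas M (e n)"
    and e_eig: "\<And>n x. x \<in> space M \<Longrightarrow> graphon_op M K (e n) x = l n * e n x"
    and e_orth: "\<And>i j. ip M (e i) (e j) = (if i = j \<and> l i > 0 then 1 else 0)"
    using pos unfolding spectral_system_def by auto
  have m: "\<And>n. 0 \<le> m n" and d_bdd: "\<And>n. bdd_meas M (d n)"
    and d_eig: "\<And>n x. x \<in> space M \<Longrightarrow> graphon_op M K (d n) x = - m n * d n x"
    and d_orth: "\<And>i j. ip M (d i) (d j) = (if i = j \<and> m i > 0 then 1 else 0)"
    using neg unfolding spectral_system_def by (auto simp: graphon_op_uminus) (metis minus_minus)
  \<comment> \<open>Eigenvalues of opposite signs are distinct, so symmetry gives orthogonality; if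
    both are 0, then \<open>e i\<close> is a null function.\<close>
  have ed: "ip M (e i) (d j) = 0" for i j
  proof (cases "l i + m j = 0")
    case True
    then have "ip M (e i) (e i) = 0" using l[of i] m[of j] by (simp add: e_orth)
    then show ?thesis using ip_Cauchy_Schwarz[OF e_bdd[of i] d_bdd[of j]] by simp
  next
    case False
    have "l i * ip M (e i) (d j) = ip M (graphon_op M K (e i)) (d j)"
      unfolding ip_scale_left[symmetric] by (intro ip_cong) (auto simp: e_eig)
    also have "\<dots> = ip M (e i) (graphon_op M K (d j))" by (rule ip_op_commute[OF K e_bdd d_bdd])
    also have "\<dots> = - m j * ip M (e i) (d j)"
      unfolding ip_scale_right[symmetric] by (intro ip_cong) (auto simp: d_eig)
    finally have "(l i + m j) * ip M (e i) (d j) = 0" by (simp add: distrib_right)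
    then show ?thesis using False by simp
  qed

  \<comment> \<open>\<open>True\<close> marks the positive half and \<open>False\<close> the
    negative one, so that one residual kernel removes both.\<close>
  define \<mu> where "\<mu> = (\<lambda>(b, i). if b then l i else - m i)"
  define v where "v = (\<lambda>(b, i). if b then e i else d i)"
  define I where "I n = (UNIV :: bool set) \<times> {..<n::nat}" for n
  define F where "F n = residual_kernel K (I n) \<mu> v" for n
  have I: "finite (I n)" for n unfolding I_def by simp
  have v_bdd: "bdd_meas M (v i)" for i by (cases i) (simp add: v_def e_bdd d_bdd)
  have eig: "graphon_op M K (v i) x = \<mu> i * v i x" if "x \<in> space M" for i x
    using that by (cases i) (simp add: v_def \<mu>_def e_eig d_eig)
  have orth: "ip M (v i) (v j) = (if i = j \<and> \<mu> i \<noteq> 0 then 1 else 0)" for i j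
    using l m by (cases i; cases j) (auto simp: v_def \<mu>_def e_orth d_orth ed ip_commute[of M "d _" "e _"] less_le)
  have sum_sq: "(\<Sum>i\<in>I n. (\<mu> i)\<^sup>2) = (\<Sum>i<n. (l i)\<^sup>2 + (m i)\<^sup>2)" for n
  proof -
    have "(\<Sum>i\<in>I n. (\<mu> i)\<^sup>2) = (\<Sum>b\<in>UNIV. \<Sum>i<n. (\<mu> (b, i))\<^sup>2)"
      unfolding I_def sum.cartesian_product by (intro sum.cong) auto
    then show ?thesis by (simp add: UNIV_bool \<mu>_def sum.distrib add.commute)
  qed
  have F_bdd: "bdd_meas ?N (F n)" for n unfolding F_def by (intro bdd_meas_residual_kernel KB v_bdd)
  have norm: "ip ?N (F n) K = ip ?N K K - (\<Sum>i<n. (l i)\<^sup>2 + (m i)\<^sup>2)"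
    "ip ?N (F n) (F n) = ip ?N K K - (\<Sum>i<n. (l i)\<^sup>2 + (m i)\<^sup>2)" for n
    unfolding F_def sum_sq[symmetric] using residual_kernel_norm[OF KB I v_bdd eig orth] by auto
  have F_norm: "ip ?N (F n) (F n) \<le> ip ?N K K" for n
    unfolding norm by (simp add: sum_nonneg)

  have upper: "ip M (graphon_op M (F n) f) f \<le> l n * ip M f f" if f: "bdd_meas M f" for n f
    unfolding F_def
  proof (rule residual_kernel_form_le[OF K pos I v_bdd eig orth _ f])
    show "e i \<in> v ` I n" if "i < n" for i
      by (rule image_eqI[of _ _ "(True, i)"]) (use that in \<open>auto simp: v_def I_def\<close>)
  qed
  \<comment> \<open>The upper bound again, for \<open>- K\<close>: its residual for the negated
    eigenvalues is \<open>- F n\<close>.\<close>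
  have lower: "- ip M (graphon_op M (F n) f) f \<le> m n * ip M f f" if f: "bdd_meas M f" for n f
  proof -
    have "ip M (graphon_op M (residual_kernel (\<lambda>z. - K z) (I n) (\<lambda>i. - \<mu> i) v) f) f \<le> m n * ip M f f"
    proof (rule residual_kernel_form_le[OF K' neg I v_bdd _ _ _ f])
      show "d i \<in> v ` I n" if "i < n" for i
        by (rule image_eqI[of _ _ "(False, i)"]) (use that in \<open>auto simp: v_def I_def\<close>)
      show "graphon_op M (\<lambda>z. - K z) (v i) x = - \<mu> i * v i x" if "x \<in> space M" for i x
        using eig[OF that] by (simp add: graphon_op_uminus)
      show "ip M (v i) (v j) = (if i = j \<and> - \<mu> i \<noteq> 0 then 1 else 0)" for i j by (simp add: orth)
    qed
    moreover have "residual_kernel (\<lambda>z. - K z) (I n) (\<lambda>i. - \<mu> i) v = (\<lambda>z. - F n z)"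
      unfolding residual_kernel_def F_def by (simp add: sum_negf)
    ultimately show ?thesis
      using ip_uminus_left[of M "graphon_op M (F n) f" f] ip_cong[of M "graphon_op M (\<lambda>z. - F n z) f" "\<lambda>x. - graphon_op M (F n) f x" f f]
      by (simp add: graphon_op_uminus)
  qed
  have form0: "(\<lambda>n. ip M (graphon_op M (F n) f) f) \<longlonglongrightarrow> 0" if f: "bdd_meas M f" for f
  proof (rule Lim_null_comparison)
    have "(\<lambda>n. (l n + m n) * ip M f f) \<longlonglongrightarrow> (0 + 0) * ip M f f"
      by (intro tendsto_intros spectral_system_tendsto_0[OF K pos] spectral_system_tendsto_0[OF K' neg])
    then show "(\<lambda>n. (l n + m n) * ip M f f) \<longlonglongrightarrow> 0" by simp
    have "\<bar>ip M (graphon_op M (F n) f) f\<bar> \<le> (l n + m n) * ip M f f" for n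
      using upper[OF f, of n] lower[OF f, of n] mult_nonneg_nonneg[OF l[of n] ip_self_nonneg[of M f]]
        mult_nonneg_nonneg[OF m[of n] ip_self_nonneg[of M f]] by (simp add: distrib_right abs_le_iff)
    then show "\<forall>\<^sub>F n in sequentially. norm (ip M (graphon_op M (F n) f) f) \<le> (l n + m n) * ip M f f" by simp
  qed
  have rect: "(\<lambda>n. ip ?N (F n) (indicator (A \<times> B))) \<longlonglongrightarrow> 0" if A: "A \<in> sets M" and B: "B \<in> sets M" for A B
  proof -
    let ?a = "indicator A :: 'a \<Rightarrow> real" and ?b = "indicator B :: 'a \<Rightarrow> real"
    note a = bdd_meas_indicator[OF A] and b = bdd_meas_indicator[OF B]
    have s: "bdd_meas M (\<lambda>x. ?a x + t * ?b x)" for t by (intro bdd_meas_add bdd_meas_mult bdd_meas_const a b)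
    have F_sym: "sym_kernel M (F n)" for n unfolding F_def by (intro sym_kernel_residual_kernel K v_bdd)
    have expand: "ip M (graphon_op M (F n) (\<lambda>x. ?a x + t * ?b x)) (\<lambda>x. ?a x + t * ?b x) =
        ip M (graphon_op M (F n) ?a) ?a + 2 * t * ip M (graphon_op M (F n) ?b) ?a +
        t * t * ip M (graphon_op M (F n) ?b) ?b" for n t
    proof -
      have "ip M (graphon_op M (F n) (\<lambda>x. ?a x + t * ?b x)) (\<lambda>x. ?a x + t * ?b x) =
          ip M (\<lambda>x. graphon_op M (F n) ?a x + t * graphon_op M (F n) ?b x) (\<lambda>x. ?a x + t * ?b x)"
        by (intro ip_cong op_add_scale F_bdd a b) auto
      also have "\<dots> = ip M (graphon_op M (F n) ?a) ?a + t * ip M (graphon_op M (F n) ?a) ?b +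
          (t * ip M (graphon_op M (F n) ?b) ?a + t * (t * ip M (graphon_op M (F n) ?b) ?b))"
        using bdd_meas_op[OF F_bdd a, of n] bdd_meas_op[OF F_bdd b, of n] a b
        by (simp add: ip_add_left ip_add_right ip_scale_left ip_scale_right bdd_meas_add
            bdd_meas_mult[OF bdd_meas_const] distrib_left)
      also have "ip M (graphon_op M (F n) ?a) ?b = ip M (graphon_op M (F n) ?b) ?a"
        using ip_op_commute[OF F_sym a b, of n] by (simp add: ip_commute)
      finally show ?thesis by simp
    qed
    \<comment> \<open>Polarisation: the forms at a + b and a - b differ by four times the mixed
      term.\<close>
    have "(\<lambda>n. (ip M (graphon_op M (F n) (\<lambda>x. ?a x + 1 * ?b x)) (\<lambda>x. ?a x + 1 * ?b x) -
        ip M (graphon_op M (F n) (\<lambda>x. ?a x + (-1) * ?b x)) (\<lambda>x. ?a x + (-1) * ?b x)) / 4) \<longlonglongrightarrow> (0 - 0) / 4"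
      by (intro tendsto_intros form0 s) simp
    then have "(\<lambda>n. ip M (graphon_op M (F n) ?b) ?a) \<longlonglongrightarrow> 0" unfolding expand by simp
    moreover have "ip M (graphon_op M (F n) ?b) ?a = ip ?N (F n) (indicator (A \<times> B))" for n
      unfolding ip_op_eq[OF F_bdd b a] by (intro ip_cong) (auto simp: indicator_def)
    ultimately show ?thesis by simp
  qed
  have "(\<lambda>n. ip ?N (F n) K) \<longlonglongrightarrow> 0"
    by (rule ip_tendsto_0_from_rectangles[OF F_bdd F_norm rect KB])
  then have "(\<lambda>n. ip ?N K K - ip ?N (F n) K) \<longlonglongrightarrow> ip ?N K K - 0" by (intro tendsto_intros)
  then show ?thesis by (simp add: norm)
qed

end

section \<open>Graphons and their envelopes\<close>


lemma version_id: "version W (\<lambda>x. x) = W"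
  unfolding version_def by simp

lemma version_uminus: "version (\<lambda>z. - W z) \<phi> = (\<lambda>z. - version W \<phi> z)"
  unfolding version_def by auto

lemma set_lebesgue_integral_eq_ip: "set_lebesgue_integral N A F = ip N F (indicator A)"
  unfolding set_lebesgue_integral_def ip_def by (simp add: mult.commute)

lemma graphon_sym_kernel: "graphon M W \<Longrightarrow> sym_kernel M W"
  unfolding graphon_def sym_kernel_def by (auto intro!: bdd_measI[of _ _ 1] simp: space_pair_measure)

lemma sym_kernel_uminus: "sym_kernel M K \<Longrightarrow> sym_kernel M (\<lambda>z. - K z)"
  unfolding sym_kernel_def by (auto intro: bdd_meas_uminus)

lemma (in prob_space) ip_indicator_abs_le:
  assumes "bdd_meas M F" "A \<in> sets M"
  shows "\<bar>ip M F (indicator A)\<bar> \<le> sqrt (ip M F F)"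
proof -
  note b = bdd_meas_indicator[OF assms(2)]
  have "ip M (indicator A) (indicator A) \<le> (\<integral>x. 1 \<partial>M)"
    unfolding ip_def
    by (intro integral_mono bdd_meas_integrable bdd_meas_mult b bdd_meas_const) (auto simp: indicator_def)
  then have "sqrt (ip M F F) * sqrt (ip M (indicator A) (indicator A)) \<le> sqrt (ip M F F) * 1"
    by (intro mult_left_mono) (auto simp: prob_space ip_self_nonneg)
  then show ?thesis using ip_abs_le[OF assms(1) b] by simp
qed

context prob_space
begin

lemma graphon_in_envelope: "graphon M W \<Longrightarrow> W \<in> envelope M W"
  unfolding envelope_def weak_star_conv_def
  by (auto intro!: exI[of _ "\<lambda>_ x. x"] mp_bijection_id simp: version_id)

text \<open>Graphons take values in [0, 1], so the differences have norm at most 1 and rectangles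
  suffice as tests.\<close>

lemma weak_star_conv_imp_ip_tendsto_0:
  assumes W: "graphon M W" and U: "graphon M U" and \<pi>: "\<And>n. mp_bijection M (\<pi> n)"
    and conv: "weak_star_conv M (\<lambda>n. version W (\<pi> n)) U" and G: "bdd_meas (M \<Otimes>\<^sub>M M) G"
  shows "(\<lambda>n. ip (M \<Otimes>\<^sub>M M) (\<lambda>z. version W (\<pi> n) z - U z) G) \<longlonglongrightarrow> 0"
proof -
  interpret P: pair_prob_space M M ..
  let ?N = "M \<Otimes>\<^sub>M M"
  note UB = sym_kernel_bdd[OF graphon_sym_kernel[OF U]]
  note vB = bdd_meas_version[OF sym_kernel_bdd[OF graphon_sym_kernel[OF W]] \<pi>]
  have D: "bdd_meas ?N (\<lambda>z. version W (\<pi> n) z - U z)" for n by (intro bdd_meas_diff vB UB)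
  show ?thesis
  proof (rule ip_tendsto_0_from_rectangles[OF D _ _ G, where R = 1])
    fix n
    have "\<bar>version W (\<pi> n) z - U z\<bar> \<le> 1" if z: "z \<in> space ?N" for z
    proof -
      obtain x y where xy: "z = (x, y)" "x \<in> space M" "y \<in> space M"
        using z by (cases z) (auto simp: space_pair_measure)
      then have "\<pi> n x \<in> space M" "\<pi> n y \<in> space M"
        using measurable_space[OF mp_bijection_measurable[OF \<pi>]] by auto
      then have "0 \<le> version W (\<pi> n) z" "version W (\<pi> n) z \<le> 1" "0 \<le> U z" "U z \<le> 1"
        using W U xy unfolding graphon_def version_def by auto
      then show ?thesis by simp
    qed
    then have "ip ?N (\<lambda>z. version W (\<pi> n) z - U z) (\<lambda>z. version W (\<pi> n) z - U z) \<le> (\<integral>z. 1 \<partial>?N)"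
      unfolding ip_def
      by (intro integral_mono P.P.bdd_meas_integrable bdd_meas_mult D bdd_meas_const)
         (simp add: abs_square_le_1 flip: power2_eq_square)
    then show "ip ?N (\<lambda>z. version W (\<pi> n) z - U z) (\<lambda>z. version W (\<pi> n) z - U z) \<le> 1"
      by (simp add: P.P.prob_space)
  next
    fix A B assume AB: "A \<in> sets M" "B \<in> sets M"
    then have b: "bdd_meas ?N (indicator (A \<times> B))" by (intro bdd_meas_indicator) auto
    have "(\<lambda>n. ip ?N (version W (\<pi> n)) (indicator (A \<times> B))) \<longlonglongrightarrow> ip ?N U (indicator (A \<times> B))"
      using conv AB unfolding weak_star_conv_def set_lebesgue_integral_eq_ip by blast
    then show "(\<lambda>n. ip ?N (\<lambda>z. version W (\<pi> n) z - U z) (indicator (A \<times> B))) \<longlonglongrightarrow> 0"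
      unfolding P.P.ip_diff_left[OF vB UB b] by (rule LIM_zero)
  qed
qed

lemma neg_eig_eq:
  assumes "sym_kernel M K" shows "neg_eig M K i = - pos_eig M (\<lambda>z. - K z) i"
proof -
  note K' = sym_kernel_uminus[OF assms]
  obtain l e where sys: "spectral_system M (\<lambda>z. - K z) l e" using spectral_system_exists[OF K'] by blast
  have "pos_eig_list M (\<lambda>z. - K z) l"
    using sys eig_mult_spectral_system[OF K' sys] unfolding pos_eig_list_def spectral_system_def by auto
  then show ?thesis using neg_eig_eq_pos_eig by metis
qed

lemma spectral_le_if_in_envelope:
  assumes W: "graphon M W" and U: "U \<in> envelope M W"
  shows "spectral_le M U W"
proof -
  obtain \<pi> where gU: "graphon M U" and \<pi>: "\<And>n. mp_bijection M (\<pi> n)"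
    and conv: "weak_star_conv M (\<lambda>n. version W (\<pi> n)) U"
    using U unfolding envelope_def by blast
  note K = graphon_sym_kernel[OF W] and L = graphon_sym_kernel[OF gU]
  note lim = weak_star_conv_imp_ip_tendsto_0[OF W gU \<pi> conv]
  have lim': "(\<lambda>n. ip (M \<Otimes>\<^sub>M M) (\<lambda>z. version (\<lambda>z. - W z) (\<pi> n) z - - U z) G) \<longlonglongrightarrow> 0"
    if G: "bdd_meas (M \<Otimes>\<^sub>M M) G" for G
  proof -
    have "ip (M \<Otimes>\<^sub>M M) (\<lambda>z. version (\<lambda>z. - W z) (\<pi> n) z - - U z) G =
        - ip (M \<Otimes>\<^sub>M M) (\<lambda>z. version W (\<pi> n) z - U z) G" for n
      unfolding ip_uminus_left[symmetric] version_uminus by simp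
    then show ?thesis using tendsto_minus[OF lim[OF G]] by simp
  qed
  show ?thesis
    unfolding spectral_le_def neg_eig_eq[OF K] neg_eig_eq[OF L]
    using pos_eig_le_of_weak_limit[OF K L \<pi> lim]
      pos_eig_le_of_weak_limit[OF sym_kernel_uminus[OF K] sym_kernel_uminus[OF L] \<pi> lim'] by simp
qed

section \<open>Cut norm and cut distance\<close>

lemma abs_ip_rectangle_le_cut_norm:
  assumes Y: "bdd_meas (M \<Otimes>\<^sub>M M) Y" and ST: "S \<in> sets M" "T \<in> sets M"
  shows "\<bar>ip (M \<Otimes>\<^sub>M M) Y (indicator (S \<times> T))\<bar> \<le> cut_norm M Y"
proof -
  interpret P: pair_prob_space M M ..
  have "bdd_above ((\<lambda>(S, T). \<bar>ip (M \<Otimes>\<^sub>M M) Y (indicator (S \<times> T))\<bar>) ` (sets M \<times> sets M))"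
    by (rule bdd_aboveI[of _ "sqrt (ip (M \<Otimes>\<^sub>M M) Y Y)"]) (auto intro!: P.P.ip_indicator_abs_le[OF Y])
  then show ?thesis
    unfolding cut_norm_def set_lebesgue_integral_eq_ip
    by (rule cSUP_upper2[where x = "(S, T)"]) (use ST in auto)
qed

text \<open>For the second membership the test rectangle is pulled back along
  \<open>\<phi> n\<close> and so varies with \<open>n\<close>; the uniformity of the cut norm over
  all rectangles is what permits this.\<close>

lemma envelope_if_cut_norm_small:
  assumes U: "graphon M U" and W: "graphon M W" and \<phi>: "\<And>n. mp_bijection M (\<phi> n)"
    and small: "\<And>n::nat. cut_norm M (\<lambda>z. U z - version W (\<phi> n) z) < inverse (Suc n)"
  shows "U \<in> envelope M W" "W \<in> envelope M U"
proof -
  interpret P: pair_prob_space M M ..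
  let ?N = "M \<Otimes>\<^sub>M M"
  note UB = sym_kernel_bdd[OF graphon_sym_kernel[OF U]] and WB = sym_kernel_bdd[OF graphon_sym_kernel[OF W]]
  note UB' = bdd_meas_version[OF UB] and WB' = bdd_meas_version[OF WB]
  have rect: "\<bar>ip ?N U (indicator (S \<times> T)) - ip ?N (version W (\<phi> n)) (indicator (S \<times> T))\<bar> \<le> inverse (Suc n)"
    if "S \<in> sets M" "T \<in> sets M" for S T n
  proof -
    have b: "bdd_meas ?N (indicator (S \<times> T))" using that by (intro bdd_meas_indicator) auto
    show ?thesis
      using abs_ip_rectangle_le_cut_norm[OF bdd_meas_diff[OF UB WB'[OF \<phi>]] that, of n] small[of n]
      by (simp add: P.P.ip_diff_left UB WB'[OF \<phi>] b)
  qed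
  have conv: "a \<longlonglongrightarrow> L" if "\<And>n. \<bar>L - a n\<bar> \<le> inverse (Suc n)" for a :: "nat \<Rightarrow> real" and L
  proof (rule LIM_zero_cancel, rule Lim_null_comparison[OF _ LIMSEQ_inverse_real_of_nat])
    show "\<forall>\<^sub>F n in sequentially. norm (a n - L) \<le> inverse (Suc n)"
      using that by (simp add: abs_minus_commute)
  qed
  have "weak_star_conv M (\<lambda>n. version W (\<phi> n)) U"
    unfolding weak_star_conv_def set_lebesgue_integral_eq_ip by (intro ballI conv rect)
  then show "U \<in> envelope M W" unfolding envelope_def using U \<phi> by blast
  have "\<exists>\<psi>. mp_bijection M \<psi> \<and> (\<forall>x\<in>space M. \<psi> (\<phi> n x) = x)" for n
    using mp_bijection_inverse[OF \<phi>[of n]] by blast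
  then obtain \<psi> where \<psi>: "\<And>n. mp_bijection M (\<psi> n)" "\<And>n x. x \<in> space M \<Longrightarrow> \<psi> n (\<phi> n x) = x" by metis
  have "weak_star_conv M (\<lambda>n. version U (\<psi> n)) W"
    unfolding weak_star_conv_def set_lebesgue_integral_eq_ip
  proof (intro ballI conv)
    fix S T n assume ST: "S \<in> sets M" "T \<in> sets M"
    let ?S = "\<phi> n -` S \<inter> space M" and ?T = "\<phi> n -` T \<inter> space M"
    note meas = mp_bijection_measurable[OF \<phi>, of n]
    have ind: "bdd_meas ?N (indicator (S \<times> T))" using ST by (intro bdd_meas_indicator) auto
    have "ip ?N W (indicator (S \<times> T)) = ip ?N (version W (\<phi> n)) (version (indicator (S \<times> T)) (\<phi> n))"
      by (rule ip_version[OF \<phi>, symmetric]) (use WB ind in \<open>auto simp: bdd_meas_def\<close>)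
    also have "\<dots> = ip ?N (version W (\<phi> n)) (indicator (?S \<times> ?T))"
      by (intro ip_cong) (auto simp: version_def indicator_def space_pair_measure)
    finally have 1: "ip ?N W (indicator (S \<times> T)) = ip ?N (version W (\<phi> n)) (indicator (?S \<times> ?T))" .
    have "ip ?N (version U (\<psi> n)) (indicator (S \<times> T)) =
        ip ?N (version (version U (\<psi> n)) (\<phi> n)) (version (indicator (S \<times> T)) (\<phi> n))"
      by (rule ip_version[OF \<phi>, symmetric]) (use UB'[OF \<psi>(1)] ind in \<open>auto simp: bdd_meas_def\<close>)
    also have "\<dots> = ip ?N U (indicator (?S \<times> ?T))"
      by (intro ip_cong) (auto simp: version_def indicator_def space_pair_measure \<psi>(2))
    finally have 2: "ip ?N (version U (\<psi> n)) (indicator (S \<times> T)) = ip ?N U (indicator (?S \<times> ?T))" .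
    show "\<bar>ip ?N W (indicator (S \<times> T)) - ip ?N (version U (\<psi> n)) (indicator (S \<times> T))\<bar> \<le> inverse (Suc n)"
      unfolding 1 2 using rect[OF measurable_sets[OF meas ST(1)] measurable_sets[OF meas ST(2)], of n]
      by (simp add: abs_minus_commute)
  qed
  then show "W \<in> envelope M U" unfolding envelope_def using W \<psi>(1) by blast
qed

text \<open>The infimum need not be attained, hence a sequence of bijections with errors below 1 /
  (n + 1).\<close>

lemma envelope_if_cut_dist_0:
  assumes U: "graphon M U" and W: "graphon M W" and "cut_dist M U W = 0"
  shows "U \<in> envelope M W" "W \<in> envelope M U"
proof -
  have "\<exists>\<phi>. mp_bijection M \<phi> \<and> cut_norm M (\<lambda>z. U z - version W \<phi> z) < inverse (Suc n)" for n
  proof -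
    let ?X = "(\<lambda>\<phi>. cut_norm M (\<lambda>z. U z - version W \<phi> z)) ` {\<phi>. mp_bijection M \<phi>}"
    have "Inf ?X < inverse (Suc n)" using assms(3) unfolding cut_dist_def by simp
    moreover have "?X \<noteq> {}" using mp_bijection_id[of M] by auto
    ultimately have "\<exists>x\<in>?X. x < inverse (Suc n)" by (intro cInf_lessD)
    then show ?thesis by blast
  qed
  then obtain \<phi> where "\<And>n. mp_bijection M (\<phi> n)"
    "\<And>n::nat. cut_norm M (\<lambda>z. U z - version W (\<phi> n) z) < inverse (Suc n)" by metis
  from envelope_if_cut_norm_small[OF U W this]
  show "U \<in> envelope M W" "W \<in> envelope M U" by auto
qed

text \<open>The L^2 distance is invariant under bijections, so the versions of \<open>W\<close> that
  define an arbitrary member of its envelope can be replaced by versions of \<open>U\<close>, one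
  index at a time.\<close>

lemma env_le_if_same_spectrum:
  assumes U: "graphon M U" and W: "graphon M W" and UW: "U \<in> envelope M W"
    and eq: "pos_eig M U = pos_eig M W" "neg_eig M U = neg_eig M W"
  shows "env_le M W U"
proof -
  interpret P: pair_prob_space M M ..
  let ?N = "M \<Otimes>\<^sub>M M"
  note Us = graphon_sym_kernel[OF U] and Ws = graphon_sym_kernel[OF W]
  note UB = sym_kernel_bdd[OF Us] and WB = sym_kernel_bdd[OF Ws]
  note UB' = bdd_meas_version[OF UB] and WB' = bdd_meas_version[OF WB]
  have HS: "(\<lambda>n. \<Sum>i<n. (pos_eig M K i)\<^sup>2 + (neg_eig M K i)\<^sup>2) \<longlonglongrightarrow> ip ?N K K" if K: "sym_kernel M K" for K
  proof -
    note K' = sym_kernel_uminus[OF K]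
    obtain l e where le: "spectral_system M K l e" using spectral_system_exists[OF K] by blast
    obtain m d where md: "spectral_system M (\<lambda>z. - K z) m d" using spectral_system_exists[OF K'] by blast
    show ?thesis
      using Hilbert_Schmidt_norm[OF K le md]
      by (simp add: neg_eig_eq[OF K] pos_eig_spectral_system[OF K le] pos_eig_spectral_system[OF K' md])
  qed
  have norm: "ip ?N W W = ip ?N U U"
    using HS[OF Ws] HS[OF Us] unfolding eq by (rule LIMSEQ_unique)
  obtain \<pi> where \<pi>: "\<And>n. mp_bijection M (\<pi> n)" and conv: "weak_star_conv M (\<lambda>n. version W (\<pi> n)) U"
    using UW unfolding envelope_def by blast
  define D where "D n = (\<lambda>z. version W (\<pi> n) z - U z)" for n
  have D_bdd: "bdd_meas ?N (D n)" for n unfolding D_def by (intro bdd_meas_diff WB' \<pi> UB)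
  \<comment> \<open>As |W| = |U|, the squared distance expands to 2 |U|^2 - 2 <W^\<pi>, U>, which
    weak convergence sends to 0.\<close>
  have "ip ?N (D n) (D n) = - 2 * ip ?N (D n) U" for n
  proof -
    note v = WB'[OF \<pi>, of n]
    have "ip ?N (version W (\<pi> n)) (version W (\<pi> n)) = ip ?N U U"
      using ip_version[OF \<pi>, of W W n] WB norm by (simp add: bdd_meas_def)
    then show ?thesis
      using P.P.ip_diff_left[OF v UB D_bdd[of n]] P.P.ip_diff_right[OF v UB v] P.P.ip_diff_right[OF v UB UB]
        P.P.ip_diff_left[OF v UB UB] ip_commute[of ?N U "version W (\<pi> n)"]
      by (simp add: D_def)
  qed
  moreover have "(\<lambda>n. - 2 * ip ?N (D n) U) \<longlonglongrightarrow> - 2 * 0"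
    unfolding D_def by (intro tendsto_intros weak_star_conv_imp_ip_tendsto_0[OF W U \<pi> conv UB])
  ultimately have "(\<lambda>n. sqrt (ip ?N (D n) (D n))) \<longlonglongrightarrow> sqrt 0" by (intro tendsto_real_sqrt) simp
  then have D0: "(\<lambda>n. sqrt (ip ?N (D n) (D n))) \<longlonglongrightarrow> 0" by simp
  have "\<exists>\<sigma>. mp_bijection M \<sigma> \<and> (\<forall>x\<in>space M. \<pi> n (\<sigma> x) = x)" for n
    using mp_bijection_inverse[OF \<pi>[of n]] by blast
  then obtain \<sigma> where \<sigma>: "\<And>n. mp_bijection M (\<sigma> n)" "\<And>n x. x \<in> space M \<Longrightarrow> \<pi> n (\<sigma> n x) = x" by metis
  have "X \<in> envelope M U" if X: "X \<in> envelope M W" for X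
  proof -
    obtain \<rho> where gX: "graphon M X" and \<rho>: "\<And>n. mp_bijection M (\<rho> n)"
      and convX: "weak_star_conv M (\<lambda>n. version W (\<rho> n)) X"
      using X unfolding envelope_def by blast
    \<comment> \<open>Since \<pi> undoes \<sigma>, moving W^\<pi> by \<tau> gives W^\<rho>. Hence
      W^\<rho> - U^\<tau> is W^\<pi> - U moved by \<tau> and has the same norm.\<close>
    define \<tau> where "\<tau> n = (\<lambda>x. \<sigma> n (\<rho> n x))" for n
    have \<tau>: "mp_bijection M (\<tau> n)" for n unfolding \<tau>_def by (rule mp_bijection_comp[OF \<sigma>(1) \<rho>])
    have "weak_star_conv M (\<lambda>n. version U (\<tau> n)) X"
      unfolding weak_star_conv_def set_lebesgue_integral_eq_ip
    proof (intro ballI)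
      fix S T assume ST: "S \<in> sets M" "T \<in> sets M"
      let ?i = "indicator (S \<times> T) :: 'a \<times> 'a \<Rightarrow> real"
      have ind: "bdd_meas ?N ?i" using ST by (intro bdd_meas_indicator) auto
      have "\<bar>ip ?N (version W (\<rho> n)) ?i - ip ?N (version U (\<tau> n)) ?i\<bar> \<le> sqrt (ip ?N (D n) (D n))" for n
      proof -
        let ?E = "\<lambda>z. version W (\<rho> n) z - version U (\<tau> n) z"
        have E: "bdd_meas ?N ?E" by (intro bdd_meas_diff UB' WB' \<rho> \<tau>)
        have "ip ?N ?E ?E = ip ?N (version (D n) (\<tau> n)) (version (D n) (\<tau> n))"
          using measurable_space[OF mp_bijection_measurable[OF \<rho>]]
          by (intro ip_cong) (auto simp: version_def D_def \<tau>_def \<sigma>(2) space_pair_measure)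
        also have "\<dots> = ip ?N (D n) (D n)"
          by (rule ip_version[OF \<tau>]) (use D_bdd in \<open>auto simp: bdd_meas_def\<close>)
        finally have "\<bar>ip ?N ?E ?i\<bar> \<le> sqrt (ip ?N (D n) (D n))"
          using P.P.ip_indicator_abs_le[OF E, of "S \<times> T"] ST by auto
        then show ?thesis by (simp add: P.P.ip_diff_left[OF WB'[OF \<rho>] UB'[OF \<tau>] ind])
      qed
      then have "(\<lambda>n. ip ?N (version W (\<rho> n)) ?i - ip ?N (version U (\<tau> n)) ?i) \<longlonglongrightarrow> 0"
        by (intro Lim_null_comparison[OF _ D0]) simp
      moreover have "(\<lambda>n. ip ?N (version W (\<rho> n)) ?i) \<longlonglongrightarrow> ip ?N X ?i"
        using convX ST unfolding weak_star_conv_def set_lebesgue_integral_eq_ip by blast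
      ultimately show "(\<lambda>n. ip ?N (version U (\<tau> n)) ?i) \<longlonglongrightarrow> ip ?N X ?i"
        using tendsto_diff by fastforce
    qed
    then show ?thesis unfolding envelope_def using gX \<tau> by blast
  qed
  then show ?thesis unfolding env_le_def by blast
qed

end

theorem theorem3p22:
  fixes M :: "'a measure"
  assumes "prob_space M" and "standard_borel_space M" and "atomless M"
  shows "graphon_order M (spectral_le M) \<and> cut_distance_identifying M (spectral_le M) \<and>
    (\<forall>U W. graphon M U \<longrightarrow> graphon M W \<longrightarrow>
       (cut_dist M U W = 0 \<longrightarrow>
          (\<forall>i. pos_eig M U i = pos_eig M W i \<and> neg_eig M U i = neg_eig M W i)) \<and>
       (env_less M U W \<longrightarrow> spectral_less M U W))"
proof -
  interpret prob_space M by (rule assms)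
  have cut: "spectral_le M U W \<and> spectral_le M W U"
    if "graphon M U" "graphon M W" "cut_dist M U W = 0" for U W
    using envelope_if_cut_dist_0[OF that] spectral_le_if_in_envelope that by blast
  have same: "pos_eig M U = pos_eig M W \<and> neg_eig M U = neg_eig M W"
    if "spectral_le M U W" "spectral_le M W U" for U W
    using that unfolding spectral_le_def by (auto intro!: ext antisym)
  have less: "spectral_le M U W \<and> \<not> spectral_le M W U"
    if U: "graphon M U" and W: "graphon M W" and env: "env_less M U W" for U W
  proof -
    \<comment> \<open>A graphon lies in its own envelope, so inclusion of envelopes makes
      \<open>U\<close> a weak* limit of versions of \<open>W\<close>.\<close>
    have UW: "U \<in> envelope M W"
      using graphon_in_envelope[OF U] env unfolding env_less_def env_le_def by blast
    have le: "spectral_le M U W" by (rule spectral_le_if_in_envelope[OF W UW])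
    \<comment> \<open>Otherwise the spectra agree, which forces the reverse inclusion of
      envelopes.\<close>
    have "\<not> spectral_le M W U"
      using env_le_if_same_spectrum[OF U W UW] same[OF le] env unfolding env_less_def by blast
    then show ?thesis using le by blast
  qed
  have "graphon_order M (spectral_le M)"
    unfolding graphon_order_def
  proof (intro conjI allI impI)
    show "reflp_on {W. graphon M W} (spectral_le M)"
      unfolding spectral_le_def by (rule reflp_onI) auto
    show "transp_on {W. graphon M W} (spectral_le M)"
      unfolding spectral_le_def by (rule transp_onI) (meson order_trans)
  qed (use cut in blast)+
  moreover have "cut_distance_identifying M (spectral_le M)"
    unfolding cut_distance_identifying_def using less by blast
  \<comment> \<open>The quasiorder is entrywise, so failure of the converse exhibits an index with a
    strict inequality.\<close>
  moreover have "spectral_less M U W" if "graphon M U" "graphon M W" "env_less M U W" for U W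
    using less[OF that] unfolding spectral_less_def spectral_le_def by (meson not_le)
  ultimately show ?thesis using cut same by metis
qed

end
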